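(* Let $l\ge r\ge2$ be integers with $[\,l\,]_{r-1}\in\{0,1\}$ (i.e. $l\equiv0$ or $l\equiv 1\bmod (r-1)$; for $r=2$ only the case "$l\equiv1$" below is to be used), and let $(\mathbb{C}^r/G,[\mathbf 0])=(X(N_G,\Delta_G),\mathrm{orb}(\sigma_0))$ be the Gorenstein cyclic quotient singularity of type $\frac1l(1,\ldots,1,l-(r-1))$ (with $r-1$ entries equal to $1$). Let $\kappa$ and the triangulations $\mathfrak T_1,\ldots,\mathfrak T_\kappa$ of the junior simplex be as defined in the context. Then the birational crepant resolution morphism $f=f_{\mathcal T}:X(N_G,\widehat\Delta_G(\mathcal T))\to X(N_G,\Delta_G)$ is the composite of the $\kappa$ toric morphisms $$X_0:=X(N_G,\Delta_G)\xleftarrow{g_1}X_1\xleftarrow{g_2}X_2\longleftarrow\cdots\xleftarrow{g_{\kappa-1}}X_{\kappa-1}\xleftarrow{g_\kappa}X_\kappa:=X(N_G,\widehat\Delta_G(\mathcal T))$$ with $X_i:=X(N_G,\widehat\Delta_G(\mathfrak T_i))$ for $1\le i\le\kappa-1$, and $\mathcal T=\mathfrak T_\kappa$. In particular, one has $$X_{i+1}\cong\mathrm{Norm}\bigl[\mathbf{Bl}^{\mathrm{red}}_{Z_i}(X_i)\bigr],\qquad 0\le i\le\kappa-1,$$ with centers $$Z_i=\begin{cases}\mathrm{orb}(\sigma_0),&\text{if } i=0,\\ V\bigl(\mathrm{pos}(\{n^{(i)},n^{(\frac{l-1}{r-1}-i+1)}\})\bigr),&\text{if }\kappa\ge2,\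 1\le i\le\kappa-1,\ l\equiv1\bmod(r-1),\\ V\bigl(\mathrm{pos}(\{n^{(i)},n^{(\frac{l}{r-1}-i)}\})\bigr),&\text{if }\kappa\ge3,\ 1\le i\le\kappa-2,\ l\equiv0\bmod(r-1),\\ V\bigl(\mathrm{pos}(\{e_1,e_2,\ldots,e_{r-1}\})\bigr),&\text{if } i=\kappa-1,\ l\equiv0\bmod(r-1).\end{cases}$$
   Context: Type $\frac1l(\alpha_1,\dots,\alpha_r)$ means that $G\subset \mathrm{GL}(r,\mathbb C)$ is the cyclic group of order $l$ generated by $\mathrm{diag}(\zeta_l^{\alpha_1},\ldots,\zeta_l^{\alpha_r})$, $\zeta_l=e^{2\pi\sqrt{-1}/l}$, acting on $\mathbb C^r$. $e_1,\dots,e_r$ is the standard basis, $N_G=\mathbb Z^r+\mathbb Z\cdot\frac1l(\alpha_1,\ldots,\alpha_r)^{\intercal}$, $\sigma_0=\mathrm{pos}(\{e_1,\dots,e_r\})$ (positive hull), $\Delta_G$ the fan of $\sigma_0$ and its faces; $X(N_G,\Delta_G)=\mathbb C^r/G$, and $\mathrm{orb}(\sigma_0)=[\mathbf 0]$ is the image of the origin. $\mathfrak s_G=\mathrm{conv}(e_1,\dots,e_r)$ is the junior simplex. $[\mu]_\nu$ is the residue of $\mu$ modulo $\nu$ in $\{0,\dots,\nu-1\}$. Let $\nu=\frac{l-1}{r-1}$ if $l\equiv1$, and $\nu=\frac l{r-1}$ if $l\equiv 0\bmod(r-1)$. Put $n^{(0)}=e_r$ and $n^{(j)}=\frac1l(j,\ldots,j,l-j(r-1))^{\intercal}$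 for $1\le j\le\nu$. Let $\Xi_r$ be the set of $(r-2)$-tuples $\xi=(\xi_1<\cdots<\xi_{r-2})$ of elements of $\{1,\ldots,r-1\}$, and $\mathbf s(j,j';\xi)=\mathrm{conv}(n^{(j)},n^{(j')},e_{\xi_1},\ldots,e_{\xi_{r-2}})$ for $0\le j\le j'\le\nu$ (of lower dimension when $j=j'$). For a set of simplices given below, all faces are always added, and $\xi$ runs over all of $\Xi_r$. $\mathcal T$ is the unique lattice triangulation of $\mathfrak s_G$ with vertex set $\mathfrak s_G\cap N_G$: its maximal simplices are $\mathbf s(j-1,j;\xi)$, $1\le j\le\nu$, and, if $l\equiv1\bmod(r-1)$, also $\mathrm{conv}(n^{(\nu)},e_1,\ldots,e_{r-1})$. $\kappa:=\lfloor\frac12(\frac{l-1}{r-1}+1)\rfloor$ if $l\equiv1$, and $\kappa:=\lfloor\frac12\cdot\frac l{r-1}\rfloor+1$ if $l\equiv0\bmod(r-1)$. Case $l\equiv 1\bmod(r-1)$: $\mathfrak T_1$ consists of $\mathbf s(0,1;\xi)$, $\mathbf s(1,\nu;\xi)$, $\mathrm{conv}(n^{(\nu)},e_1,\dots,e_{r-1})$ and their faces. For $\kappa\ge2$ and $1\le i\le\kappa-1$, $\mathfrak T_{i+1}$ arises from $\mathfrak T_i$ by replacing each $\mathbf s(i,\nu-i+1;\xi)$ by $\mathbf s(i,i+1;\xi)$, $\mathbf s(i+1,\nu-i;\xi)$, $\mathbf s(\nu-i,\nu-i+1;\xi)$. Case $l\equiv0\bmod(r-1)$: $\mathfrak T_1$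 consists of $\mathbf s(0,1;\xi)$, $\mathbf s(1,\nu-1;\xi)$, $\mathrm{conv}(n^{(\nu-1)},e_1,\dots,e_{r-1})$ and their faces. For $\kappa\ge3$ and $1\le i\le\kappa-2$, $\mathfrak T_{i+1}$ arises from $\mathfrak T_i$ by replacing each $\mathbf s(i,\nu-i;\xi)$ by $\mathbf s(i,i+1;\xi)$, $\mathbf s(i+1,\nu-i-1;\xi)$, $\mathbf s(\nu-i-1,\nu-i;\xi)$. Finally $\mathfrak T_\kappa$ arises from $\mathfrak T_{\kappa-1}$ by replacing $\mathrm{conv}(n^{(\nu-1)},e_1,\dots,e_{r-1})$ by the simplices $\mathbf s(\nu-1,\nu;\xi)$. For a triangulation $\mathfrak T$ of $\mathfrak s_G$, $\widehat\Delta_G(\mathfrak T)$ is the fan of cones $\mathbb R_{\ge0}\mathbf s$, $\mathbf s\in\mathfrak T$; all morphisms between the corresponding toric varieties are those induced by the identity of $N_G$. $V(\tau)$ is the closure of the orbit of the cone $\tau$ in the toric variety under consideration. $\mathbf{Bl}^{\mathrm{red}}_Z(X)$ is the usual blow-up of $X$ along $Z$ with its reduced scheme structure, and $\mathrm{Norm}[\cdot]$ denotes normalization. *)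

theory Defs
  imports
    "HOL-Analysis.Analysis"
    "HOL-Library.Poly_Mapping"
    "HOL-Computational_Algebra.Fraction_Field"
    "HOL-Computational_Algebra.Polynomial"
    "HOL-Number_Theory.Cong"
    "HOL-Algebra.Generated_Rings"
    "HOL-Algebra.Ideal"
begin

section \<open>Integral schemes inside a fixed field\<close>

text \<open>
  A separated integral scheme of finite type with function field inside a field \<open>K\<close> is
  determined by the set of its local rings, regarded as subrings of \<open>K\<close> (Zariski's models;
  Chevalley schemes, EGA I, Section 8.3).  Such a scheme is represented here by that set: its members
  are the scheme-theoretic points (the generic point is the function field, closed points are the
  minimal members), the member itself is the stalk, and a ring of sections is an intersection of
  stalks.  For schemes \<open>Y\<close>, \<open>X\<close> with the same function field, a morphism \<open>Y \<rightarrow> X\<close> inducing the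
  identity of the function field exists iff each local ring of \<open>Y\<close> dominates one of \<open>X\<close>; the morphism
  then sends the point \<open>S\<close> to the unique local ring of \<open>X\<close> dominated by \<open>S\<close>, and its maps on stalks
  are the inclusions.  Consequently, two schemes that are birational over \<open>X\<close> are isomorphic over \<open>X\<close>
  iff their sets of local rings are equal.
\<close>

definition field_ring :: "'k::field ring" where
  "field_ring = \<lparr>carrier = UNIV, monoid.mult = (*), one = 1, ring.zero = 0, add = (+)\<rparr>"

definition localization :: "'k::field set \<Rightarrow> 'k set \<Rightarrow> 'k set" where
  "localization A P = {a / b | a b. a \<in> A \<and> b \<in> A \<and> b \<notin> P}"

definition Spec :: "'k::field set \<Rightarrow> 'k set set" where
  "Spec A = {localization A P | P. primeideal P (field_ring\<lparr>carrier := A\<rparr>)}"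

definition max_ideal :: "'k::field set \<Rightarrow> 'k set" where
  "max_ideal R = {x \<in> R. x = 0 \<or> inverse x \<notin> R}"

definition dominates :: "'k::field set \<Rightarrow> 'k set \<Rightarrow> bool" where
  "dominates S R \<longleftrightarrow> R \<subseteq> S \<and> max_ideal R = max_ideal S \<inter> R"

definition birational_morphism :: "'k::field set set \<Rightarrow> 'k set set \<Rightarrow> bool" where
  "birational_morphism Y X \<longleftrightarrow> (\<forall>S\<in>Y. \<exists>!R. R \<in> X \<and> dominates S R)"

text \<open>The map on points, meaningful on those \<open>S\<close> that dominate exactly one member of \<open>X\<close>.\<close>

definition birational_map :: "'k::field set set \<Rightarrow> 'k set \<Rightarrow> 'k set" where
  "birational_map X S = (THE R. R \<in> X \<and> dominates S R)"

text \<open>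
  The Zariski topology.  The sets \<open>{R \<in> X. x \<in> R}\<close> (domains of definition of rational functions) are
  open; conversely, if \<open>Spec A\<close> is an affine open subset of \<open>X\<close> and \<open>A\<close> is generated by
  \<open>x\<^sub>1, \<dots>, x\<^sub>n\<close>, then its principal open subset given by \<open>f\<close> consists of the members of \<open>X\<close> that
  contain \<open>x\<^sub>1, \<dots>, x\<^sub>n\<close> and \<open>1/f\<close>.
\<close>

definition zariski :: "'k::field set set \<Rightarrow> 'k set topology" where
  "zariski X = topology_generated_by (range (\<lambda>x. {R \<in> X. x \<in> R}))"

text \<open>
  Stalk at \<open>R\<close> of the ideal sheaf of the closed subset \<open>Z\<close> with its reduced structure: the
  intersection of the primes of \<open>R\<close> belonging to the points \<open>S\<close> of \<open>Z\<close> that specialize to \<open>R\<close>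
  (that is, \<open>R \<subseteq> S\<close>).
\<close>

definition reduced_ideal :: "'k::field set set \<Rightarrow> 'k set \<Rightarrow> 'k set" where
  "reduced_ideal Z R = {x \<in> R. \<forall>S\<in>Z. R \<subseteq> S \<longrightarrow> x \<in> max_ideal S}"

text \<open>
  For an ideal \<open>I\<close> of a domain \<open>R\<close>, \<open>Proj (\<Oplus> I\<^sup>n)\<close> is covered by the affine charts \<open>Spec R[I/f]\<close> with
  \<open>0 \<noteq> f \<in> I\<close>; \<open>R[I/f]\<close> is the degree-zero part of the Rees algebra localized at \<open>f\<close> in degree one.
  As blowing up commutes with localization, the blow-up of \<open>X\<close> is the union of the blow-ups of its
  local schemes.
\<close>

definition blowup_chart :: "'k::field set \<Rightarrow> 'k set \<Rightarrow> 'k \<Rightarrow> 'k set" where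
  "blowup_chart R I f = generate_ring field_ring (R \<union> {g / f | g. g \<in> I})"

definition blowup_red :: "'k::field set set \<Rightarrow> 'k set set \<Rightarrow> 'k set set" where
  "blowup_red Z X =
     (\<Union>R\<in>X. \<Union>f\<in>reduced_ideal Z R - {0}. Spec (blowup_chart R (reduced_ideal Z R) f))"

definition integral_closure :: "'k::field set \<Rightarrow> 'k set" where
  "integral_closure A =
     {x. (\<exists>a\<in>A. \<exists>b\<in>A. b \<noteq> 0 \<and> x = a / b) \<and>
         (\<exists>p. Polynomial.lead_coeff p = 1 \<and> (\<forall>i. Polynomial.coeff p i \<in> A) \<and> poly p x = 0)}"

definition normalization :: "'k::field set set \<Rightarrow> 'k set set" where
  "normalization X = (\<Union>R\<in>X. Spec (integral_closure R))"


section \<open>Toric varieties over the complex numbers\<close>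

text \<open>
  \<open>'n\<close> indexes the coordinates of the ambient space, so \<open>r = CARD('n)\<close>.  All lattices \<open>N\<close>
  considered contain the standard lattice, hence the dual lattice consists of integral vectors, and
  the function field of the torus lies in the field of fractions of the Laurent polynomial ring in
  the variables indexed by \<open>'n\<close>.  The order on \<open>'n\<close> makes that ring an integral domain by type class
  and singles out the last coordinate.
\<close>

type_synonym 'n ratfun = "(('n \<Rightarrow>\<^sub>0 int) \<Rightarrow>\<^sub>0 complex) fract"

definition pairing :: "('n::finite \<Rightarrow>\<^sub>0 int) \<Rightarrow> real^'n \<Rightarrow> real" where
  "pairing m u = (\<Sum>i\<in>UNIV. of_int (Poly_Mapping.lookup m i) * u $ i)"

definition dual_lattice :: "(real^'n) set \<Rightarrow> ('n::finite \<Rightarrow>\<^sub>0 int) set" where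
  "dual_lattice N = {m. \<forall>u\<in>N. pairing m u \<in> \<int>}"

definition dual_semigroup :: "(real^'n) set \<Rightarrow> (real^'n) set \<Rightarrow> ('n::finite \<Rightarrow>\<^sub>0 int) set" where
  "dual_semigroup N \<sigma> = {m \<in> dual_lattice N. \<forall>u\<in>\<sigma>. pairing m u \<ge> 0}"

definition laurent_character :: "('n::{finite,linorder} \<Rightarrow>\<^sub>0 int) \<Rightarrow> 'n ratfun" where
  "laurent_character m = Fract (Poly_Mapping.single m 1) 1"

definition semigroup_algebra :: "('n::{finite,linorder} \<Rightarrow>\<^sub>0 int) set \<Rightarrow> 'n ratfun set" where
  "semigroup_algebra M = {Fract p 1 | p. Poly_Mapping.keys p \<subseteq> M}"

definition affine_toric ::
    "(real^'n::{finite,linorder}) set \<Rightarrow> (real^'n::{finite,linorder}) set \<Rightarrow> 'n ratfun set set" where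
  "affine_toric N \<sigma> = Spec (semigroup_algebra (dual_semigroup N \<sigma>))"

definition toric_variety ::
    "(real^'n::{finite,linorder}) set \<Rightarrow> (real^'n::{finite,linorder}) set set \<Rightarrow> 'n ratfun set set" where
  "toric_variety N \<Delta> = (\<Union>\<sigma>\<in>\<Delta>. affine_toric N \<sigma>)"

text \<open>
  The orbit of \<open>\<tau>\<close> is the closed subset of the affine toric variety of \<open>\<tau>\<close> on which the characters
  that are nonnegative on \<open>\<tau>\<close> but do not vanish identically on it are zero.
\<close>

definition orb ::
    "(real^'n::{finite,linorder}) set \<Rightarrow> (real^'n::{finite,linorder}) set \<Rightarrow> 'n ratfun set set" where
  "orb N \<tau> = {R \<in> affine_toric N \<tau>.
     \<forall>m\<in>dual_semigroup N \<tau>. (\<exists>u\<in>\<tau>. pairing m u \<noteq> 0) \<longrightarrow> laurent_character m \<in> max_ideal R}"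

definition orbit_closure ::
    "(real^'n::{finite,linorder}) set \<Rightarrow> (real^'n::{finite,linorder}) set set \<Rightarrow> (real^'n::{finite,linorder}) set \<Rightarrow> 'n ratfun set set"
  where "orbit_closure N \<Delta> \<tau> = zariski (toric_variety N \<Delta>) closure_of orb N \<tau>"

text \<open>Existence of the toric morphism induced by the identity of the common lattice.\<close>

definition toric_compatible :: "(real^'n) set set \<Rightarrow> (real^'n) set set \<Rightarrow> bool" where
  "toric_compatible \<Delta>' \<Delta> \<longleftrightarrow> (\<forall>\<sigma>'\<in>\<Delta>'. \<exists>\<sigma>\<in>\<Delta>. \<sigma>' \<subseteq> \<sigma>)"

definition pos :: "(real^'n) set \<Rightarrow> (real^'n) set" where
  "pos A = convex_cone hull A"


section \<open>The cyclic quotient singularity and its triangulations\<close>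

definition last_index :: "'n::{finite,linorder}" where
  "last_index = Max UNIV"

definition unit_vec :: "'n::finite \<Rightarrow> real^'n" where
  "unit_vec i = axis i 1"

definition N_G :: "nat \<Rightarrow> (real^'n::{finite,linorder}) set" where
  "N_G l = {z + of_int k *\<^sub>R (\<chi> i. (if i = last_index then real l - (real CARD('n) - 1) else 1) / real l)
            | z k. \<forall>i. z $ i \<in> \<int>}"

definition \<sigma>0 :: "(real^'n::finite) set" where
  "\<sigma>0 = pos (range unit_vec)"

definition \<Delta>_G :: "(real^'n::finite) set set" where
  "\<Delta>_G = {pos B | B. B \<subseteq> range unit_vec}"

text \<open>The lattice points \<open>n\<^sup>(\<^sup>j\<^sup>)\<close>; in particular \<open>npt l 0\<close> is the last standard basis vector.\<close>

definition npt :: "nat \<Rightarrow> nat \<Rightarrow> real^'n::{finite,linorder}" where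
  "npt l j =
     (\<chi> i. (if i = last_index then real l - real j * (real CARD('n) - 1) else real j) / real l)"

text \<open>
  For \<open>r = 2\<close> both congruences hold; testing this one first selects the intended case.
\<close>

definition case_one :: "nat \<Rightarrow> nat \<Rightarrow> bool" where
  "case_one l r \<longleftrightarrow> [l = 1] (mod (r - 1))"

definition nu :: "nat \<Rightarrow> nat \<Rightarrow> nat" where
  "nu l r = (if case_one l r then (l - 1) div (r - 1) else l div (r - 1))"

definition kappa :: "nat \<Rightarrow> nat \<Rightarrow> nat" where
  "kappa l r = (if case_one l r then ((l - 1) div (r - 1) + 1) div 2 else (l div (r - 1)) div 2 + 1)"

definition \<Xi> :: "'n::{finite,linorder} set set" where
  "\<Xi> = {\<xi>. \<xi> \<subseteq> - {last_index} \<and> card \<xi> = CARD('n) - 2}"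

text \<open>
  Generating simplices are given by their vertex sets, \<open>simplices l j j'\<close> being those of all
  \<open>\<s>(j,j';\<xi>)\<close>; \<open>complex_of\<close> passes to the convex hulls and adds all faces
  (including the empty one, which yields the zero cone of the fan).
\<close>

definition simplices :: "nat \<Rightarrow> nat \<Rightarrow> nat \<Rightarrow> (real^'n::{finite,linorder}) set set" where
  "simplices l j j' = {{npt l j, npt l j'} \<union> unit_vec ` \<xi> | \<xi>. \<xi> \<in> \<Xi>}"

definition base_simplex :: "nat \<Rightarrow> nat \<Rightarrow> (real^'n::{finite,linorder}) set" where
  "base_simplex l j = insert (npt l j) (unit_vec ` (- {last_index}))"

definition complex_of :: "(real^'n) set set \<Rightarrow> (real^'n) set set" where
  "complex_of G = {convex hull B | A B. A \<in> G \<and> B \<subseteq> A}"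

definition fan_of :: "(real^'n) set set \<Rightarrow> (real^'n) set set" where
  "fan_of T = pos ` T"

definition full_triangulation :: "nat \<Rightarrow> (real^'n::{finite,linorder}) set set" where
  "full_triangulation l =
     (let \<nu> = nu l CARD('n) in
      complex_of ((\<Union>j\<in>{1..\<nu>}. simplices l (j - 1) j) \<union>
                  (if case_one l CARD('n) then {base_simplex l \<nu>} else {})))"

text \<open>
  The second argument \<open>k\<close> of the next two functions stands for the triangulation with index
  \<open>k + 1\<close>; in the second one the final replacement is not yet included.
\<close>

primrec gens_one :: "nat \<Rightarrow> nat \<Rightarrow> (real^'n::{finite,linorder}) set set" where
  "gens_one l 0 =
     (let \<nu> = nu l CARD('n) in
      simplices l 0 1 \<union> simplices l 1 \<nu> \<union> {base_simplex l \<nu>})"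
| "gens_one l (Suc k) =
     (let \<nu> = nu l CARD('n); i = Suc k in
      (gens_one l k - simplices l i (\<nu> - i + 1))
        \<union> simplices l i (i + 1) \<union> simplices l (i + 1) (\<nu> - i) \<union> simplices l (\<nu> - i) (\<nu> - i + 1))"

primrec gens_zero :: "nat \<Rightarrow> nat \<Rightarrow> (real^'n::{finite,linorder}) set set" where
  "gens_zero l 0 =
     (let \<nu> = nu l CARD('n) in
      simplices l 0 1 \<union> simplices l 1 (\<nu> - 1) \<union> {base_simplex l (\<nu> - 1)})"
| "gens_zero l (Suc k) =
     (let \<nu> = nu l CARD('n); i = Suc k in
      (gens_zero l k - simplices l i (\<nu> - i))
        \<union> simplices l i (i + 1) \<union> simplices l (i + 1) (\<nu> - i - 1) \<union> simplices l (\<nu> - i - 1) (\<nu> - i))"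

text \<open>The triangulation with index \<open>i\<close>, for \<open>1 \<le> i \<le> \<kappa>\<close>.\<close>

definition triangulation_seq :: "nat \<Rightarrow> nat \<Rightarrow> (real^'n::{finite,linorder}) set set" where
  "triangulation_seq l i =
     (let \<nu> = nu l CARD('n); \<kappa> = kappa l CARD('n) in
      complex_of
        (if case_one l CARD('n) then gens_one l (i - 1)
         else if i < \<kappa> then gens_zero l (i - 1)
         else (gens_zero l (\<kappa> - 2) - {base_simplex l (\<nu> - 1)}) \<union> simplices l (\<nu> - 1) \<nu>))"

definition fan_seq :: "nat \<Rightarrow> nat \<Rightarrow> (real^'n::{finite,linorder}) set set" where
  "fan_seq l i =
     (if i = 0 then \<Delta>_G
      else if i < kappa l CARD('n) then fan_of (triangulation_seq l i)
      else fan_of (full_triangulation l))"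

definition X_seq :: "nat \<Rightarrow> nat \<Rightarrow> ('n::{finite,linorder}) ratfun set set" where
  "X_seq l i = toric_variety (N_G l) (fan_seq l i)"

definition center :: "nat \<Rightarrow> nat \<Rightarrow> ('n::{finite,linorder}) ratfun set set" where
  "center l i =
     (let \<nu> = nu l CARD('n); \<kappa> = kappa l CARD('n); V = orbit_closure (N_G l) (fan_seq l i) in
      if i = 0 then orb (N_G l) \<sigma>0
      else if case_one l CARD('n) then V (pos {npt l i, npt l (\<nu> - i + 1)})
      else if i < \<kappa> - 1 then V (pos {npt l i, npt l (\<nu> - i)})
      else V (pos (unit_vec ` (- {last_index}))))"

end

theory Submission
  imports Defs
begin

text \<open>
  Since schemes are sets of local rings, \<open>X\<^sub>i\<^sub>+\<^sub>1\<close> and the normalized blow-up can be compared as sets.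
  The ideal of the center at a local ring is determined by the local ring at the generic point of
  the center, so blowing up is local, and over an affine toric chart the ideal is spanned by the
  characters that are nonnegative on the cone of the chart and positive in the interior of the cone of
  the center.  On each local ring over the blow-up this ideal is generated by one of a few explicit
  characters, one for each new maximal cone, and adjoining to the chart the quotients by such a
  character gives precisely the algebra of the semigroup dual to the new cone.  These algebras are
  integrally closed: all blow-ups in the sequence are already normal.  If a local ring dominates at
  most one member of \<open>X\<close>, then it dominates at most one member of a blow-up of \<open>X\<close>; this gives all
  morphisms and their composition.  An exponent \<open>m\<close> in the dual lattice is determined by its coordinates
  \<open>m\<^sub>2, \<dots>, m\<^sub>r\<close> and an integer \<open>x\<close> such that its value on \<open>n\<^sup>(\<^sup>j\<^sup>)\<close> is \<open>j x + m\<^sub>r\<close>, so the semigroup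
  computations are two-dimensional.
\<close>

section \<open>Local rings in a field\<close>

text \<open>The number of steps comes from surface singularities. For an exponent in the dual
  lattice with values s at \<open>npt l a\<close> and t at \<open>npt l b\<close>, b - a divides t -
  s. So transversally to a two-dimensional center cone the chart is u v = w^(b-a), with maximal
  ideal spanned by the exponents (b-a,0), (1,1), (0,b-a); blowing it up cuts one unit interval off
  either end, and the long interval shrinks by two per step. If r > 2 and l is congruent to 0, the
  cone over the base simplex stays singular, a line times the quotient of type 1/(r-1)(1,...,1),
  whence the extra last step. Two reductions make the blow-ups combinatorial. Where an element a
  generates the ideal, the monomials of a divided by a add up, with scalar coefficients, to 1; in a
  local ring one of them is a unit, so a character generates as well. At the origin the explicit
  characters need not generate the ideal itself: an exponent is first concentrated on one coordinate
  p, which is possible only where the quotients of the coordinates by x_p are regular. Hence the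
  covering condition quantifies over submonoids \<Lambda> instead of naming generators of the
  ideal.\<close>

definition unital_subring :: "'k::field set \<Rightarrow> bool" where
  "unital_subring A \<longleftrightarrow> 1 \<in> A \<and> (\<forall>x\<in>A. \<forall>y\<in>A. x - y \<in> A \<and> x * y \<in> A)"

text \<open>\<open>max_ideal\<close> is by definition the set of nonunits, so closure under sums is
  all that locality adds; absorption of ring elements is automatic
  (\<open>max_ideal_mult\<close>).\<close>

definition local_subring :: "'k::field set \<Rightarrow> bool" where
  "local_subring S \<longleftrightarrow> unital_subring S \<and> (\<forall>x\<in>max_ideal S. \<forall>y\<in>max_ideal S. x + y \<in> max_ideal S)"

lemma unital_subringD:
  assumes "unital_subring A"
  shows "1 \<in> A" "0 \<in> A" "x \<in> A \<Longrightarrow> y \<in> A \<Longrightarrow> x + y \<in> A" "x \<in> A \<Longrightarrow> y \<in> A \<Longrightarrow> x - y \<in> A"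
    "x \<in> A \<Longrightarrow> y \<in> A \<Longrightarrow> x * y \<in> A" "x \<in> A \<Longrightarrow> - x \<in> A" "x \<in> A \<Longrightarrow> x ^ n \<in> A"
proof -
  have d: "1 \<in> A" "\<And>x y. x \<in> A \<Longrightarrow> y \<in> A \<Longrightarrow> x - y \<in> A" "\<And>x y. x \<in> A \<Longrightarrow> y \<in> A \<Longrightarrow> x * y \<in> A"
    using assms by (auto simp: unital_subring_def)
  have z: "0 \<in> A" using d(2)[OF d(1) d(1)] by simp
  have m: "- x \<in> A" if "x \<in> A" for x using d(2)[OF z that] by simp
  have p: "x + y \<in> A" if "x \<in> A" "y \<in> A" for x y using d(2)[OF that(1) m[OF that(2)]] by simp
  have w: "x ^ n \<in> A" if "x \<in> A" for x n using that by (induction n) (auto intro: d)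
  show "1 \<in> A" "0 \<in> A" "x \<in> A \<Longrightarrow> y \<in> A \<Longrightarrow> x + y \<in> A" "x \<in> A \<Longrightarrow> y \<in> A \<Longrightarrow> x - y \<in> A"
    "x \<in> A \<Longrightarrow> y \<in> A \<Longrightarrow> x * y \<in> A" "x \<in> A \<Longrightarrow> - x \<in> A" "x \<in> A \<Longrightarrow> x ^ n \<in> A"
    using d z m p w by auto
qed

lemma unital_subring_sum:
  "unital_subring A \<Longrightarrow> (\<And>i. i \<in> F \<Longrightarrow> f i \<in> A) \<Longrightarrow> sum f F \<in> A"
  by (induction F rule: infinite_finite_induct) (auto intro: unital_subringD)

lemma local_subringD:
  assumes "local_subring S"
  shows "unital_subring S" "x \<in> max_ideal S \<Longrightarrow> y \<in> max_ideal S \<Longrightarrow> x + y \<in> max_ideal S"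
  using assms by (auto simp: local_subring_def)

lemma max_ideal_mult:
  assumes "unital_subring S" "x \<in> max_ideal S" "y \<in> S"
  shows "x * y \<in> max_ideal S"
proof (cases "x * y = 0")
  case False
  have "inverse (x * y) \<notin> S"
  proof
    assume "inverse (x * y) \<in> S"
    then have "inverse (x * y) * y \<in> S" using assms by (simp only: unital_subringD)
    then have "inverse x \<in> S" using False by (simp add: field_simps)
    then show False using assms(2) False by (auto simp: max_ideal_def)
  qed
  then show ?thesis using assms unital_subringD by (auto simp: max_ideal_def)
qed (use assms in \<open>auto simp: max_ideal_def unital_subringD\<close>)

lemma max_ideal_sum:
  assumes "local_subring S"
  shows "(\<And>i. i \<in> F \<Longrightarrow> f i \<in> max_ideal S) \<Longrightarrow> sum f F \<in> max_ideal S"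
proof (induction F rule: infinite_finite_induct)
  have z: "0 \<in> max_ideal S"
    using assms by (auto simp: max_ideal_def local_subring_def unital_subringD)
  case (infinite A) with z show ?case by simp
next
  case empty
  then show ?case using assms by (auto simp: max_ideal_def local_subring_def unital_subringD)
next
  case (insert x F)
  then show ?case using local_subringD(2)[OF assms] by simp
qed

lemma cring_field_ring: "cring (field_ring :: 'k::field ring)"
proof (rule cringI)
  show "abelian_group (field_ring :: 'k ring)"
    by (rule abelian_groupI) (auto simp: field_ring_def intro: exI[of _ "- _"] add.left_inverse)
  show "comm_monoid (field_ring :: 'k ring)"
    by (rule comm_monoidI) (auto simp: field_ring_def)
qed (auto simp: field_ring_def algebra_simps)

interpretation field_ring: cring "field_ring :: 'k::field ring" by (rule cring_field_ring)

lemma field_ring_simps [simp]: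
  "carrier field_ring = UNIV" "x \<otimes>\<^bsub>field_ring\<^esub> y = x * y" "x \<oplus>\<^bsub>field_ring\<^esub> y = x + y"
  "\<one>\<^bsub>field_ring\<^esub> = 1" "\<zero>\<^bsub>field_ring\<^esub> = 0"
  by (auto simp: field_ring_def)

lemma a_inv_field_ring [simp]: "\<ominus>\<^bsub>field_ring\<^esub> x = - x"
  using field_ring.minus_equality[of "- x" x] by simp

lemma subring_field_ring_iff: "subring A field_ring \<longleftrightarrow> unital_subring A"
proof
  assume "subring A field_ring"
  note s = subringE[OF this]
  show "unital_subring A"
    unfolding unital_subring_def
  proof (intro conjI ballI)
    fix x y assume xy: "x \<in> A" "y \<in> A"
    then have "x + (- y) \<in> A" using s(5,7) by (metis a_inv_field_ring field_ring_simps(3))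
    then show "x - y \<in> A" by simp
    show "x * y \<in> A" using s(6) xy by fastforce
  qed (use s in auto)
next
  assume "unital_subring A"
  then show "subring A field_ring"
    by (intro field_ring.subringI) (auto simp: unital_subringD)
qed

lemma generated_unital_subring: "unital_subring (generate_ring field_ring H)"
  using field_ring.generate_ring_is_subring[of H] by (simp add: subring_field_ring_iff)

lemma generated_least:
  "unital_subring E \<Longrightarrow> H \<subseteq> E \<Longrightarrow> generate_ring field_ring H \<subseteq> E"
  using field_ring.generate_ring_min_subring1[of H E] by (simp add: subring_field_ring_iff)

lemma blowup_chart:
  "unital_subring (blowup_chart R I f)" "R \<subseteq> blowup_chart R I f"
  "g \<in> I \<Longrightarrow> g / f \<in> blowup_chart R I f"
  "unital_subring E \<Longrightarrow> R \<subseteq> E \<Longrightarrow> (\<And>g. g \<in> I \<Longrightarrow> g / f \<in> E) \<Longrightarrow> blowup_chart R I f \<subseteq> E"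
proof -
  let ?H = "R \<union> {g / f |g. g \<in> I}"
  show "unital_subring (blowup_chart R I f)"
    by (simp add: blowup_chart_def generated_unital_subring)
  show "R \<subseteq> blowup_chart R I f" "g \<in> I \<Longrightarrow> g / f \<in> blowup_chart R I f"
    by (auto simp: blowup_chart_def intro: generate_ring.incl)
  assume E: "unital_subring E" "R \<subseteq> E" "\<And>g. g \<in> I \<Longrightarrow> g / f \<in> E"
  then have "?H \<subseteq> E" by auto
  then show "blowup_chart R I f \<subseteq> E"
    unfolding blowup_chart_def by (rule generated_least[OF E(1)])
qed

text \<open>Elementwise form of \<open>primeideal\<close> for a subring of a field; it keeps records
  and locales out of the later arguments.\<close>

definition prime_in :: "'k::field set \<Rightarrow> 'k set \<Rightarrow> bool" where
  "prime_in P A \<longleftrightarrow> P \<subseteq> A \<and> 0 \<in> P \<and> (\<forall>x\<in>P. \<forall>y\<in>P. x + y \<in> P) \<and> (\<forall>x\<in>P. \<forall>y\<in>A. x * y \<in> P)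
    \<and> 1 \<notin> P \<and> (\<forall>x\<in>A. \<forall>y\<in>A. x * y \<in> P \<longrightarrow> x \<in> P \<or> y \<in> P)"

lemma primeideal_iff:
  assumes A: "unital_subring A"
  shows "primeideal P (field_ring\<lparr>carrier := A\<rparr>) \<longleftrightarrow> prime_in P A"
proof
  let ?R = "field_ring\<lparr>carrier := A\<rparr>"
  assume "primeideal P ?R"
  then interpret primeideal P ?R .
  have "1 \<notin> P" using I_notcarr one_imp_carrier by auto
  then show "prime_in P A"
    unfolding prime_in_def
    using a_subset additive_subgroup.zero_closed[OF additive_subgroup_axioms]
      additive_subgroup.a_closed[OF additive_subgroup_axioms] I_r_closed I_prime
    by auto
next
  let ?R = "field_ring\<lparr>carrier := A\<rparr>"
  assume P: "prime_in P A"
  have "cring ?R"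
    using field_ring.subcring_iff[of A] field_ring.subcringI'[of A] A by (simp add: subring_field_ring_iff)
  moreover from this interpret R: cring ?R .
  have "- 1 \<in> A" using A by (simp add: unital_subringD)
  then have neg: "- x \<in> P" if "x \<in> P" for x
    using P that unfolding prime_in_def by (metis mult.right_neutral mult_minus_right)
  have inv: "\<ominus>\<^bsub>?R\<^esub> x = - x" if "x \<in> A" for x
    using R.minus_equality[of "- x" x] that A by (simp add: unital_subringD)
  have "ideal P ?R"
  proof (rule idealI)
    show "ring ?R" by (rule R.ring_axioms)
    show "subgroup P (add_monoid ?R)"
    proof (rule R.add.subgroupI)
      fix x assume x: "x \<in> P"
      then have "x \<in> A" using P by (auto simp: prime_in_def)
      then show "\<ominus>\<^bsub>?R\<^esub> x \<in> P" using neg[OF x] inv by simp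
    qed (use P in \<open>auto simp: prime_in_def\<close>)
  qed (use P in \<open>auto simp: prime_in_def mult.commute\<close>)
  ultimately show "primeideal P ?R"
    using P A by (intro primeidealI) (auto simp: prime_in_def unital_subringD)
qed

lemma local_subring_localization:
  assumes A: "unital_subring A" and P: "prime_in P A"
  shows "local_subring (localization A P)" and "A \<subseteq> localization A P"
    and "x \<in> A \<Longrightarrow> x \<in> max_ideal (localization A P) \<longleftrightarrow> x \<in> P"
proof -
  let ?L = "localization A P"
  have nz: "b \<noteq> 0" if "b \<notin> P" for b using that P by (auto simp: prime_in_def)
  have LI: "a / b \<in> ?L" if "a \<in> A" "b \<in> A" "b \<notin> P" for a b
    using that by (auto simp: localization_def)
  have mul: "b * d \<notin> P" if "b \<in> A" "d \<in> A" "b \<notin> P" "d \<notin> P" for b d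
    using that P by (auto simp: prime_in_def)
  have one: "1 \<in> A" "1 \<notin> P" using P A by (auto simp: prime_in_def unital_subringD)
  have sub: "unital_subring ?L"
    unfolding unital_subring_def
  proof (intro conjI ballI)
    show "1 \<in> ?L" using LI[OF one(1) one] by simp
    fix x y assume "x \<in> ?L" "y \<in> ?L"
    then obtain a b c d where x: "x = a / b" "a \<in> A" "b \<in> A" "b \<notin> P"
      and y: "y = c / d" "c \<in> A" "d \<in> A" "d \<notin> P" unfolding localization_def by blast
    have "x - y = (a * d - c * b) / (b * d)" using x y nz by (simp add: field_simps)
    then show "x - y \<in> ?L" using LI x y mul A by (simp add: unital_subringD)
    have "x * y = (a * c) / (b * d)" using x y by simp
    then show "x * y \<in> ?L" using LI x y mul A by (simp add: unital_subringD)
  qed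
  show AL: "A \<subseteq> ?L" using LI[OF _ one] by fastforce
  \<comment> \<open>A quotient with numerator in P is not invertible: b / a = c / d would give b * d
    = a * c in P, although b and d lie outside P.\<close>
  have unit: "inverse (a / b) \<notin> ?L" if "a \<in> P" "b \<in> A" "b \<notin> P" "a \<noteq> 0" for a b
  proof
    assume "inverse (a / b) \<in> ?L"
    then obtain c d where cd: "b / a = c / d" "c \<in> A" "d \<in> A" "d \<notin> P"
      unfolding localization_def by (auto simp: field_simps)
    then have "b * d = a * c" using that nz by (simp add: field_simps)
    moreover have "a * c \<in> P" using that cd P by (auto simp: prime_in_def)
    ultimately show False using mul that cd by metis
  qed
  have max: "x \<in> max_ideal ?L \<longleftrightarrow> (\<exists>a b. x = a / b \<and> a \<in> P \<and> b \<in> A \<and> b \<notin> P)" for x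
  proof
    assume x: "x \<in> max_ideal ?L"
    then obtain a b where ab: "x = a / b" "a \<in> A" "b \<in> A" "b \<notin> P"
      unfolding max_ideal_def localization_def by blast
    have "a \<in> P"
    proof (rule ccontr)
      assume "a \<notin> P"
      then have "inverse x \<in> ?L" using LI[of b a] ab by simp
      moreover have "x \<noteq> 0" using nz \<open>a \<notin> P\<close> ab by simp
      ultimately show False using x by (auto simp: max_ideal_def)
    qed
    then show "\<exists>a b. x = a / b \<and> a \<in> P \<and> b \<in> A \<and> b \<notin> P" using ab by blast
  next
    assume "\<exists>a b. x = a / b \<and> a \<in> P \<and> b \<in> A \<and> b \<notin> P"
    then obtain a b where ab: "x = a / b" "a \<in> P" "b \<in> A" "b \<notin> P" by blast
    then have "x \<in> ?L" using LI P by (auto simp: prime_in_def)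
    then show "x \<in> max_ideal ?L" using unit ab by (auto simp: max_ideal_def)
  qed
  show "local_subring ?L"
    unfolding local_subring_def
  proof (intro conjI ballI sub)
    fix x y assume "x \<in> max_ideal ?L" "y \<in> max_ideal ?L"
    then obtain a b c d where x: "x = a / b" "a \<in> P" "b \<in> A" "b \<notin> P"
      and y: "y = c / d" "c \<in> P" "d \<in> A" "d \<notin> P" unfolding max by blast
    have "x + y = (a * d + c * b) / (b * d)" using x y nz by (simp add: field_simps)
    moreover have "a * d + c * b \<in> P" using x y P by (auto simp: prime_in_def)
    moreover have "b * d \<in> A" "b * d \<notin> P" using mul x y A by (auto intro: unital_subringD)
    ultimately show "x + y \<in> max_ideal ?L" unfolding max by blast
  qed
  show "x \<in> max_ideal ?L \<longleftrightarrow> x \<in> P" if "x \<in> A"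
  proof
    assume "x \<in> P"
    then have "x = x / 1 \<and> x \<in> P \<and> 1 \<in> A \<and> 1 \<notin> P" using one by simp
    then show "x \<in> max_ideal ?L" unfolding max by blast
  next
    assume x: "x \<in> max_ideal ?L"
    show "x \<in> P"
    proof (rule ccontr)
      assume "x \<notin> P"
      then have "inverse x \<in> ?L" using LI[OF one(1) that] by (simp add: inverse_eq_divide)
      then show False using x nz[OF \<open>x \<notin> P\<close>] by (auto simp: max_ideal_def)
    qed
  qed
qed

text \<open>The prime is recovered from S as \<open>max_ideal S \<inter> A\<close>, and the last
  conjunct says that S contains no more than the localization there. Afterwards points are handled
  without mentioning primes.\<close>

lemma Spec_iff:
  assumes A: "unital_subring A"
  shows "S \<in> Spec A \<longleftrightarrow> local_subring S \<and> A \<subseteq> S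
    \<and> (\<forall>s\<in>S. \<exists>x\<in>A. \<exists>y\<in>A. y \<noteq> 0 \<and> inverse y \<in> S \<and> s = x / y)"
proof
  assume "S \<in> Spec A"
  then obtain P where S: "S = localization A P" and P: "prime_in P A"
    unfolding Spec_def using primeideal_iff[OF A] by blast
  note l = local_subring_localization[OF A P]
  have "\<exists>x\<in>A. \<exists>y\<in>A. y \<noteq> 0 \<and> inverse y \<in> S \<and> s = x / y" if s: "s \<in> S" for s
  proof -
    obtain x y where "x \<in> A" "y \<in> A" "y \<notin> P" "s = x / y"
      using s unfolding S localization_def by blast
    moreover have "inverse y \<in> S"
      using \<open>y \<in> A\<close> \<open>y \<notin> P\<close> unital_subringD(1)[OF A]
      unfolding S localization_def inverse_eq_divide by blast
    moreover have "y \<noteq> 0" using P \<open>y \<notin> P\<close> by (auto simp: prime_in_def)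
    ultimately show ?thesis by blast
  qed
  then show "local_subring S \<and> A \<subseteq> S
    \<and> (\<forall>s\<in>S. \<exists>x\<in>A. \<exists>y\<in>A. y \<noteq> 0 \<and> inverse y \<in> S \<and> s = x / y)"
    using l S by auto
next
  assume *: "local_subring S \<and> A \<subseteq> S
    \<and> (\<forall>s\<in>S. \<exists>x\<in>A. \<exists>y\<in>A. y \<noteq> 0 \<and> inverse y \<in> S \<and> s = x / y)"
  then have S: "unital_subring S" by (auto simp: local_subring_def)
  let ?P = "max_ideal S \<inter> A"
  have P: "prime_in ?P A"
    unfolding prime_in_def
  proof (intro conjI ballI impI)
    show "0 \<in> ?P" using A S by (auto simp: max_ideal_def unital_subringD)
    show "1 \<notin> ?P" using S by (auto simp: max_ideal_def unital_subringD)
    fix x y assume xy: "x \<in> A" "y \<in> A" "x * y \<in> ?P"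
    show "x \<in> ?P \<or> y \<in> ?P"
    proof (rule ccontr)
      assume "\<not> ?thesis"
      then have "x \<noteq> 0" "y \<noteq> 0" "inverse x \<in> S" "inverse y \<in> S"
        using xy * by (auto simp: max_ideal_def)
      moreover then have "inverse (x * y) \<in> S" using S by (simp add: unital_subringD mult.commute)
      ultimately show False using xy by (auto simp: max_ideal_def)
    qed
  next
    fix x y assume "x \<in> ?P" "y \<in> ?P"
    then show "x + y \<in> ?P" using * A by (auto simp: local_subring_def unital_subringD)
  next
    fix x y assume "x \<in> ?P" "y \<in> A"
    then show "x * y \<in> ?P" using * A max_ideal_mult[OF S] by (auto simp: unital_subringD)
  qed auto
  have "S = localization A ?P"
  proof
    show "S \<subseteq> localization A ?P"
    proof
      fix s assume "s \<in> S"
      then obtain x y where "x \<in> A" "y \<in> A" "y \<noteq> 0" "inverse y \<in> S" "s = x / y"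
        using * by blast
      moreover then have "y \<notin> ?P" by (auto simp: max_ideal_def)
      ultimately show "s \<in> localization A ?P" unfolding localization_def by blast
    qed
    show "localization A ?P \<subseteq> S"
    proof
      fix s assume "s \<in> localization A ?P"
      then obtain x y where xy: "x \<in> A" "y \<in> A" "y \<notin> ?P" "s = x / y" unfolding localization_def by blast
      then have "inverse y \<in> S" using * by (auto simp: max_ideal_def)
      then have "x * inverse y \<in> S" using xy * S by (auto intro: unital_subringD)
      then show "s \<in> S" using xy by (simp add: divide_inverse)
    qed
  qed
  then show "S \<in> Spec A" unfolding Spec_def using primeideal_iff[OF A] P by blast
qed

lemma SpecD:
  assumes "unital_subring A" "S \<in> Spec A"
  shows "local_subring S" "unital_subring S" "A \<subseteq> S"
    "s \<in> S \<Longrightarrow> \<exists>x\<in>A. \<exists>y\<in>A. y \<noteq> 0 \<and> inverse y \<in> S \<and> s = x / y"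
  using assms Spec_iff[OF assms(1), of S] by (auto simp: local_subring_def)

section \<open>Blowing up along the closure of a point\<close>

text \<open>For a local ring S containing A this is the localization of A at the prime cut out by S,
  that is, the point of \<open>Spec A\<close> below S.\<close>

definition fractions_in :: "'k::field set \<Rightarrow> 'k set \<Rightarrow> 'k set" where
  "fractions_in S A = {x / y | x y. x \<in> A \<and> y \<in> A \<and> y \<noteq> 0 \<and> inverse y \<in> S}"

lemma fractions_inI:
  "x \<in> A \<Longrightarrow> y \<in> A \<Longrightarrow> y \<noteq> 0 \<Longrightarrow> inverse y \<in> S \<Longrightarrow> x / y \<in> fractions_in S A"
  by (auto simp: fractions_in_def)

lemma fractions_inE:
  assumes "s \<in> fractions_in S A"
  obtains x y where "x \<in> A" "y \<in> A" "y \<noteq> 0" "inverse y \<in> S" "s = x / y"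
  using assms by (auto simp: fractions_in_def)

lemma unit_mult:
  assumes "unital_subring S" "inverse x \<in> S" "inverse y \<in> S"
  shows "inverse (x * y) \<in> S"
  using unital_subringD(5)[OF assms] by simp

lemma fractions_in_subset:
  assumes "unital_subring A" "unital_subring S" "A \<subseteq> S"
  shows "unital_subring (fractions_in S A)" "A \<subseteq> fractions_in S A" "fractions_in S A \<subseteq> S"
    "z \<in> fractions_in S A \<Longrightarrow> z \<noteq> 0 \<Longrightarrow> inverse z \<in> S \<Longrightarrow> inverse z \<in> fractions_in S A"
proof -
  have one: "1 \<in> A" "inverse 1 \<in> S" using assms by (auto simp: unital_subringD)
  show sub: "A \<subseteq> fractions_in S A"
  proof
    fix x assume "x \<in> A"
    then have "x / 1 \<in> fractions_in S A" using one by (intro fractions_inI) auto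
    then show "x \<in> fractions_in S A" by simp
  qed
  show "unital_subring (fractions_in S A)"
    unfolding unital_subring_def
  proof (intro conjI ballI)
    show "1 \<in> fractions_in S A" using one sub by blast
    fix s t assume st: "s \<in> fractions_in S A" "t \<in> fractions_in S A"
    obtain x y where s: "x \<in> A" "y \<in> A" "y \<noteq> 0" "inverse y \<in> S" "s = x / y"
      using st(1) by (rule fractions_inE)
    obtain z w where t: "z \<in> A" "w \<in> A" "w \<noteq> 0" "inverse w \<in> S" "t = z / w"
      using st(2) by (rule fractions_inE)
    have yw: "y * w \<in> A" "y * w \<noteq> 0" "inverse (y * w) \<in> S"
      using s t assms unit_mult by (auto intro: unital_subringD)
    have "(x * w - z * y) / (y * w) \<in> fractions_in S A" "(x * z) / (y * w) \<in> fractions_in S A"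
      using s t yw assms by (auto intro!: fractions_inI unital_subringD)
    moreover have "s - t = (x * w - z * y) / (y * w)" "s * t = (x * z) / (y * w)"
      using s t by (auto simp: field_simps)
    ultimately show "s - t \<in> fractions_in S A" "s * t \<in> fractions_in S A" by simp_all
  qed
  show "fractions_in S A \<subseteq> S"
  proof
    fix s assume "s \<in> fractions_in S A"
    then obtain x y where s: "x \<in> A" "y \<in> A" "y \<noteq> 0" "inverse y \<in> S" "s = x / y"
      by (rule fractions_inE)
    have "x * inverse y \<in> S" by (rule unital_subringD(5)[OF assms(2)]) (use assms s in blast)+
    then show "s \<in> S" using s by (simp add: divide_inverse)
  qed
  assume z: "z \<in> fractions_in S A" "z \<noteq> 0" "inverse z \<in> S"
  then obtain x y where s: "x \<in> A" "y \<in> A" "y \<noteq> 0" "inverse y \<in> S" "z = x / y"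
    by (auto elim: fractions_inE)
  have "inverse z * inverse y \<in> S" by (rule unital_subringD(5)[OF assms(2) z(3) s(4)])
  moreover have "x \<noteq> 0" using s z by auto
  ultimately have "inverse x \<in> S" "x \<noteq> 0" using s z by (simp_all add: field_simps)
  then have "y / x \<in> fractions_in S A" using s by (intro fractions_inI)
  then show "inverse z \<in> fractions_in S A" using s by simp
qed

lemma Spec_iff_fractions:
  assumes "unital_subring A"
  shows "S \<in> Spec A \<longleftrightarrow> local_subring S \<and> A \<subseteq> S \<and> S \<subseteq> fractions_in S A"
  unfolding Spec_iff[OF assms] fractions_in_def by blast

text \<open>Denominators can be cleared: if the elements of B are fractions over C with denominators
  invertible in S, so are all elements of S. Charts are compared in this way at one local ring at a
  time, although the rings B and C differ.\<close>

lemma Spec_transfer: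
  assumes B: "unital_subring B" and S: "S \<in> Spec B"
    and C: "unital_subring C" "C \<subseteq> S" "B \<subseteq> fractions_in S C"
  shows "S \<in> Spec C"
  unfolding Spec_iff_fractions[OF C(1)]
proof (intro conjI C(2))
  note s = SpecD(1-3)[OF B S]
  show "local_subring S" by (rule s)
  note f = fractions_in_subset[OF C(1) s(2) C(2)]
  show "S \<subseteq> fractions_in S C"
  proof
    fix z assume "z \<in> S"
    then obtain x y where xy: "x \<in> B" "y \<in> B" "y \<noteq> 0" "inverse y \<in> S" "z = x / y"
      using SpecD(4)[OF B S] by blast
    then have "inverse y \<in> fractions_in S C" using f(4) C(3) by blast
    then have "x * inverse y \<in> fractions_in S C"
      by (intro unital_subringD(5)[OF f(1)]) (use xy C(3) in blast)+
    then show "z \<in> fractions_in S C" using xy by (simp add: divide_inverse)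
  qed
qed

text \<open>Domination means that no nonunit of R becomes a unit in S; transitivity and uniqueness
  are read off from this form.\<close>

lemma dominates_iff:
  "dominates S R \<longleftrightarrow> R \<subseteq> S \<and> (\<forall>x\<in>R. x \<noteq> 0 \<longrightarrow> inverse x \<in> S \<longrightarrow> inverse x \<in> R)"
proof -
  have "max_ideal R = max_ideal S \<inter> R \<longleftrightarrow> (\<forall>x\<in>R. x \<noteq> 0 \<longrightarrow> inverse x \<in> S \<longrightarrow> inverse x \<in> R)"
    if "R \<subseteq> S" using that unfolding max_ideal_def by auto
  then show ?thesis by (auto simp: dominates_def)
qed

lemma dominates_trans: "dominates S R \<Longrightarrow> dominates R Q \<Longrightarrow> dominates S Q"
  unfolding dominates_iff by (meson subset_iff)

lemma local_subring_dominated: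
  assumes "local_subring S" "dominates S R" "unital_subring R"
  shows "local_subring R"
  using assms unfolding local_subring_def dominates_def by (auto simp: unital_subringD)

lemma fractions_in_Spec:
  assumes "unital_subring A" "local_subring S" "A \<subseteq> S"
  shows "fractions_in S A \<in> Spec A" "dominates S (fractions_in S A)"
proof -
  note f = fractions_in_subset[OF assms(1) local_subringD(1)[OF assms(2)] assms(3)]
  show d: "dominates S (fractions_in S A)" unfolding dominates_iff using f by blast
  have "x / y \<in> fractions_in (fractions_in S A) A"
    if "x \<in> A" "y \<in> A" "y \<noteq> 0" "inverse y \<in> S" for x y
    using that f by (intro fractions_inI) auto
  then have "fractions_in S A \<subseteq> fractions_in (fractions_in S A) A"
    by (auto elim: fractions_inE)
  then show "fractions_in S A \<in> Spec A"
    unfolding Spec_iff_fractions[OF assms(1)]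
    using f local_subring_dominated[OF assms(2) d] by auto
qed

text \<open>Denominators of elements of R are units in R, hence in S; conversely an element of A
  that is a unit in S is one in R already. So a ring dominates at most one point of an affine
  scheme.\<close>

lemma dominated_in_Spec:
  assumes "unital_subring A" "R \<in> Spec A" "dominates S R"
  shows "R = fractions_in S A"
proof
  note r = SpecD[OF assms(1,2)]
  show "R \<subseteq> fractions_in S A"
    using assms(3) r(4) unfolding dominates_iff by (fastforce intro: fractions_inI)
  show "fractions_in S A \<subseteq> R"
  proof
    fix s assume "s \<in> fractions_in S A"
    then obtain x y where s: "x \<in> A" "y \<in> A" "y \<noteq> 0" "inverse y \<in> S" "s = x / y"
      by (rule fractions_inE)
    then have "inverse y \<in> R" using assms(3) r(3) unfolding dominates_iff by blast
    then have "x * inverse y \<in> R" by (intro unital_subringD(5)[OF r(2)]) (use s r in blast)+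
    then show "s \<in> R" using s by (simp add: divide_inverse)
  qed
qed

text \<open>A scheme contains the localizations of each of its local rings. This is needed to pass
  from a member contained in S to a member dominated by S.\<close>

definition generization_closed :: "'k::field set set \<Rightarrow> bool" where
  "generization_closed X \<longleftrightarrow> (\<forall>R\<in>X. local_subring R \<and> Spec R \<subseteq> X)"

text \<open>The criterion for Chevalley schemes, with S ranging over all subsets of the field; it is
  what makes the map on points well defined.\<close>

definition separated :: "'k::field set set \<Rightarrow> bool" where
  "separated X \<longleftrightarrow>
     (\<forall>S. \<forall>R\<in>X. \<forall>R'\<in>X. dominates S R \<longrightarrow> dominates S R' \<longrightarrow> R = R')"

lemma self_in_Spec: "local_subring R \<Longrightarrow> R \<in> Spec R"
  using fractions_in_subset(2)[of R R] local_subringD(1)[of R] by (auto simp: Spec_iff_fractions)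

lemma generization_closed_Spec:
  assumes A: "unital_subring A"
  shows "generization_closed (Spec A)"
  unfolding generization_closed_def
proof (intro ballI conjI subsetI)
  fix R assume R: "R \<in> Spec A"
  note r = SpecD[OF A R]
  show "local_subring R" by (rule r)
  fix S assume S: "S \<in> Spec R"
  note s = SpecD(1-3)[OF r(2) S]
  have "R \<subseteq> fractions_in S A" using r(4) s(3) by (fastforce intro: fractions_inI)
  then show "S \<in> Spec A" using Spec_transfer[OF r(2) S A] r(3) s(3) by blast
qed

lemma generization_closed_UN:
  "(\<And>i. i \<in> F \<Longrightarrow> generization_closed (X i)) \<Longrightarrow> generization_closed (\<Union>i\<in>F. X i)"
  unfolding generization_closed_def by blast

lemma separated_Spec: "unital_subring A \<Longrightarrow> separated (Spec A)"
  unfolding separated_def using dominated_in_Spec by blast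

lemma normalization_normal:
  assumes "generization_closed X" "\<And>R. R \<in> X \<Longrightarrow> integral_closure R = R"
  shows "normalization X = X"
  using assms self_in_Spec unfolding normalization_def generization_closed_def by fastforce

text \<open>The stalk at \<open>A\<close> of the ideal of the closure of the point \<open>T\<close>.\<close>

definition point_ideal :: "'k::field set \<Rightarrow> 'k set \<Rightarrow> 'k set" where
  "point_ideal T A = {x \<in> A. A \<subseteq> T \<longrightarrow> x \<in> max_ideal T}"

definition point_blowup :: "'k::field set \<Rightarrow> 'k set set \<Rightarrow> 'k set set" where
  "point_blowup T X =
     (\<Union>R\<in>X. \<Union>f\<in>point_ideal T R - {0}. Spec (blowup_chart R (point_ideal T R) f))"

text \<open>A nonunit of T is a nonunit of every S between R and T, so of all conditions in the
  reduced ideal only the one at the generic point T remains.\<close>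

lemma reduced_ideal_generic:
  assumes "T \<in> Z" "\<And>S. S \<in> Z \<Longrightarrow> S \<subseteq> T"
  shows "reduced_ideal Z R = point_ideal T R"
  using assms unfolding reduced_ideal_def point_ideal_def max_ideal_def by blast

lemma blowup_red_generic:
  assumes "T \<in> Z" "\<And>S. S \<in> Z \<Longrightarrow> S \<subseteq> T"
  shows "blowup_red Z X = point_blowup T X"
proof -
  have "reduced_ideal Z = point_ideal T"
    by (rule ext, rule reduced_ideal_generic) (use assms in auto)
  then show ?thesis by (simp add: blowup_red_def point_blowup_def)
qed

text \<open>Formation of the ideal commutes with localization. The delicate situation is a center
  that meets \<open>Spec A\<close> but not the local scheme of R.\<close>

lemma point_ideal_localize:
  assumes A: "unital_subring A" and R: "R \<in> Spec A" and T: "local_subring T"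
  shows "x \<in> point_ideal T R \<longleftrightarrow>
    (\<exists>a\<in>point_ideal T A. \<exists>b\<in>A. b \<noteq> 0 \<and> inverse b \<in> R \<and> x = a / b)" (is "_ \<longleftrightarrow> ?r")
proof
  note r = SpecD[OF A R]
  note t = local_subringD(1)[OF T]
  {
    assume x: "x \<in> point_ideal T R"
    then obtain a b where ab: "a \<in> A" "b \<in> A" "b \<noteq> 0" "inverse b \<in> R" "x = a / b"
      using r(4)[of x] unfolding point_ideal_def by blast
    show ?r
    proof (cases "A \<subseteq> T \<and> \<not> R \<subseteq> T")
      \<comment> \<open>The ideal at R is the unit ideal here, while that at A is proper. An element
        of R outside T supplies a denominator d that is a unit in R and vanishes at T; the fraction
        a / b is expanded by d.\<close>
      case True
      then obtain y where "y \<in> R" "y \<notin> T" by blast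
      then obtain c d where cd: "c \<in> A" "d \<in> A" "d \<noteq> 0" "inverse d \<in> R" "y = c / d"
        using r(4)[of y] by blast
      have "inverse d \<notin> T"
      proof
        assume "inverse d \<in> T"
        then have "c * inverse d \<in> T" by (intro unital_subringD(5)[OF t]) (use cd True in blast)+
        then show False using \<open>y \<notin> T\<close> cd by (simp add: divide_inverse)
      qed
      then have d: "d \<in> max_ideal T" using cd True by (auto simp: max_ideal_def)
      have "d * a \<in> point_ideal T A"
        unfolding point_ideal_def using max_ideal_mult[OF t d] True ab cd A
        by (auto intro: unital_subringD)
      moreover have "inverse (d * b) \<in> R" by (rule unit_mult[OF r(2) cd(4) ab(4)])
      moreover have "x = (d * a) / (d * b)" using ab cd by simp
      moreover have "d * b \<in> A" by (rule unital_subringD(5)[OF A cd(2) ab(2)])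
      moreover have "d * b \<noteq> 0" using ab cd by simp
      ultimately show ?thesis by blast
    next
      case False
      have "a \<in> max_ideal T" if "A \<subseteq> T"
      proof -
        have "R \<subseteq> T" using False that by blast
        then have "x * b \<in> max_ideal T"
          using x ab(2) that by (intro max_ideal_mult[OF t]) (auto simp: point_ideal_def)
        then show ?thesis using ab by simp
      qed
      then have "a \<in> point_ideal T A" using ab by (auto simp: point_ideal_def)
      then show ?thesis using ab by blast
    qed
  }
  assume ?r
  then obtain a b where ab: "a \<in> point_ideal T A" "b \<in> A" "b \<noteq> 0" "inverse b \<in> R" "x = a / b"
    by blast
  have "a \<in> R" using ab r(3) by (auto simp: point_ideal_def)
  then have "a * inverse b \<in> R" using unital_subringD(5)[OF r(2)] ab by simp
  moreover have "a * inverse b \<in> max_ideal T" if "R \<subseteq> T"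
    using ab r that max_ideal_mult[OF t] by (auto simp: point_ideal_def)
  ultimately show "x \<in> point_ideal T R" using ab by (auto simp: point_ideal_def divide_inverse)
qed

lemma point_ideal_mono_Spec:
  assumes "unital_subring A" "R \<in> Spec A" "local_subring T"
  shows "point_ideal T A \<subseteq> point_ideal T R"
proof
  fix a assume a: "a \<in> point_ideal T A"
  have "1 \<in> A" "inverse 1 \<in> R" using assms(1) SpecD(2)[OF assms(1,2)] by (auto simp: unital_subringD)
  moreover have "a = a / 1" by simp
  ultimately show "a \<in> point_ideal T R"
    unfolding point_ideal_localize[OF assms] using a zero_neq_one by metis
qed

text \<open>At a local ring S of the blow-up the ideal is generated by some a. If some v in V
  divides a there, then v generates it too, and S is a point of the chart of v; so the charts of V
  suffice, even though V need not generate the ideal over A.\<close>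

lemma point_blowup_Spec:
  assumes A: "unital_subring A" and T: "local_subring T"
    and V: "V \<subseteq> point_ideal T A - {0}"
    and unit: "\<And>S a. local_subring S \<Longrightarrow> A \<subseteq> S \<Longrightarrow> a \<in> point_ideal T A \<Longrightarrow> a \<noteq> 0 \<Longrightarrow>
        (\<And>g. g \<in> point_ideal T A \<Longrightarrow> g / a \<in> S) \<Longrightarrow> \<exists>v\<in>V. a / v \<in> S"
  shows "point_blowup T (Spec A) = (\<Union>v\<in>V. Spec (blowup_chart A (point_ideal T A) v))"
proof (intro equalityI subsetI)
  let ?I = "point_ideal T"
  fix S assume "S \<in> point_blowup T (Spec A)"
  then obtain R f where R: "R \<in> Spec A" and f: "f \<in> ?I R" "f \<noteq> 0"
    and S: "S \<in> Spec (blowup_chart R (?I R) f)"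
    unfolding point_blowup_def by blast
  note r = SpecD[OF A R]
  note IR = point_ideal_localize[OF A R T]
  note chart = blowup_chart[where R=R and I="?I R" and f=f]
  note s = SpecD[OF chart(1) S]
  have RS: "R \<subseteq> S" using s(3) chart(2) by blast
  obtain a b where ab: "a \<in> ?I A" "b \<in> A" "b \<noteq> 0" "inverse b \<in> R" "f = a / b"
    using f IR by blast
  have a0: "a \<noteq> 0" using f ab by auto
  have ga: "g / a \<in> S" if "g \<in> ?I A" for g
  proof -
    have "g / f \<in> S" using chart(3) point_ideal_mono_Spec[OF A R T] that s(3) by blast
    then have "g / f * inverse b \<in> S" by (intro unital_subringD(5)[OF s(2)]) (use ab RS in blast)+
    then show ?thesis using ab by (simp add: field_simps)
  qed
  obtain v where v: "v \<in> V" "a / v \<in> S"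
    using unit[OF s(1) _ ab(1) a0 ga] r(3) RS by blast
  have v0: "v \<noteq> 0" "v \<in> ?I A" using v V by auto
  let ?C = "blowup_chart A (?I A) v"
  note c = blowup_chart[where R=A and I="?I A" and f=v]
  have CS: "?C \<subseteq> S"
  proof (rule c(4)[OF s(2)])
    fix g assume "g \<in> ?I A"
    then have "g / a * (a / v) \<in> S" by (intro unital_subringD(5)[OF s(2)]) (use ga v in blast)+
    then show "g / v \<in> S" using a0 by simp
  qed (use r RS in blast)
  note fr = fractions_in_subset[OF c(1) s(2) CS]
  have "blowup_chart R (?I R) f \<subseteq> fractions_in S ?C"
  proof (rule blowup_chart(4)[OF fr(1)])
    show "R \<subseteq> fractions_in S ?C"
      using r(4) c(2) RS by (fastforce intro: fractions_inI)
    fix g assume "g \<in> ?I R"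
    then obtain a' b' where ab': "a' \<in> ?I A" "b' \<in> A" "b' \<noteq> 0" "inverse b' \<in> R" "g = a' / b'"
      using IR by blast
    \<comment> \<open>This is g / f written with numerator and denominator from the chart of v. The
      factor a / v is a unit of S, because v / a lies in S as well.\<close>
    have "a' / v * b / (a / v * b') \<in> fractions_in S ?C"
    proof (rule fractions_inI)
      show "a' / v * b \<in> ?C" "a / v * b' \<in> ?C"
        by (intro unital_subringD(5)[OF c(1)] c(3) subsetD[OF c(2)] ab ab')+
      show "a / v * b' \<noteq> 0" using a0 v0 ab' by simp
      have "inverse (a / v) \<in> S" using ga[OF v0(2)] by simp
      then show "inverse (a / v * b') \<in> S" by (rule unit_mult[OF s(2)]) (use ab' RS in blast)
    qed
    moreover have "a' / v * b / (a / v * b') = g / f" using ab(3,5) ab'(3,5) v0 a0 by simp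
    ultimately show "g / f \<in> fractions_in S ?C" by simp
  qed
  then show "S \<in> (\<Union>v\<in>V. Spec (blowup_chart A (?I A) v))"
    using Spec_transfer[OF chart(1) S c(1) CS] v(1) by blast
next
  let ?I = "point_ideal T"
  fix S assume "S \<in> (\<Union>v\<in>V. Spec (blowup_chart A (?I A) v))"
  then obtain v where v: "v \<in> V" and S: "S \<in> Spec (blowup_chart A (?I A) v)" by blast
  note c = blowup_chart[where R=A and I="?I A" and f=v]
  note s = SpecD[OF c(1) S]
  have AS: "A \<subseteq> S" using c(2) s(3) by blast
  \<comment> \<open>\<open>point_blowup\<close> is defined over local rings, so the chart over A is
    compared with that over the point of \<open>Spec A\<close> below S.\<close>
  define R where "R = fractions_in S A"
  have R: "R \<in> Spec A" "R \<subseteq> S"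
    using fractions_in_Spec[OF A s(1) AS] by (auto simp: R_def dominates_iff)
  note r = SpecD[OF A R(1)]
  have IA: "?I A \<subseteq> ?I R" by (rule point_ideal_mono_Spec[OF A R(1) T])
  let ?B = "blowup_chart R (?I R) v"
  note b = blowup_chart[where R=R and I="?I R" and f=v]
  have BS: "?B \<subseteq> S"
  proof (rule b(4)[OF s(2) R(2)])
    fix g assume "g \<in> ?I R"
    then obtain a d where ad: "a \<in> ?I A" "d \<in> A" "d \<noteq> 0" "inverse d \<in> R" "g = a / d"
      using point_ideal_localize[OF A R(1) T] by blast
    have "a / v * inverse d \<in> S"
      by (rule unital_subringD(5)[OF s(2)]) (use c(3)[OF ad(1)] s R ad in blast)+
    moreover have "a / v * inverse d = g / v" using ad(5) by (simp add: divide_inverse)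
    ultimately show "g / v \<in> S" by argo
  qed
  have "blowup_chart A (?I A) v \<subseteq> ?B"
    by (rule c(4)[OF b(1)]) (use b r IA in blast)+
  then have "S \<in> Spec ?B"
    using Spec_transfer[OF c(1) S b(1) BS] fractions_in_subset(2)[OF b(1) s(2) BS] by blast
  then show "S \<in> point_blowup T (Spec A)"
    unfolding point_blowup_def using R(1) v V IA by blast
qed

text \<open>A chart over Q also has points lying over generizations of Q, so S need not dominate Q.
  Replacing Q by its localization R below S, with the same f, repairs this.\<close>

lemma point_blowup_dominates:
  assumes X: "generization_closed X" and S: "S \<in> point_blowup T X" and T: "local_subring T"
  obtains R f where "R \<in> X" "dominates S R" "f \<in> point_ideal T R" "f \<noteq> 0"
    "S \<in> Spec (blowup_chart R (point_ideal T R) f)"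
proof -
  let ?I = "point_ideal T"
  obtain Q f where Q: "Q \<in> X" and f: "f \<in> ?I Q" "f \<noteq> 0"
    and S: "S \<in> Spec (blowup_chart Q (?I Q) f)"
    using S unfolding point_blowup_def by blast
  have q: "unital_subring Q" using Q X by (auto simp: generization_closed_def local_subring_def)
  note c = blowup_chart[where R=Q and I="?I Q" and f=f]
  note s = SpecD[OF c(1) S]
  have QS: "Q \<subseteq> S" using c(2) s(3) by blast
  define R where "R = fractions_in S Q"
  note R = fractions_in_Spec[OF q s(1) QS, folded R_def]
  note r = SpecD[OF q R(1)]
  have RS: "R \<subseteq> S" using R(2) by (auto simp: dominates_iff)
  have IR: "?I Q \<subseteq> ?I R" by (rule point_ideal_mono_Spec[OF q R(1) T])
  note b = blowup_chart[where R=R and I="?I R" and f=f]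
  have BS: "blowup_chart R (?I R) f \<subseteq> S"
  proof (rule b(4)[OF s(2) RS])
    fix g assume "g \<in> ?I R"
    then obtain a d where ad: "a \<in> ?I Q" "d \<in> Q" "d \<noteq> 0" "inverse d \<in> R" "g = a / d"
      using point_ideal_localize[OF q R(1) T] by blast
    have "a / f * inverse d \<in> S"
      by (rule unital_subringD(5)[OF s(2)]) (use c(3)[OF ad(1)] s RS ad in blast)+
    moreover have "a / f * inverse d = g / f" using ad(5) by (simp add: divide_inverse)
    ultimately show "g / f \<in> S" by argo
  qed
  have "blowup_chart Q (?I Q) f \<subseteq> blowup_chart R (?I R) f"
    by (rule c(4)[OF b(1)]) (use b r IR in blast)+
  then have "S \<in> Spec (blowup_chart R (?I R) f)"
    using Spec_transfer[OF c(1) S b(1) BS] fractions_in_subset(2)[OF b(1) s(2) BS] by blast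
  moreover have "R \<in> X" using R(1) Q X by (auto simp: generization_closed_def)
  ultimately show ?thesis using that R(2) IR f by blast
qed

text \<open>Two members dominated by the same ring lie over a common \<open>R\<close> and belong to charts given by \<open>f\<^sub>1\<close>
  and \<open>f\<^sub>2\<close>; then \<open>f\<^sub>1 / f\<^sub>2\<close> is a unit in both, so each of them contains both charts.\<close>

lemma separated_point_blowup:
  assumes X: "generization_closed X" "separated X" and T: "local_subring T"
  shows "separated (point_blowup T X)"
proof -
  let ?I = "point_ideal T"
  have incl: "S1 \<subseteq> S2"
    if S1: "S1 \<in> Spec (blowup_chart R (?I R) f1)" and S2: "S2 \<in> Spec (blowup_chart R (?I R) f2)"
      and f: "f1 \<in> ?I R" "f2 \<in> ?I R" "f1 \<noteq> 0" "f2 \<noteq> 0"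
      and d: "dominates S S1" "dominates S S2" for S S1 S2 R f1 f2
  proof
    note c1 = blowup_chart[where R=R and I="?I R" and f=f1] and c2 = blowup_chart[where R=R and I="?I R" and f=f2]
    note s1 = SpecD[OF c1(1) S1] and s2 = SpecD[OF c2(1) S2]
    have "f1 / f2 \<in> S2" "f2 / f1 \<in> S1" using c1(3) c2(3) s1(3) s2(3) f by blast+
    moreover have "inverse (f1 / f2) = f2 / f1" "f1 / f2 \<noteq> 0" using f by auto
    ultimately have u: "f2 / f1 \<in> S2" using d unfolding dominates_iff by (metis subsetD)
    have c: "blowup_chart R (?I R) f1 \<subseteq> S2"
    proof (rule c1(4)[OF s2(2)])
      fix g assume "g \<in> ?I R"
      then have "g / f2 * (f2 / f1) \<in> S2"
        by (intro unital_subringD(5)[OF s2(2)]) (use u c2(3) s2(3) in blast)+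
      then show "g / f1 \<in> S2" using f by simp
    qed (use c2(2) s2(3) in blast)
    fix s assume "s \<in> S1"
    then obtain x y where xy: "x \<in> blowup_chart R (?I R) f1" "y \<in> blowup_chart R (?I R) f1"
      "y \<noteq> 0" "inverse y \<in> S1" "s = x / y" using s1(4)[of s] by blast
    then have "inverse y \<in> S2" using c d unfolding dominates_iff by blast
    then have "x * inverse y \<in> S2" by (intro unital_subringD(5)[OF s2(2)]) (use xy c in blast)+
    then show "s \<in> S2" using xy by (simp add: divide_inverse)
  qed
  show ?thesis
    unfolding separated_def
  proof (intro allI ballI impI)
    fix S S1 S2
    assume S: "S1 \<in> point_blowup T X" "S2 \<in> point_blowup T X" and d: "dominates S S1" "dominates S S2"
    obtain R1 f1 where 1: "R1 \<in> X" "dominates S1 R1" "f1 \<in> ?I R1" "f1 \<noteq> 0"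
      "S1 \<in> Spec (blowup_chart R1 (?I R1) f1)"
      using point_blowup_dominates[OF X(1) S(1) T] by blast
    obtain R2 f2 where 2: "R2 \<in> X" "dominates S2 R2" "f2 \<in> ?I R2" "f2 \<noteq> 0"
      "S2 \<in> Spec (blowup_chart R2 (?I R2) f2)"
      using point_blowup_dominates[OF X(1) S(2) T] by blast
    have "R1 = R2"
      using X(2) 1(1,2) 2(1,2) d dominates_trans unfolding separated_def by blast
    then show "S1 = S2" using incl 1 2 d by blast
  qed
qed

lemma birational_morphism_point_blowup:
  assumes "generization_closed X" "separated X" "local_subring T"
  shows "birational_morphism (point_blowup T X) X"
  unfolding birational_morphism_def
proof
  fix S assume "S \<in> point_blowup T X"
  then obtain R where R: "R \<in> X" "dominates S R"
    using point_blowup_dominates[OF assms(1) _ assms(3)] by metis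
  show "\<exists>!R. R \<in> X \<and> dominates S R"
  proof (rule ex1I)
    show "R \<in> X \<and> dominates S R" using R by simp
    show "R' = R" if "R' \<in> X \<and> dominates S R'" for R'
      using assms(2) R that unfolding separated_def by blast
  qed
qed

lemma birational_map_eq:
  assumes "separated X" "R \<in> X" "dominates S R"
  shows "birational_map X S = R"
  unfolding birational_map_def
proof (rule the_equality)
  show "R \<in> X \<and> dominates S R" using assms by simp
  show "R' = R" if "R' \<in> X \<and> dominates S R'" for R'
    using assms that unfolding separated_def by blast
qed

lemma foldr_comp: "foldr (\<circ>) fs h = foldr (\<circ>) fs id \<circ> h"
  by (induction fs) (auto simp: comp_assoc)

text \<open>Domination is transitive, so following S down the chain ends at a member of
  \<open>X 0\<close> dominated by S.\<close>

lemma birational_chain: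
  assumes "\<And>i. i < k \<Longrightarrow> birational_morphism (X (Suc i)) (X i)"
    and "\<And>i. i < k \<Longrightarrow> separated (X i)" and "S \<in> X k"
  shows "foldr (\<circ>) (map (\<lambda>i. birational_map (X (i - 1))) [1..<k + 1]) id S \<in> X 0
    \<and> dominates S (foldr (\<circ>) (map (\<lambda>i. birational_map (X (i - 1))) [1..<k + 1]) id S)"
  using assms
proof (induction k arbitrary: S)
  case 0
  then show ?case by (simp add: dominates_iff)
next
  case (Suc k)
  obtain R where R: "R \<in> X k" "dominates S R"
    using Suc.prems(1)[of k] Suc.prems(3) unfolding birational_morphism_def by auto
  have eq: "birational_map (X k) S = R" using R Suc.prems(2)[of k] by (intro birational_map_eq) auto
  \<comment> \<open>The list grows at its right end, so \<open>birational_map (X k)\<close> is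
    applied first and can be absorbed into the starting point R.\<close>
  have F: "foldr (\<circ>) (map (\<lambda>i. birational_map (X (i - 1))) [1..<Suc k + 1]) id S
      = foldr (\<circ>) (map (\<lambda>i. birational_map (X (i - 1))) [1..<k + 1]) id R"
    by (simp add: foldr_comp[of _ "birational_map (X k)"] eq)
  have "foldr (\<circ>) (map (\<lambda>i. birational_map (X (i - 1))) [1..<k + 1]) id R \<in> X 0
    \<and> dominates R (foldr (\<circ>) (map (\<lambda>i. birational_map (X (i - 1))) [1..<k + 1]) id R)"
    using Suc.prems R by (intro Suc.IH) auto
  then show ?case unfolding F using dominates_trans[OF R(2)] by blast
qed

section \<open>Leading exponents and integral closedness of Laurent polynomial rings\<close>

definition min_value :: "('e \<Rightarrow> real) \<Rightarrow> ('e \<Rightarrow>\<^sub>0 'c::zero) \<Rightarrow> real" where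
  "min_value \<phi> p = Min (\<phi> ` Poly_Mapping.keys p)"

text \<open>Exponents are ordered by \<phi>, ties being broken by the linear order. So there is a
  unique leading exponent, additive under products, even for a degenerate \<phi> such as 0.\<close>

definition leading_exp :: "('e::linorder \<Rightarrow> real) \<Rightarrow> ('e \<Rightarrow>\<^sub>0 'c::zero) \<Rightarrow> 'e" where
  "leading_exp \<phi> p = Min {m \<in> Poly_Mapping.keys p. \<phi> m = min_value \<phi> p}"

lemma min_value_le: "m \<in> Poly_Mapping.keys p \<Longrightarrow> min_value \<phi> p \<le> \<phi> m"
  by (simp add: min_value_def)

lemma min_value_attained:
  assumes "p \<noteq> 0"
  obtains m where "m \<in> Poly_Mapping.keys p" "\<phi> m = min_value \<phi> p"
proof -
  have "Min (\<phi> ` Poly_Mapping.keys p) \<in> \<phi> ` Poly_Mapping.keys p"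
    using assms by (intro Min_in) auto
  then show ?thesis using that by (auto simp: min_value_def)
qed

lemma leading_exp:
  assumes "p \<noteq> 0"
  shows "leading_exp \<phi> p \<in> Poly_Mapping.keys p" "\<phi> (leading_exp \<phi> p) = min_value \<phi> p"
    "m \<in> Poly_Mapping.keys p \<Longrightarrow> \<phi> m = min_value \<phi> p \<Longrightarrow> leading_exp \<phi> p \<le> m"
proof -
  let ?M = "{m \<in> Poly_Mapping.keys p. \<phi> m = min_value \<phi> p}"
  have "?M \<noteq> {}" using min_value_attained[OF assms, of \<phi>] by blast
  then have "Min ?M \<in> ?M" by (intro Min_in) auto
  then show "leading_exp \<phi> p \<in> Poly_Mapping.keys p" "\<phi> (leading_exp \<phi> p) = min_value \<phi> p"
    by (auto simp: leading_exp_def)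
  assume "m \<in> Poly_Mapping.keys p" "\<phi> m = min_value \<phi> p"
  then show "leading_exp \<phi> p \<le> m" unfolding leading_exp_def by (intro Min_le) auto
qed

lemma leading_expI:
  assumes "m \<in> Poly_Mapping.keys p" "\<And>k. k \<in> Poly_Mapping.keys p \<Longrightarrow> \<phi> m \<le> \<phi> k"
    and "\<And>k. k \<in> Poly_Mapping.keys p \<Longrightarrow> \<phi> k = \<phi> m \<Longrightarrow> m \<le> k"
  shows "leading_exp \<phi> p = m" "min_value \<phi> p = \<phi> m"
proof -
  have "p \<noteq> 0" using assms(1) by auto
  show v: "min_value \<phi> p = \<phi> m"
    unfolding min_value_def using assms by (intro Min_eqI) auto
  show "leading_exp \<phi> p = m"
    unfolding leading_exp_def v using assms by (intro Min_eqI) auto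
qed

text \<open>The sum of the leading exponents arises only once in the product: a second
  representation would have equal \<phi>-values in both factors, and then the strict order of
  exponents excludes it.\<close>

lemma lookup_leading_mult:
  fixes p q :: "'e::linordered_ab_group_add \<Rightarrow>\<^sub>0 'c::idom" and \<phi> :: "'e \<Rightarrow> real"
  assumes "Modules.additive \<phi>" "p \<noteq> 0" "q \<noteq> 0"
  shows "Poly_Mapping.lookup (p * q) (leading_exp \<phi> p + leading_exp \<phi> q)
    = Poly_Mapping.lookup p (leading_exp \<phi> p) * Poly_Mapping.lookup q (leading_exp \<phi> q)"
proof -
  define m n where "m = leading_exp \<phi> p" and "n = leading_exp \<phi> q"
  define p' q' where "p' = p - Poly_Mapping.single m (Poly_Mapping.lookup p m)"
    and "q' = q - Poly_Mapping.single n (Poly_Mapping.lookup q n)"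
  have p': "Poly_Mapping.keys p' = Poly_Mapping.keys p - {m}"
    and q': "Poly_Mapping.keys q' = Poly_Mapping.keys q - {n}"
    unfolding p'_def q'_def
    by (auto simp: in_keys_iff lookup_minus lookup_single when_def split: if_splits)
  have 1: "Poly_Mapping.lookup (Poly_Mapping.single m (Poly_Mapping.lookup p m) * q') (m + n) = 0"
  proof (rule ccontr)
    assume "\<not> ?thesis"
    then have "m + n \<in> Poly_Mapping.keys (Poly_Mapping.single m (Poly_Mapping.lookup p m) * q')"
      by (simp add: in_keys_iff)
    then obtain a b where "m + n = a + b" "b \<in> Poly_Mapping.keys q'"
      "a \<in> Poly_Mapping.keys (Poly_Mapping.single m (Poly_Mapping.lookup p m))"
      using keys_mult by blast
    then show False using q' by (auto split: if_splits)
  qed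
  have 2: "Poly_Mapping.lookup (p' * q) (m + n) = 0"
  proof (rule ccontr)
    assume "\<not> ?thesis"
    then have "m + n \<in> Poly_Mapping.keys (p' * q)" by (simp add: in_keys_iff)
    then obtain a b where ab: "m + n = a + b" "a \<in> Poly_Mapping.keys p'" "b \<in> Poly_Mapping.keys q"
      using keys_mult by blast
    then have a: "a \<in> Poly_Mapping.keys p" "a \<noteq> m" using p' by auto
    have "\<phi> m + \<phi> n = \<phi> a + \<phi> b" using ab(1) Modules.additive.add[OF assms(1)] by metis
    moreover have "\<phi> m \<le> \<phi> a" "\<phi> n \<le> \<phi> b"
      using min_value_le[OF a(1)] min_value_le[OF ab(3)] leading_exp(2)[OF assms(2)]
        leading_exp(2)[OF assms(3)] unfolding m_def n_def by metis+
    ultimately have "\<phi> a = \<phi> m" "\<phi> b = \<phi> n" by linarith+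
    then have "m \<le> a" "n \<le> b"
      using leading_exp[OF assms(2)] leading_exp[OF assms(3)] a ab unfolding m_def n_def by auto
    then have "m + n < a + b" using a(2) by (intro add_less_le_mono) auto
    then show False using ab by simp
  qed
  have "p * q = Poly_Mapping.single m (Poly_Mapping.lookup p m) * Poly_Mapping.single n (Poly_Mapping.lookup q n)
      + Poly_Mapping.single m (Poly_Mapping.lookup p m) * q' + p' * q"
    unfolding p'_def q'_def by (simp add: algebra_simps)
  then have "Poly_Mapping.lookup (p * q) (m + n)
      = Poly_Mapping.lookup p m * Poly_Mapping.lookup q n"
    using 1 2 by (simp add: lookup_add mult_single)
  then show ?thesis by (simp add: m_def n_def)
qed

lemma leading_exp_mult:
  fixes p q :: "'e::linordered_ab_group_add \<Rightarrow>\<^sub>0 'c::idom" and \<phi> :: "'e \<Rightarrow> real"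
  assumes "Modules.additive \<phi>" "p \<noteq> 0" "q \<noteq> 0"
  shows "leading_exp \<phi> (p * q) = leading_exp \<phi> p + leading_exp \<phi> q"
    "min_value \<phi> (p * q) = min_value \<phi> p + min_value \<phi> q"
proof -
  let ?m = "leading_exp \<phi> p" and ?n = "leading_exp \<phi> q"
  note add = Modules.additive.add[OF assms(1)]
  note p = leading_exp[OF assms(2), where \<phi> = \<phi>] and q = leading_exp[OF assms(3), where \<phi> = \<phi>]
  have 1: "?m + ?n \<in> Poly_Mapping.keys (p * q)"
    using p(1) q(1) by (simp add: in_keys_iff lookup_leading_mult[OF assms])
  have 2: "\<phi> (?m + ?n) \<le> \<phi> k \<and> (\<phi> k = \<phi> (?m + ?n) \<longrightarrow> ?m + ?n \<le> k)"
    if "k \<in> Poly_Mapping.keys (p * q)" for k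
  proof -
    obtain a b where ab: "k = a + b" "a \<in> Poly_Mapping.keys p" "b \<in> Poly_Mapping.keys q"
      using keys_mult \<open>k \<in> _\<close> by blast
    have "\<phi> ?m \<le> \<phi> a" "\<phi> ?n \<le> \<phi> b"
      using p(2) q(2) min_value_le[OF ab(2), of \<phi>] min_value_le[OF ab(3), of \<phi>] by auto
    moreover have "?m + ?n \<le> k" if "\<phi> a = \<phi> ?m" "\<phi> b = \<phi> ?n"
      using p q ab that by (auto intro!: add_mono)
    ultimately show ?thesis by (auto simp: ab(1) add)
  qed
  show "leading_exp \<phi> (p * q) = ?m + ?n" using 1 2 by (intro leading_expI) auto
  have "min_value \<phi> (p * q) = \<phi> (?m + ?n)" using 1 2 by (intro leading_expI(2)) auto
  then show "min_value \<phi> (p * q) = min_value \<phi> p + min_value \<phi> q" by (simp add: add p q)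
qed

lemma min_value_power:
  fixes p :: "'e::linordered_ab_group_add \<Rightarrow>\<^sub>0 'c::idom" and \<phi> :: "'e \<Rightarrow> real"
  assumes "Modules.additive \<phi>" "p \<noteq> 0"
  shows "min_value \<phi> (p ^ k) = k * min_value \<phi> p"
proof (induction k)
  case 0
  then show ?case using Modules.additive.zero[OF assms(1)] by (simp add: min_value_def)
qed (use assms in \<open>simp add: leading_exp_mult algebra_simps\<close>)

lemma additive_leading_power:
  fixes p :: "'e::linordered_ab_group_add \<Rightarrow>\<^sub>0 'c::idom" and \<phi> :: "'e \<Rightarrow> real"
  assumes "Modules.additive \<phi>" "Modules.additive \<psi>" "p \<noteq> 0"
  shows "\<phi> (leading_exp \<psi> (p ^ k)) = k * \<phi> (leading_exp \<psi> p)"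
proof (induction k)
  case 0
  have "leading_exp \<psi> (1 :: 'e \<Rightarrow>\<^sub>0 'c) = 0" by (rule leading_expI) auto
  then show ?case using Modules.additive.zero[OF assms(1)] by simp
qed (use assms in \<open>simp add: leading_exp_mult Modules.additive.add algebra_simps\<close>)

lemma real_multiple_bounded:
  assumes "\<And>k::nat. real k * x \<le> y"
  shows "x \<le> 0"
proof (rule ccontr)
  assume "\<not> x \<le> 0"
  then obtain k :: nat where "y < real k * x" using reals_Archimedean3[of x] by auto
  then show False using assms[of k] by simp
qed

text \<open>
  The initial term of an almost integral quotient \<open>a / b\<close> has its exponent in the Newton polytope of
  the quotient (compare leading exponents of \<open>d a\<^sup>k\<close> for large \<open>k\<close>), so subtracting it leaves a
  quotient whose Newton polytope contains strictly fewer lattice points above the leading exponent.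
\<close>

lemma almost_integral_Laurent:
  fixes a b d :: "'e::linordered_ab_group_add \<Rightarrow>\<^sub>0 'c::field" and \<Phi> U :: "('e \<Rightarrow> real) set"
  assumes \<Phi>: "\<And>\<phi>. \<phi> \<in> \<Phi> \<Longrightarrow> Modules.additive \<phi>" "\<And>c. finite {m. \<forall>\<phi>\<in>\<Phi>. c \<phi> \<le> \<phi> m}"
    and U: "\<And>\<phi>. \<phi> \<in> U \<Longrightarrow> Modules.additive \<phi>"
    and L: "\<And>x y. x \<in> L \<Longrightarrow> y \<in> L \<Longrightarrow> x - y \<in> L"
    and \<Gamma>: "\<Gamma> = {m \<in> L. \<forall>\<phi>\<in>U. 0 \<le> \<phi> m}"
    and b: "b \<noteq> 0" "Poly_Mapping.keys b \<subseteq> L" and d: "d \<noteq> 0"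
    and "Poly_Mapping.keys a \<subseteq> L"
    and "\<And>k. \<exists>p. Poly_Mapping.keys p \<subseteq> \<Gamma> \<and> d * a ^ k = p * b ^ k"
  shows "\<exists>p. Poly_Mapping.keys p \<subseteq> \<Gamma> \<and> a = p * b"
proof -
  \<comment> \<open>With the zero functional the tie-break decides alone, so this is the least
    exponent in the linear order.\<close>
  define lm where "lm = (leading_exp (\<lambda>_. 0) :: ('e \<Rightarrow>\<^sub>0 'c) \<Rightarrow> 'e)"
  have zero: "Modules.additive (\<lambda>_::'e. 0 :: real)" by (simp add: Modules.additive_def)
  define box where
    "box a = {m. (\<forall>\<phi>\<in>\<Phi>. min_value \<phi> a - min_value \<phi> b \<le> \<phi> m) \<and> lm a - lm b \<le> m}" for a
  have fin: "finite (box a)" for a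
    by (rule finite_subset[OF _ \<Phi>(2)[of "\<lambda>\<phi>. min_value \<phi> a - min_value \<phi> b"]]) (auto simp: box_def)
  have L': "x + y \<in> L" if "x \<in> L" "y \<in> L" for x y
    using L[OF that(1) L[OF L[OF that(1) that(1)] that(2)]] by simp
  have \<Gamma>': "x + y \<in> \<Gamma>" if "x \<in> \<Gamma>" "y \<in> \<Gamma>" for x y
    using that L' U unfolding \<Gamma> by (auto simp: Modules.additive.add)
  \<comment> \<open>In d a^k = p b^k the contribution of d stays bounded while those of a and b grow
    with k. The first bound holds for every additive \<phi>: for those in \<Phi> it places m in the
    finite \<open>box\<close>, for those in U it is combined with the second bound to place m in
    \<Gamma>.\<close>
  have *: "\<phi> (lm a - lm b) \<ge> min_value \<phi> a - min_value \<phi> b"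
    "(\<forall>m\<in>\<Gamma>. 0 \<le> \<phi> m) \<longrightarrow> 0 \<le> min_value \<phi> a - min_value \<phi> b"
    if "a \<noteq> 0" and \<phi>: "Modules.additive \<phi>"
      and ex: "\<And>k. \<exists>p. Poly_Mapping.keys p \<subseteq> \<Gamma> \<and> d * a ^ k = p * b ^ k" for a and \<phi> :: "'e \<Rightarrow> real"
  proof -
    have "real k * (min_value \<phi> a - min_value \<phi> b - \<phi> (lm a - lm b)) \<le> \<phi> (lm d) - min_value \<phi> d
      \<and> ((\<forall>m\<in>\<Gamma>. 0 \<le> \<phi> m) \<longrightarrow> real k * (min_value \<phi> b - min_value \<phi> a) \<le> min_value \<phi> d)" for k
    proof -
      obtain p where p: "Poly_Mapping.keys p \<subseteq> \<Gamma>" "d * a ^ k = p * b ^ k" using ex by blast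
      have p0: "p \<noteq> 0" using p(2) d \<open>a \<noteq> 0\<close> by auto
      have "min_value \<phi> (d * a ^ k) = min_value \<phi> (p * b ^ k)" using p(2) by simp
      then have 1: "min_value \<phi> d + k * min_value \<phi> a = min_value \<phi> p + k * min_value \<phi> b"
        using d p0 b \<open>a \<noteq> 0\<close> \<phi> by (simp add: leading_exp_mult min_value_power)
      have "\<phi> (lm (d * a ^ k)) = \<phi> (lm (p * b ^ k))" using p(2) by simp
      then have 2: "\<phi> (lm d) + k * \<phi> (lm a) = \<phi> (lm p) + k * \<phi> (lm b)"
        using d p0 b \<open>a \<noteq> 0\<close> \<phi> zero unfolding lm_def
        by (simp add: leading_exp_mult additive_leading_power Modules.additive.add)
      have 3: "min_value \<phi> p \<le> \<phi> (lm p)"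
        using min_value_le[OF leading_exp(1)[OF p0]] unfolding lm_def .
      have 4: "0 \<le> min_value \<phi> p" if "\<forall>m\<in>\<Gamma>. 0 \<le> \<phi> m"
        using min_value_attained[OF p0, of \<phi>] p(1) that by (metis subsetD)
      have 5: "\<phi> (lm a - lm b) = \<phi> (lm a) - \<phi> (lm b)" using \<phi> by (simp add: Modules.additive.diff)
      show ?thesis unfolding 5 using 1 2 3 4 by (simp add: algebra_simps)
    qed
    then show "\<phi> (lm a - lm b) \<ge> min_value \<phi> a - min_value \<phi> b"
      and "(\<forall>m\<in>\<Gamma>. 0 \<le> \<phi> m) \<longrightarrow> 0 \<le> min_value \<phi> a - min_value \<phi> b"
      using real_multiple_bounded[of "min_value \<phi> a - min_value \<phi> b - \<phi> (lm a - lm b)"]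
        real_multiple_bounded[of "min_value \<phi> b - min_value \<phi> a"] by fastforce+
  qed
  show ?thesis
    using assms(9,10)
  proof (induction "card (box a)" arbitrary: a rule: less_induct)
    case less
    show ?case
    proof (cases "a = 0")
      case True
      then show ?thesis by (intro exI[of _ 0]) auto
    next
      case a0: False
      define m where "m = lm a - lm b"
      define c where "c = Poly_Mapping.lookup a (lm a) / Poly_Mapping.lookup b (lm b)"
      define t where "t = Poly_Mapping.single m c"
      define a' where "a' = a - t * b"
      note la = leading_exp[OF a0, where \<phi> = "\<lambda>_. 0", folded lm_def]
      note lb = leading_exp[OF b(1), where \<phi> = "\<lambda>_. 0", folded lm_def]
      have c: "c \<noteq> 0" using la(1) lb(1) by (auto simp: c_def in_keys_iff)
      have t0: "t \<noteq> 0" using c unfolding t_def by (metis single_zero lookup_single_eq lookup_zero)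
      have lt: "leading_exp (\<lambda>_. 0) t = m"
        by (rule leading_expI) (use c in \<open>auto simp: t_def split: if_splits\<close>)
      have mL: "m \<in> L" using la(1) lb(1) less.prems(1) b(2) L unfolding m_def by blast
      have \<phi>m: "min_value \<phi> a - min_value \<phi> b \<le> \<phi> m" if "Modules.additive \<phi>" for \<phi> :: "'e \<Rightarrow> real"
        using *(1)[OF a0 that less.prems(2)] by (simp add: m_def)
      have m\<Gamma>: "m \<in> \<Gamma>"
      proof -
        have "0 \<le> \<phi> m" if "\<phi> \<in> U" for \<phi>
          using *(2)[OF a0 U[OF that] less.prems(2)] \<phi>m[OF U[OF that]] that \<Gamma> by auto
        then show ?thesis using mL by (simp add: \<Gamma>)
      qed
      have t\<Gamma>: "Poly_Mapping.keys t \<subseteq> \<Gamma>" using m\<Gamma> by (simp add: t_def)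
      show ?thesis
      proof (cases "a' = 0")
        case True
        then show ?thesis using t\<Gamma> by (intro exI[of _ t]) (simp add: a'_def)
      next
        case False
        have keys: "k \<in> Poly_Mapping.keys a \<or> (\<exists>j\<in>Poly_Mapping.keys b. k = m + j)"
          if "k \<in> Poly_Mapping.keys a'" for k
        proof -
          have "k \<in> Poly_Mapping.keys a \<or> k \<in> Poly_Mapping.keys (t * b)"
            using that unfolding a'_def by (auto simp: in_keys_iff lookup_minus)
          then show ?thesis using keys_mult[of t b] by (auto simp: t_def split: if_splits)
        qed
        have keysL: "Poly_Mapping.keys a' \<subseteq> L"
          using keys less.prems(1) b(2) mL L' by blast
        have "Poly_Mapping.lookup (t * b) (m + lm b) = c * Poly_Mapping.lookup b (lm b)"
          using lookup_leading_mult[OF zero t0 b(1), unfolded lt, folded lm_def] by (simp add: t_def)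
        then have "Poly_Mapping.lookup a' (lm a) = 0"
          using lb(1) by (simp add: a'_def lookup_minus m_def c_def in_keys_iff)
        then have "lm a' \<noteq> lm a"
          using leading_exp(1)[OF False, of "\<lambda>_. 0"] unfolding lm_def in_keys_iff by metis
        moreover have "lm a \<le> lm a'"
        proof -
          have "lm a' \<in> Poly_Mapping.keys a'" using leading_exp(1)[OF False] unfolding lm_def .
          then consider "lm a' \<in> Poly_Mapping.keys a" | j where "j \<in> Poly_Mapping.keys b" "lm a' = m + j"
            using keys by blast
          then show ?thesis
          proof cases
            case 1
            have v: "min_value (\<lambda>_. 0) p = 0" if "p \<noteq> 0" for p :: "'e \<Rightarrow>\<^sub>0 'c"
              using that by (auto simp: min_value_def)
            from 1 show ?thesis using la(3) v[OF a0] by simp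
          next
            case 2
            have v: "min_value (\<lambda>_. 0) p = 0" if "p \<noteq> 0" for p :: "'e \<Rightarrow>\<^sub>0 'c"
              using that by (auto simp: min_value_def)
            have "lm b \<le> j" using 2 lb(3) v[OF b(1)] by simp
            then have "lm a - lm b + lm b \<le> m + j" unfolding m_def by (rule add_left_mono)
            then show ?thesis using 2 by simp
          qed
        qed
        ultimately have lt': "lm a < lm a'" by simp
        have val: "min_value \<phi> a \<le> min_value \<phi> a'" if "\<phi> \<in> \<Phi>" for \<phi>
        proof -
          obtain k where k: "k \<in> Poly_Mapping.keys a'" "\<phi> k = min_value \<phi> a'"
            using min_value_attained[OF False] by blast
          consider "k \<in> Poly_Mapping.keys a" | j where "j \<in> Poly_Mapping.keys b" "k = m + j"
            using keys[OF k(1)] by blast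
          then have "min_value \<phi> a \<le> \<phi> k"
          proof cases
            case 2
            have "\<phi> k = \<phi> m + \<phi> j" using 2 Modules.additive.add[OF \<Phi>(1)[OF that]] by simp
            then show ?thesis using \<phi>m[OF \<Phi>(1)[OF that]] min_value_le[OF 2(1), of \<phi>] by linarith
          qed (rule min_value_le)
          then show ?thesis using k by simp
        qed
        have "box a' \<subseteq> box a"
          using val lt' unfolding box_def by (fastforce simp: algebra_simps)
        moreover have "m \<in> box a" using \<phi>m \<Phi>(1) by (auto simp: box_def m_def)
        moreover have "m \<notin> box a'" using lt' by (auto simp: box_def m_def)
        ultimately have "card (box a') < card (box a)"
          using fin by (intro psubset_card_mono) auto
        \<comment> \<open>Mixed products make the induction close: expanding one factor a' = a - t *
          b trades it for a factor a or for t * b. The case j = 0 is the almost integrality of a' /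
          b.\<close>
        moreover have "\<exists>q. Poly_Mapping.keys q \<subseteq> \<Gamma> \<and> d * a ^ j * a' ^ k = q * b ^ (j + k)" for j k
        proof (induction k arbitrary: j)
          case 0
          then show ?case using less.prems(2)[of j] by simp
        next
          case (Suc k)
          obtain q1 where q1: "Poly_Mapping.keys q1 \<subseteq> \<Gamma>" "d * a ^ Suc j * a' ^ k = q1 * b ^ (Suc j + k)"
            using Suc.IH[of "Suc j"] by blast
          obtain q2 where q2: "Poly_Mapping.keys q2 \<subseteq> \<Gamma>" "d * a ^ j * a' ^ k = q2 * b ^ (j + k)"
            using Suc.IH[of j] by blast
          have "d * a ^ j * a' ^ Suc k = d * a ^ Suc j * a' ^ k - t * b * (d * a ^ j * a' ^ k)"
            by (simp add: a'_def algebra_simps)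
          also have "\<dots> = (q1 - t * q2) * b ^ (j + Suc k)"
            unfolding q1(2) q2(2) by (simp add: algebra_simps)
          finally have "d * a ^ j * a' ^ Suc k = (q1 - t * q2) * b ^ (j + Suc k)" .
          moreover have "Poly_Mapping.keys (q1 - t * q2) \<subseteq> \<Gamma>"
          proof
            fix k assume "k \<in> Poly_Mapping.keys (q1 - t * q2)"
            then have "k \<in> Poly_Mapping.keys q1 \<or> k \<in> Poly_Mapping.keys (t * q2)"
              by (auto simp: in_keys_iff lookup_minus)
            then show "k \<in> \<Gamma>" using q1(1) q2(1) t\<Gamma> \<Gamma>' keys_mult[of t q2] by blast
          qed
          ultimately show ?case by blast
        qed
        from this[of 0] have "\<And>k. \<exists>q. Poly_Mapping.keys q \<subseteq> \<Gamma> \<and> d * a' ^ k = q * b ^ k"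
          by simp
        ultimately obtain q where q: "Poly_Mapping.keys q \<subseteq> \<Gamma>" "a' = q * b"
          using less.hyps[of a'] keysL by blast
        have "a = (q + t) * b" using q(2) by (simp add: a'_def algebra_simps)
        moreover have "Poly_Mapping.keys (q + t) \<subseteq> \<Gamma>"
          using Poly_Mapping.keys_add[of q t] q(1) t\<Gamma> by blast
        ultimately show ?thesis by blast
      qed
    qed
  qed
qed

section \<open>Semigroup algebras and their blow-ups\<close>

definition const_fun :: "complex \<Rightarrow> 'n::{finite,linorder} ratfun" where
  "const_fun c = Fract (Poly_Mapping.single 0 c) 1"

definition submonoid_exps :: "'e::monoid_add set \<Rightarrow> bool" where
  "submonoid_exps \<Gamma> \<longleftrightarrow> 0 \<in> \<Gamma> \<and> (\<forall>x\<in>\<Gamma>. \<forall>y\<in>\<Gamma>. x + y \<in> \<Gamma>)"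

lemma Fract_1_eq_iff: "Fract p 1 = Fract q 1 \<longleftrightarrow> p = q"
  by (simp add: eq_fract)

lemma Fract_1_eq_0_iff: "Fract p 1 = 0 \<longleftrightarrow> p = 0"
  by (simp add: Zero_fract_def eq_fract)

lemma Fract_1_arith:
  "Fract p 1 + Fract q 1 = Fract (p + q) 1" "Fract p 1 - Fract q 1 = Fract (p - q) 1"
  "Fract p 1 * Fract q 1 = Fract (p * q) 1" "Fract p 1 ^ k = Fract (p ^ k) 1"
proof -
  show "Fract p 1 ^ k = Fract (p ^ k) 1" by (induction k) (auto simp: One_fract_def)
qed auto

lemma Fract_1_sum: "Fract (sum f F) 1 = (\<Sum>i\<in>F. Fract (f i) 1)"
proof (induction F rule: infinite_finite_induct)
  case (insert x F)
  have "Fract (f x + sum f F) 1 = Fract (f x) 1 + Fract (sum f F) 1" by simp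
  then show ?case using insert by (simp del: add_fract)
qed (auto simp: Zero_fract_def)

lemma laurent_character_0 [simp]: "laurent_character 0 = 1"
  by (simp add: laurent_character_def One_fract_def)

lemma laurent_character_add: "laurent_character (m + n) = laurent_character m * laurent_character n"
  by (simp add: laurent_character_def mult_single)

lemma laurent_character_nonzero [simp]: "laurent_character m \<noteq> 0"
proof -
  have "Poly_Mapping.lookup (Poly_Mapping.single m 1 :: _ \<Rightarrow>\<^sub>0 complex) m \<noteq> 0" by simp
  then show ?thesis unfolding laurent_character_def Fract_1_eq_0_iff by (metis lookup_zero)
qed

lemma laurent_character_diff: "laurent_character (m - n) = laurent_character m / laurent_character n"
proof -
  have "laurent_character (m - n) * laurent_character n = laurent_character m"
    by (simp flip: laurent_character_add)
  then show ?thesis by (metis laurent_character_nonzero nonzero_mult_div_cancel_right)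
qed

lemma inverse_laurent_character: "inverse (laurent_character m) = laurent_character (- m)"
  using laurent_character_diff[of 0 m] by (simp add: inverse_eq_divide)

lemma Fract_1_expand:
  "Fract p 1 = (\<Sum>m\<in>Poly_Mapping.keys p. const_fun (Poly_Mapping.lookup p m) * laurent_character m)"
proof -
  have "p = (\<Sum>m\<in>Poly_Mapping.keys p. Poly_Mapping.single m (Poly_Mapping.lookup p m))"
    by (rule poly_mapping_eqI) (auto simp: lookup_sum lookup_single when_def in_keys_iff sum.delta)
  then have "Fract p 1 = (\<Sum>m\<in>Poly_Mapping.keys p. Fract (Poly_Mapping.single m (Poly_Mapping.lookup p m)) 1)"
    by (metis Fract_1_sum)
  then show ?thesis by (simp add: const_fun_def laurent_character_def mult_single)
qed

lemma semigroup_algebra_iff: "Fract p 1 \<in> semigroup_algebra \<Gamma> \<longleftrightarrow> Poly_Mapping.keys p \<subseteq> \<Gamma>"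
  by (auto simp: semigroup_algebra_def Fract_1_eq_iff)

lemma semigroup_algebraE:
  assumes "x \<in> semigroup_algebra \<Gamma>"
  obtains p where "x = Fract p 1" "Poly_Mapping.keys p \<subseteq> \<Gamma>"
  using assms by (auto simp: semigroup_algebra_def)

lemma semigroup_algebra_mono: "\<Gamma> \<subseteq> \<Gamma>' \<Longrightarrow> semigroup_algebra \<Gamma> \<subseteq> semigroup_algebra \<Gamma>'"
  by (auto simp: semigroup_algebra_def)

lemma laurent_character_in_iff: "laurent_character m \<in> semigroup_algebra \<Gamma> \<longleftrightarrow> m \<in> \<Gamma>"
  by (simp add: laurent_character_def semigroup_algebra_iff)

lemma semigroup_algebra_diff:
  assumes "x \<in> semigroup_algebra \<Gamma>" "y \<in> semigroup_algebra \<Gamma>"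
  shows "x - y \<in> semigroup_algebra \<Gamma>"
proof -
  obtain p q where p: "x = Fract p 1" "Poly_Mapping.keys p \<subseteq> \<Gamma>"
    and q: "y = Fract q 1" "Poly_Mapping.keys q \<subseteq> \<Gamma>"
    using assms by (auto elim!: semigroup_algebraE)
  have "Poly_Mapping.keys (p - q) \<subseteq> Poly_Mapping.keys p \<union> Poly_Mapping.keys q"
    by (auto simp: in_keys_iff lookup_minus)
  then have "Poly_Mapping.keys (p - q) \<subseteq> \<Gamma>" using p q by blast
  then show ?thesis unfolding p q Fract_1_arith semigroup_algebra_iff .
qed

lemma semigroup_algebra_mult:
  assumes "x \<in> semigroup_algebra \<Gamma>" "y \<in> semigroup_algebra \<Gamma>'"
    and "\<And>m n. m \<in> \<Gamma> \<Longrightarrow> n \<in> \<Gamma>' \<Longrightarrow> m + n \<in> \<Gamma>''"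
  shows "x * y \<in> semigroup_algebra \<Gamma>''"
proof -
  obtain p q where p: "x = Fract p 1" "Poly_Mapping.keys p \<subseteq> \<Gamma>"
    and q: "y = Fract q 1" "Poly_Mapping.keys q \<subseteq> \<Gamma>'"
    using assms by (auto elim!: semigroup_algebraE)
  have "Poly_Mapping.keys (p * q) \<subseteq> \<Gamma>''" using p q assms(3) keys_mult[of p q] by blast
  then show ?thesis unfolding p q Fract_1_arith semigroup_algebra_iff .
qed

lemma unital_subring_semigroup_algebra:
  assumes "submonoid_exps \<Gamma>"
  shows "unital_subring (semigroup_algebra \<Gamma>)"
  unfolding unital_subring_def
proof (intro conjI ballI)
  have "laurent_character 0 \<in> semigroup_algebra \<Gamma>"
    using assms by (simp only: laurent_character_in_iff submonoid_exps_def)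
  then show "1 \<in> semigroup_algebra \<Gamma>" by simp
  fix x y assume "x \<in> semigroup_algebra \<Gamma>" "y \<in> semigroup_algebra \<Gamma>"
  then show "x - y \<in> semigroup_algebra \<Gamma>" "x * y \<in> semigroup_algebra \<Gamma>"
    using assms unfolding submonoid_exps_def
    by (auto intro: semigroup_algebra_diff semigroup_algebra_mult)
qed

lemma const_fun_in: "0 \<in> \<Gamma> \<Longrightarrow> const_fun c \<in> semigroup_algebra \<Gamma>"
  by (simp add: const_fun_def semigroup_algebra_iff)

lemma semigroup_algebra_subset:
  assumes B: "unital_subring B" "range const_fun \<subseteq> B" "\<And>m. m \<in> \<Gamma> \<Longrightarrow> laurent_character m \<in> B"
  shows "semigroup_algebra \<Gamma> \<subseteq> B"
proof
  fix x assume "x \<in> semigroup_algebra \<Gamma>"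
  then obtain p where p: "x = Fract p 1" "Poly_Mapping.keys p \<subseteq> \<Gamma>" by (rule semigroup_algebraE)
  show "x \<in> B"
    unfolding p(1) Fract_1_expand
    by (intro unital_subring_sum[OF B(1)] unital_subringD(5)[OF B(1)]) (use p(2) B in auto)
qed

text \<open>Turns a ring into the submonoid \<Lambda> of exponents of its characters; statements
  about rings become statements about exponents.\<close>

lemma submonoid_characters:
  assumes "unital_subring B"
  shows "submonoid_exps {m. laurent_character m \<in> B}"
  using assms unfolding submonoid_exps_def by (auto simp: unital_subringD laurent_character_add)

text \<open>The local ring at the generic point of the orbit on which the characters of the elements of
  \<open>\<Gamma>\<close> with \<open>\<phi> m > 0\<close> vanish.\<close>

definition orbit_stalk :: "('n::{finite,linorder} \<Rightarrow>\<^sub>0 int) set \<Rightarrow> (('n \<Rightarrow>\<^sub>0 int) \<Rightarrow> real) \<Rightarrow> 'n ratfun set" where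
  "orbit_stalk \<Gamma> \<phi> = localization (semigroup_algebra \<Gamma>) (semigroup_algebra {m \<in> \<Gamma>. \<phi> m > 0})"

text \<open>The least \<phi>-value is additive under products. Two factors that each have an
  exponent with \<phi> \<le> 0 therefore have a product with such an exponent.\<close>

lemma prime_orbit:
  fixes \<phi> :: "('n::{finite,linorder} \<Rightarrow>\<^sub>0 int) \<Rightarrow> real"
  assumes \<Gamma>: "submonoid_exps \<Gamma>" and \<phi>: "Modules.additive \<phi>" "\<And>m. m \<in> \<Gamma> \<Longrightarrow> 0 \<le> \<phi> m"
  shows "prime_in (semigroup_algebra {m \<in> \<Gamma>. \<phi> m > 0}) (semigroup_algebra \<Gamma>)" (is "prime_in ?P ?A")
  unfolding prime_in_def
proof (intro conjI ballI impI)
  note add = Modules.additive.add[OF \<phi>(1)]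
  have A: "unital_subring ?A" by (rule unital_subring_semigroup_algebra[OF \<Gamma>])
  show "?P \<subseteq> ?A" by (rule semigroup_algebra_mono) auto
  have "Fract 0 1 \<in> ?P" unfolding semigroup_algebra_iff by simp
  then show z: "0 \<in> ?P" by (simp add: Zero_fract_def)
  have "laurent_character 0 \<notin> ?P"
    unfolding laurent_character_in_iff using Modules.additive.zero[OF \<phi>(1)] by simp
  then show "1 \<notin> ?P" by simp
  {
    fix x y assume xy: "x \<in> ?P" "y \<in> ?P"
    have "x - (0 - y) \<in> ?P" using xy z by (intro semigroup_algebra_diff)
    then show "x + y \<in> ?P" by simp
  next
    fix x y assume xy: "x \<in> ?P" "y \<in> ?A"
    then show "x * y \<in> ?P"
      by (rule semigroup_algebra_mult)
        (use \<Gamma> \<phi>(2) in \<open>auto simp: submonoid_exps_def add add_pos_nonneg\<close>)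
  next
    fix x y assume xy: "x \<in> ?A" "y \<in> ?A" "x * y \<in> ?P"
    obtain p q where p: "x = Fract p 1" "Poly_Mapping.keys p \<subseteq> \<Gamma>"
      and q: "y = Fract q 1" "Poly_Mapping.keys q \<subseteq> \<Gamma>"
      using xy by (auto elim!: semigroup_algebraE)
    show "x \<in> ?P \<or> y \<in> ?P"
    proof (rule ccontr)
      assume n: "\<not> ?thesis"
      then have 0: "p \<noteq> 0" "q \<noteq> 0" using z p q by (auto simp: Zero_fract_def)
      obtain m n where m: "m \<in> Poly_Mapping.keys p" "\<not> \<phi> m > 0" and n: "n \<in> Poly_Mapping.keys q" "\<not> \<phi> n > 0"
        using n p q unfolding p q semigroup_algebra_iff by blast
      have "min_value \<phi> p \<le> 0" "min_value \<phi> q \<le> 0"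
        using min_value_le[OF m(1), of \<phi>] min_value_le[OF n(1), of \<phi>] m n by linarith+
      then have "min_value \<phi> (p * q) \<le> 0" using leading_exp_mult(2)[OF \<phi>(1) 0] by simp
      moreover obtain k where "k \<in> Poly_Mapping.keys (p * q)" "\<phi> k = min_value \<phi> (p * q)"
        using min_value_attained[of "p * q" \<phi>] 0 by auto
      moreover have "Poly_Mapping.keys (p * q) \<subseteq> {m \<in> \<Gamma>. \<phi> m > 0}"
        using xy(3) unfolding p q Fract_1_arith semigroup_algebra_iff .
      ultimately show False by auto
    qed
  }
qed

lemma orbit_stalk:
  fixes \<phi> :: "('n::{finite,linorder} \<Rightarrow>\<^sub>0 int) \<Rightarrow> real"
  assumes \<Gamma>: "submonoid_exps \<Gamma>" and \<phi>: "Modules.additive \<phi>" "\<And>m. m \<in> \<Gamma> \<Longrightarrow> 0 \<le> \<phi> m"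
  shows "orbit_stalk \<Gamma> \<phi> \<in> Spec (semigroup_algebra \<Gamma>)" "local_subring (orbit_stalk \<Gamma> \<phi>)"
    "semigroup_algebra \<Gamma> \<subseteq> orbit_stalk \<Gamma> \<phi>"
    "x \<in> semigroup_algebra \<Gamma> \<Longrightarrow>
      x \<in> max_ideal (orbit_stalk \<Gamma> \<phi>) \<longleftrightarrow> x \<in> semigroup_algebra {m \<in> \<Gamma>. \<phi> m > 0}"
proof -
  note A = unital_subring_semigroup_algebra[OF \<Gamma>]
  note P = prime_orbit[OF \<Gamma> \<phi>]
  show "orbit_stalk \<Gamma> \<phi> \<in> Spec (semigroup_algebra \<Gamma>)"
    unfolding Spec_def orbit_stalk_def using primeideal_iff[OF A] P by blast
  show "local_subring (orbit_stalk \<Gamma> \<phi>)" "semigroup_algebra \<Gamma> \<subseteq> orbit_stalk \<Gamma> \<phi>"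
    "x \<in> semigroup_algebra \<Gamma> \<Longrightarrow>
      x \<in> max_ideal (orbit_stalk \<Gamma> \<phi>) \<longleftrightarrow> x \<in> semigroup_algebra {m \<in> \<Gamma>. \<phi> m > 0}"
    unfolding orbit_stalk_def using local_subring_localization[OF A P] by auto
qed

text \<open>If the characters with \<phi> m > 0 are nonunits of R, so are their combinations; hence
  denominators that are units in R avoid the prime of the orbit.\<close>

lemma orbit_stalk_greatest:
  fixes \<phi> :: "('n::{finite,linorder} \<Rightarrow>\<^sub>0 int) \<Rightarrow> real"
  assumes \<Gamma>: "submonoid_exps \<Gamma>" and R: "R \<in> Spec (semigroup_algebra \<Gamma>)"
    and "\<And>m. m \<in> \<Gamma> \<Longrightarrow> \<phi> m > 0 \<Longrightarrow> laurent_character m \<in> max_ideal R"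
  shows "R \<subseteq> orbit_stalk \<Gamma> \<phi>"
proof
  let ?A = "semigroup_algebra \<Gamma>" and ?P = "semigroup_algebra {m \<in> \<Gamma>. \<phi> m > 0}"
  note A = unital_subring_semigroup_algebra[OF \<Gamma>]
  note r = SpecD[OF A R]
  have P: "y \<in> max_ideal R" if "y \<in> ?P" for y
  proof -
    obtain p where p: "y = Fract p 1" "Poly_Mapping.keys p \<subseteq> {m \<in> \<Gamma>. \<phi> m > 0}"
      using \<open>y \<in> ?P\<close> by (rule semigroup_algebraE)
    have "laurent_character m * const_fun c \<in> max_ideal R" if "m \<in> Poly_Mapping.keys p" for m c
      using that p assms(3) r(3) const_fun_in[of \<Gamma> c] \<Gamma>
      by (intro max_ideal_mult[OF r(2)]) (auto simp: submonoid_exps_def)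
    then show ?thesis
      unfolding p(1) Fract_1_expand by (intro max_ideal_sum[OF r(1)]) (simp add: mult.commute)
  qed
  fix s assume "s \<in> R"
  then obtain x y where xy: "x \<in> ?A" "y \<in> ?A" "y \<noteq> 0" "inverse y \<in> R" "s = x / y"
    using r(4)[of s] by blast
  then have "y \<notin> ?P" using P by (auto simp: max_ideal_def)
  then show "s \<in> orbit_stalk \<Gamma> \<phi>" using xy unfolding orbit_stalk_def localization_def by blast
qed

text \<open>A denominator has an exponent with \<phi> k \<le> 0, where \<psi> vanishes, so its least
  \<psi>-value is at most 0. Multiplied by the character of m it would give a numerator over
  \<Gamma> with a negative \<psi>-value.\<close>

lemma character_notin_orbit_stalk:
  fixes \<phi> \<psi> :: "('n::{finite,linorder} \<Rightarrow>\<^sub>0 int) \<Rightarrow> real"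
  assumes \<psi>: "Modules.additive \<psi>" "\<And>k. k \<in> \<Gamma> \<Longrightarrow> 0 \<le> \<psi> k" "\<And>k. k \<in> \<Gamma> \<Longrightarrow> \<phi> k \<le> 0 \<Longrightarrow> \<psi> k = 0"
    and m: "\<psi> m < 0"
  shows "laurent_character m \<notin> orbit_stalk \<Gamma> \<phi>"
proof
  assume "laurent_character m \<in> orbit_stalk \<Gamma> \<phi>"
  then obtain x y where xy: "laurent_character m = x / y" "x \<in> semigroup_algebra \<Gamma>"
    "y \<in> semigroup_algebra \<Gamma>" "y \<notin> semigroup_algebra {m \<in> \<Gamma>. \<phi> m > 0}"
    unfolding orbit_stalk_def localization_def by blast
  obtain p q where p: "x = Fract p 1" "Poly_Mapping.keys p \<subseteq> \<Gamma>"
    and q: "y = Fract q 1" "Poly_Mapping.keys q \<subseteq> \<Gamma>"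
    using xy by (auto elim!: semigroup_algebraE)
  obtain k where k: "k \<in> Poly_Mapping.keys q" "\<phi> k \<le> 0"
    using xy(4) q(2) unfolding q semigroup_algebra_iff by force
  have q0: "q \<noteq> 0" using k(1) by auto
  have s0: "Poly_Mapping.single m (1::complex) \<noteq> 0"
    by (metis lookup_single_eq lookup_zero zero_neq_one)
  have "Fract (Poly_Mapping.single m 1 * q) 1 = Fract p 1"
    using xy(1) q0 unfolding p q laurent_character_def by (simp add: eq_fract mult.commute)
  then have eq: "p = Poly_Mapping.single m 1 * q" by (simp add: Fract_1_eq_iff)
  have "min_value \<psi> p = \<psi> m + min_value \<psi> q"
    unfolding eq leading_exp_mult(2)[OF \<psi>(1) s0 q0] by (simp add: min_value_def)
  moreover have "min_value \<psi> q \<le> 0"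
    using min_value_le[OF k(1), of \<psi>] \<psi>(3) k q by auto
  moreover have "p \<noteq> 0" using eq q0 s0 by simp
  then obtain j where "j \<in> Poly_Mapping.keys p" "\<psi> j = min_value \<psi> p" by (rule min_value_attained)
  then have "0 \<le> min_value \<psi> p" using \<psi>(2) p(2) by (metis subsetD)
  ultimately show False using m by simp
qed

lemma point_blowup_UN: "point_blowup T (\<Union>i\<in>F. X i) = (\<Union>i\<in>F. point_blowup T (X i))"
  unfolding point_blowup_def by blast

text \<open>If T does not contain A, the ideal is the unit ideal and the single chart with v = 1 is
  A itself.\<close>

lemma point_blowup_Spec_trivial:
  assumes A: "unital_subring A" and T: "local_subring T" and "\<not> A \<subseteq> T"
  shows "point_blowup T (Spec A) = Spec A"
proof -
  have I: "point_ideal T A = A" using assms(3) by (auto simp: point_ideal_def)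
  have "point_blowup T (Spec A) = (\<Union>v\<in>{1}. Spec (blowup_chart A (point_ideal T A) v))"
    by (rule point_blowup_Spec[OF A T]) (use A I in \<open>auto simp: unital_subringD\<close>)
  moreover have "blowup_chart A A 1 = A"
    using blowup_chart(2)[of A A 1] blowup_chart(4)[OF A, of A A 1] by auto
  ultimately show ?thesis by (simp add: I)
qed

text \<open>The last hypothesis expresses by minimality that \<Gamma>' is generated by \<Gamma> and
  the differences m - v. It is applied to the exponents of the characters in the blow-up
  chart.\<close>

lemma blowup_chart_semigroup_algebra:
  assumes \<Gamma>: "submonoid_exps \<Gamma>" and \<Gamma>': "submonoid_exps \<Gamma>'" "\<Gamma> \<subseteq> \<Gamma>'"
    and 1: "\<And>m. m \<in> I \<Longrightarrow> m - v \<in> \<Gamma>'"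
    and 2: "\<And>\<Lambda>. submonoid_exps \<Lambda> \<Longrightarrow> \<Gamma> \<subseteq> \<Lambda> \<Longrightarrow> (\<And>m. m \<in> I \<Longrightarrow> m - v \<in> \<Lambda>) \<Longrightarrow> \<Gamma>' \<subseteq> \<Lambda>"
  shows "blowup_chart (semigroup_algebra \<Gamma>) (semigroup_algebra I) (laurent_character v)
    = semigroup_algebra \<Gamma>'" (is "?B = _")
proof
  note chart = blowup_chart[where R = "semigroup_algebra \<Gamma>" and I = "semigroup_algebra I"
      and f = "laurent_character v"]
  show "?B \<subseteq> semigroup_algebra \<Gamma>'"
  proof (rule chart(4))
    show "unital_subring (semigroup_algebra \<Gamma>')" by (rule unital_subring_semigroup_algebra[OF \<Gamma>'(1)])
    show "semigroup_algebra \<Gamma> \<subseteq> semigroup_algebra \<Gamma>'" by (rule semigroup_algebra_mono[OF \<Gamma>'(2)])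
    fix g assume g: "g \<in> semigroup_algebra I"
    have "laurent_character (- v) \<in> semigroup_algebra {- v}" by (simp add: laurent_character_in_iff)
    with g have "g * laurent_character (- v) \<in> semigroup_algebra \<Gamma>'"
      by (rule semigroup_algebra_mult) (use 1 in force)
    then show "g / laurent_character v \<in> semigroup_algebra \<Gamma>'"
      by (simp add: divide_inverse inverse_laurent_character)
  qed
  show "semigroup_algebra \<Gamma>' \<subseteq> ?B"
  proof (rule semigroup_algebra_subset[OF chart(1)])
    show "range const_fun \<subseteq> ?B"
      using const_fun_in[of \<Gamma>] \<Gamma> chart(2) by (auto simp: submonoid_exps_def)
    have "\<Gamma>' \<subseteq> {m. laurent_character m \<in> ?B}"
    proof (rule 2[OF submonoid_characters[OF chart(1)]])
      show "\<Gamma> \<subseteq> {m. laurent_character m \<in> ?B}"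
        using chart(2) laurent_character_in_iff by blast
      show "m - v \<in> {m. laurent_character m \<in> ?B}" if "m \<in> I" for m
        using chart(3)[of "laurent_character m"] that
        by (simp add: laurent_character_diff laurent_character_in_iff)
    qed
    then show "laurent_character m \<in> ?B" if "m \<in> \<Gamma>'" for m using that by blast
  qed
qed

text \<open>Translates the blow-up of a monomial ideal into exponents. \<Gamma> belongs to the chart
  and \<Gamma>0 to the cone of the center; \<Lambda> in hypothesis 3 will be the set of exponents of
  characters regular at a local ring where the character of m generates the ideal.\<close>

lemma point_blowup_semigroup_algebra:
  fixes \<phi> :: "('n::{finite,linorder} \<Rightarrow>\<^sub>0 int) \<Rightarrow> real"
  assumes \<Gamma>: "submonoid_exps \<Gamma>" and \<Gamma>0: "submonoid_exps \<Gamma>0" "\<Gamma> \<subseteq> \<Gamma>0"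
    and \<phi>: "Modules.additive \<phi>" "\<And>m. m \<in> \<Gamma>0 \<Longrightarrow> 0 \<le> \<phi> m"
    and I: "I = {m \<in> \<Gamma>. 0 < \<phi> m}" and V: "\<And>i. i \<in> J \<Longrightarrow> v i \<in> I"
    and \<Gamma>': "\<And>i. i \<in> J \<Longrightarrow> submonoid_exps (\<Gamma>' i)" "\<And>i. i \<in> J \<Longrightarrow> \<Gamma> \<subseteq> \<Gamma>' i"
    and 1: "\<And>i m. i \<in> J \<Longrightarrow> m \<in> I \<Longrightarrow> m - v i \<in> \<Gamma>' i"
    and 2: "\<And>i \<Lambda>. i \<in> J \<Longrightarrow> submonoid_exps \<Lambda> \<Longrightarrow> \<Gamma> \<subseteq> \<Lambda> \<Longrightarrow>
      (\<And>m. m \<in> I \<Longrightarrow> m - v i \<in> \<Lambda>) \<Longrightarrow> \<Gamma>' i \<subseteq> \<Lambda>"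
    and 3: "\<And>m \<Lambda>. m \<in> I \<Longrightarrow> submonoid_exps \<Lambda> \<Longrightarrow> \<Gamma> \<subseteq> \<Lambda> \<Longrightarrow>
      (\<And>x. x \<in> I \<Longrightarrow> x - m \<in> \<Lambda>) \<Longrightarrow> \<exists>i\<in>J. m - v i \<in> \<Lambda>"
  shows "point_blowup (orbit_stalk \<Gamma>0 \<phi>) (Spec (semigroup_algebra \<Gamma>))
    = (\<Union>i\<in>J. Spec (semigroup_algebra (\<Gamma>' i)))"
proof -
  let ?T = "orbit_stalk \<Gamma>0 \<phi>" and ?A = "semigroup_algebra \<Gamma>" and ?I = "semigroup_algebra I"
  note A = unital_subring_semigroup_algebra[OF \<Gamma>]
  note T = orbit_stalk[OF \<Gamma>0(1) \<phi>]
  have A0: "?A \<subseteq> semigroup_algebra \<Gamma>0" by (rule semigroup_algebra_mono[OF \<Gamma>0(2)])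
  have AT: "?A \<subseteq> ?T" using T(3) A0 by blast
  \<comment> \<open>The maximal ideal of the stalk is known on the larger algebra of \<Gamma>0; the
    ideal of the chart is its trace on the algebra of \<Gamma>.\<close>
  have I: "point_ideal ?T ?A = ?I"
  proof -
    have "x \<in> point_ideal ?T ?A \<longleftrightarrow> x \<in> ?A \<and> x \<in> semigroup_algebra {m \<in> \<Gamma>0. \<phi> m > 0}" for x
      using AT A0 T(4)[of x] by (auto simp: point_ideal_def)
    moreover have "x \<in> ?A \<and> x \<in> semigroup_algebra {m \<in> \<Gamma>0. \<phi> m > 0} \<longleftrightarrow> x \<in> ?I" for x
      unfolding semigroup_algebra_def I using \<Gamma>0(2) by (auto simp: Fract_1_eq_iff subset_iff)
    ultimately show ?thesis by blast
  qed
  have "point_blowup ?T (Spec ?A)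
      = (\<Union>v\<in>laurent_character ` v ` J. Spec (blowup_chart ?A (point_ideal ?T ?A) v))"
  proof (rule point_blowup_Spec[OF A T(2)])
    show "laurent_character ` v ` J \<subseteq> point_ideal ?T ?A - {0}"
      using V by (auto simp: I laurent_character_in_iff)
    fix S a assume S: "local_subring S" "?A \<subseteq> S" and a: "a \<in> point_ideal ?T ?A" "a \<noteq> 0"
      and g: "\<And>g. g \<in> point_ideal ?T ?A \<Longrightarrow> g / a \<in> S"
    note s = local_subringD(1)[OF S(1)]
    obtain p where p: "a = Fract p 1" "Poly_Mapping.keys p \<subseteq> I"
      using a(1) unfolding I by (rule semigroup_algebraE)
    have ch: "laurent_character m / a \<in> S" if "m \<in> I" for m
      using g that by (simp add: I laurent_character_in_iff)
    \<comment> \<open>Otherwise every quotient of a character of the ideal by a would be a nonunit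
      of S, and so would their combination given by the expansion of a, which is 1.\<close>
    have "\<exists>m\<in>I. a / laurent_character m \<in> S"
    proof (rule ccontr)
      assume n: "\<not> ?thesis"
      have "laurent_character m / a \<in> max_ideal S" if "m \<in> I" for m
        using n ch that by (auto simp: max_ideal_def)
      moreover have "const_fun c \<in> S" for c
        using const_fun_in[of \<Gamma> c] \<Gamma> S(2) by (auto simp: submonoid_exps_def)
      ultimately have "(\<Sum>m\<in>Poly_Mapping.keys p. laurent_character m / a * const_fun (Poly_Mapping.lookup p m))
          \<in> max_ideal S"
        using p(2) by (intro max_ideal_sum[OF S(1)] max_ideal_mult[OF s]) auto
      moreover have "(\<Sum>m\<in>Poly_Mapping.keys p. laurent_character m / a * const_fun (Poly_Mapping.lookup p m))
          = (\<Sum>m\<in>Poly_Mapping.keys p. const_fun (Poly_Mapping.lookup p m) * laurent_character m) / a"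
        unfolding sum_divide_distrib by (intro sum.cong) (auto simp: mult.commute)
      moreover have "\<dots> = 1" using a(2) unfolding Fract_1_expand[symmetric] p(1)[symmetric] by simp
      ultimately have "1 \<in> max_ideal S" by simp
      then show False using s by (auto simp: max_ideal_def unital_subringD)
    qed
    then obtain m where m: "m \<in> I" "a / laurent_character m \<in> S" by blast
    have "\<exists>i\<in>J. m - v i \<in> {w. laurent_character w \<in> S}"
    proof (rule 3[OF m(1) submonoid_characters[OF s]])
      show "\<Gamma> \<subseteq> {w. laurent_character w \<in> S}" using S(2) laurent_character_in_iff by blast
      fix x assume "x \<in> I"
      then have "laurent_character x / a * (a / laurent_character m) \<in> S"
        using ch m(2) by (intro unital_subringD(5)[OF s])
      then show "x - m \<in> {w. laurent_character w \<in> S}" using a(2) by (simp add: laurent_character_diff)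
    qed
    then obtain i where v: "i \<in> J" "laurent_character (m - v i) \<in> S" by blast
    have "a / laurent_character m * laurent_character (m - v i) \<in> S"
      using m(2) v(2) by (rule unital_subringD(5)[OF s])
    then have "a / laurent_character (v i) \<in> S" by (simp add: laurent_character_diff)
    then show "\<exists>v\<in>laurent_character ` v ` J. a / v \<in> S" using v(1) by blast
  qed
  also have "\<dots> = (\<Union>i\<in>J. Spec (blowup_chart ?A ?I (laurent_character (v i))))"
    unfolding I by blast
  also have "\<dots> = (\<Union>i\<in>J. Spec (semigroup_algebra (\<Gamma>' i)))"
  proof (rule SUP_cong[OF refl])
    fix i assume i: "i \<in> J"
    have "blowup_chart ?A ?I (laurent_character (v i)) = semigroup_algebra (\<Gamma>' i)"
      by (rule blowup_chart_semigroup_algebra[OF \<Gamma> \<Gamma>'(1)[OF i] \<Gamma>'(2)[OF i]])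
        (use 1[OF i] 2[OF i] in blast)+
    then show "Spec (blowup_chart ?A ?I (laurent_character (v i))) = Spec (semigroup_algebra (\<Gamma>' i))"
      by simp
  qed
  finally show ?thesis .
qed

section \<open>Toric varieties\<close>

lemma common_denominator:
  assumes A: "unital_subring A" and R: "R \<in> Spec A" and "finite F" "f ` F \<subseteq> R"
  shows "\<exists>c\<in>A. c \<noteq> 0 \<and> inverse c \<in> R \<and> (\<forall>i\<in>F. c * f i \<in> A)"
  using assms(3,4)
proof (induction F)
  case empty
  then show ?case using unital_subringD(1)[OF A] unital_subringD(1)[OF SpecD(2)[OF A R]]
    by (intro bexI[of _ 1]) auto
next
  case (insert j F)
  note r = SpecD[OF A R]
  obtain c where c: "c \<in> A" "c \<noteq> 0" "inverse c \<in> R" "\<forall>i\<in>F. c * f i \<in> A"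
    using insert by auto
  obtain x y where xy: "x \<in> A" "y \<in> A" "y \<noteq> 0" "inverse y \<in> R" "f j = x / y"
    using r(4)[of "f j"] insert.prems by auto
  have "c * y * f i \<in> A" if "i \<in> insert j F" for i
  proof (cases "i = j")
    case True
    then show ?thesis using xy c unital_subringD(5)[OF A c(1) xy(1)] by simp
  next
    case False
    then have "c * f i * y \<in> A" using that c(4) xy(2) by (intro unital_subringD(5)[OF A, of "c * f i" y]) auto
    then show ?thesis by (simp add: mult_ac)
  qed
  moreover have "c * y \<in> A" by (rule unital_subringD(5)[OF A c(1) xy(2)])
  moreover have "inverse (c * y) \<in> R" by (rule unit_mult[OF r(2) c(3) xy(4)])
  ultimately show ?case using c xy by (intro bexI[of _ "c * y"]) auto
qed

text \<open>The equation expresses each power of y through lower ones, so a d that clears the first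
  n powers clears all. This turns integrality into almost integrality.\<close>

lemma power_in_integral_extension:
  assumes A: "unital_subring A" and y: "y ^ n = (\<Sum>i<n. q i * y ^ i)" "\<And>i. i < n \<Longrightarrow> q i \<in> A"
    and d: "\<And>k. k < n \<Longrightarrow> d * y ^ k \<in> A"
  shows "d * y ^ k \<in> A"
proof (induction k rule: less_induct)
  case (less k)
  show ?case
  proof (cases "k < n")
    case False
    have "d * y ^ k = d * (y ^ n * y ^ (k - n))" using False by (simp flip: power_add)
    also have "\<dots> = (\<Sum>i<n. q i * (d * y ^ (i + (k - n))))"
      unfolding y(1) by (simp add: sum_distrib_left sum_distrib_right power_add mult_ac)
    also have "\<dots> \<in> A"
      using False by (intro unital_subring_sum[OF A] unital_subringD(5)[OF A] less) (auto intro: y)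
    finally show ?thesis .
  qed (rule d)
qed

text \<open>With c a common denominator of the coefficients of the equation of x, the element c * x
  is integral over A, hence lies in A by the hypothesis \<open>normal\<close>; and c is a unit of
  R.\<close>

lemma integral_closure_Spec:
  assumes A: "unital_subring A" and R: "R \<in> Spec A"
    and normal: "\<And>x d. d \<in> A \<Longrightarrow> d \<noteq> 0 \<Longrightarrow> (\<exists>a\<in>A. \<exists>b\<in>A. b \<noteq> 0 \<and> x = a / b) \<Longrightarrow>
      (\<And>k. d * x ^ k \<in> A) \<Longrightarrow> x \<in> A"
  shows "integral_closure R = R"
proof
  note r = SpecD[OF A R]
  show "R \<subseteq> integral_closure R"
  proof
    fix x assume x: "x \<in> R"
    have "\<exists>a\<in>R. \<exists>b\<in>R. b \<noteq> 0 \<and> x = a / b"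
      using x unital_subringD(1)[OF r(2)] by (intro bexI[of _ x] bexI[of _ 1]) auto
    moreover have "Polynomial.coeff [:- x, 1:] i \<in> R" for i
      using x r(2) by (auto simp: coeff_pCons unital_subringD split: nat.split)
    ultimately show "x \<in> integral_closure R"
      unfolding integral_closure_def by (intro CollectI conjI exI[of _ "[:- x, 1:]"]) auto
  qed
  show "integral_closure R \<subseteq> R"
  proof
    fix x assume "x \<in> integral_closure R"
    then obtain u v p where uv: "u \<in> R" "v \<in> R" "v \<noteq> 0" "x = u / v"
      and p: "Polynomial.lead_coeff p = 1" "\<And>i. Polynomial.coeff p i \<in> R" "poly p x = 0"
      unfolding integral_closure_def by blast
    define n where "n = Polynomial.degree p"
    obtain c where c: "c \<in> A" "c \<noteq> 0" "inverse c \<in> R" "\<forall>i\<in>{..n}. c * Polynomial.coeff p i \<in> A"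
      using common_denominator[OF A R, of "{..n}" "Polynomial.coeff p"] p(2)
      by (meson finite_atMost image_subsetI)
    obtain u1 u2 where u: "u1 \<in> A" "u2 \<in> A" "u2 \<noteq> 0" "u = u1 / u2" using r(4)[OF uv(1)] by blast
    obtain v1 v2 where v: "v1 \<in> A" "v2 \<in> A" "v2 \<noteq> 0" "v = v1 / v2" using r(4)[OF uv(2)] by blast
    define y where "y = c * x"
    define a b where "a = c * u1 * v2" and "b = u2 * v1"
    have ab: "a \<in> A" "b \<in> A" unfolding a_def b_def by (intro unital_subringD(5)[OF A] c u v)+
    have b0: "b \<noteq> 0" using u v uv by (auto simp: b_def)
    have yab: "y = a / b" using uv u v by (simp add: y_def a_def b_def field_simps)
    \<comment> \<open>Coefficients of the equation of y = c * x, obtained by multiplying that of x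
      by c^n. For i < n at least one factor c is left to clear the denominator of the i-th
      coefficient.\<close>
    define q where "q i = - (c ^ (n - Suc i) * (c * Polynomial.coeff p i))" for i
    have "0 = c ^ n * (\<Sum>i\<le>n. Polynomial.coeff p i * x ^ i)"
      using p(3) by (simp add: poly_altdef n_def)
    also have "\<dots> = (\<Sum>i\<le>n. c ^ (n - i) * Polynomial.coeff p i * y ^ i)"
      unfolding sum_distrib_left
    proof (intro sum.cong refl)
      fix i assume "i \<in> {..n}"
      then have "c ^ n = c ^ (n - i) * c ^ i" by (simp flip: power_add)
      then show "c ^ n * (Polynomial.coeff p i * x ^ i) = c ^ (n - i) * Polynomial.coeff p i * y ^ i"
        by (simp add: y_def power_mult_distrib mult_ac)
    qed
    also have "\<dots> = (\<Sum>i<n. c ^ (n - i) * Polynomial.coeff p i * y ^ i) + y ^ n"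
      using p(1) by (simp add: n_def flip: lessThan_Suc_atMost)
    also have "(\<Sum>i<n. c ^ (n - i) * Polynomial.coeff p i * y ^ i) = - (\<Sum>i<n. q i * y ^ i)"
      unfolding sum_negf[symmetric]
    proof (intro sum.cong refl)
      fix i assume "i \<in> {..<n}"
      then have "n - i = Suc (n - Suc i)" by auto
      then show "c ^ (n - i) * Polynomial.coeff p i * y ^ i = - (q i * y ^ i)"
        by (simp add: q_def mult_ac)
    qed
    finally have yn: "y ^ n = (\<Sum>i<n. q i * y ^ i)" by (simp add: algebra_simps)
    have "q i \<in> A" if "i < n" for i
    proof -
      have "c ^ (n - Suc i) * (c * Polynomial.coeff p i) \<in> A"
        using c(4) that by (intro unital_subringD(5)[OF A unital_subringD(7)[OF A c(1)]]) auto
      then show ?thesis unfolding q_def by (rule unital_subringD(6)[OF A])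
    qed
    moreover have "b ^ n * y ^ k \<in> A" if "k < n" for k
    proof -
      have "b ^ n = b ^ (n - k) * b ^ k" using that by (simp flip: power_add)
      then have "b ^ n * y ^ k = b ^ (n - k) * a ^ k" using b0 by (simp add: yab power_divide)
      then show ?thesis using ab by (simp add: unital_subringD[OF A])
    qed
    ultimately have "b ^ n * y ^ k \<in> A" for k
      using power_in_integral_extension[OF A yn] by blast
    then have "y \<in> A"
      using normal[of "b ^ n" y] ab b0 yab unital_subringD(7)[OF A] by auto
    then have "y * inverse c \<in> R" using c r(3) by (intro unital_subringD(5)[OF r(2)]) auto
    moreover have "y * inverse c = x" using c(2) by (simp add: y_def)
    ultimately show "x \<in> R" by simp
  qed
qed

lemma pairing_add: "pairing (m + n) u = pairing m u + pairing n u"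
  by (simp add: pairing_def lookup_add algebra_simps sum.distrib)

lemma pairing_diff: "pairing (m - n) u = pairing m u - pairing n u"
  by (simp add: pairing_def lookup_minus algebra_simps sum_subtractf)

lemma pairing_zero [simp]: "pairing 0 u = 0"
  by (simp add: pairing_def)

lemma additive_pairing: "Modules.additive (\<lambda>m. pairing m u)"
  by (simp add: Modules.additive_def pairing_add)

lemma submonoid_dual_semigroup: "submonoid_exps (dual_semigroup N \<sigma>)"
  by (auto simp: submonoid_exps_def dual_semigroup_def dual_lattice_def pairing_add)

text \<open>Each coordinate occurs with both signs, so lower bounds on these functionals enclose the
  exponents in a box. They play the part of \<Phi> in
  \<open>almost_integral_Laurent\<close>.\<close>

lemma finite_box_exps:
  "finite {m :: 'n::finite \<Rightarrow>\<^sub>0 int. \<forall>\<phi>\<in>(\<Union>i. {\<lambda>m. real_of_int (Poly_Mapping.lookup m i),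
     \<lambda>m. - real_of_int (Poly_Mapping.lookup m i)}). c \<phi> \<le> \<phi> m}" (is "finite ?S")
proof -
  define lo where "lo i = \<lfloor>c (\<lambda>m. real_of_int (Poly_Mapping.lookup m i))\<rfloor>" for i :: 'n
  define hi where "hi i = \<lceil>- c (\<lambda>m. - real_of_int (Poly_Mapping.lookup m i))\<rceil>" for i :: 'n
  have "Poly_Mapping.lookup ` ?S \<subseteq> PiE UNIV (\<lambda>i. {lo i..hi i})"
  proof
    fix f assume "f \<in> Poly_Mapping.lookup ` ?S"
    then obtain m where m: "f = Poly_Mapping.lookup m" "m \<in> ?S" by blast
    have "lo i \<le> f i \<and> f i \<le> hi i" for i
    proof -
      have "c (\<lambda>m. real_of_int (Poly_Mapping.lookup m i)) \<le> f i"
        "c (\<lambda>m. - real_of_int (Poly_Mapping.lookup m i)) \<le> - real_of_int (f i)" using m by auto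
      then show ?thesis unfolding lo_def hi_def by linarith
    qed
    then show "f \<in> PiE UNIV (\<lambda>i. {lo i..hi i})" by (simp add: PiE_iff)
  qed
  then have "finite (Poly_Mapping.lookup ` ?S)" by (rule finite_subset) (simp add: finite_PiE)
  then show ?thesis by (rule finite_imageD) (rule inj_onI, simp only: poly_mapping_eq_iff)
qed

lemma semigroup_algebra_normal:
  assumes d: "d \<in> semigroup_algebra (dual_semigroup N \<sigma>)" "d \<noteq> 0"
    and x: "\<exists>a\<in>semigroup_algebra (dual_semigroup N \<sigma>). \<exists>b\<in>semigroup_algebra (dual_semigroup N \<sigma>).
      b \<noteq> 0 \<and> x = a / b"
    and k: "\<And>k. d * x ^ k \<in> semigroup_algebra (dual_semigroup N \<sigma>)"
  shows "x \<in> semigroup_algebra (dual_semigroup N \<sigma>)"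
proof -
  let ?\<Gamma> = "dual_semigroup N \<sigma>"
  obtain a b where a: "Poly_Mapping.keys a \<subseteq> ?\<Gamma>" and b: "Poly_Mapping.keys b \<subseteq> ?\<Gamma>"
    and x: "x = Fract a 1 / Fract b 1" and b0: "Fract b 1 \<noteq> 0"
    using x by (auto elim!: semigroup_algebraE)
  obtain e where e: "Poly_Mapping.keys e \<subseteq> ?\<Gamma>" "d = Fract e 1" using d(1) by (auto elim!: semigroup_algebraE)
  have L: "dual_semigroup N \<sigma> = {m \<in> dual_lattice N. \<forall>\<phi>\<in>(\<lambda>u m. pairing m u) ` \<sigma>. 0 \<le> \<phi> m}"
    by (auto simp: dual_semigroup_def)
  have "\<exists>p. Poly_Mapping.keys p \<subseteq> ?\<Gamma> \<and> a = p * b"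
  proof (rule almost_integral_Laurent[OF _ finite_box_exps _ _ L])
    show "\<exists>p. Poly_Mapping.keys p \<subseteq> ?\<Gamma> \<and> e * a ^ k = p * b ^ k" for k
    proof -
      obtain p where p: "Poly_Mapping.keys p \<subseteq> ?\<Gamma>" "d * x ^ k = Fract p 1"
        using k[of k] by (auto elim!: semigroup_algebraE)
      have "x ^ k * Fract b 1 ^ k = Fract a 1 ^ k"
        using b0 unfolding x by (simp del: divide_fract add: power_divide)
      then have "Fract (e * a ^ k) 1 = d * x ^ k * Fract (b ^ k) 1"
        unfolding e(2) Fract_1_arith(3,4)[symmetric] by (simp only: mult.assoc)
      also have "\<dots> = Fract (p * b ^ k) 1" unfolding p(2) by simp
      finally show ?thesis using p(1) by (auto simp: Fract_1_eq_iff)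
    qed
    show "x - y \<in> dual_lattice N" if "x \<in> dual_lattice N" "y \<in> dual_lattice N" for x y
      using that by (auto simp: dual_lattice_def pairing_diff)
    show "b \<noteq> 0" using b0 by (auto simp: Zero_fract_def)
    show "e \<noteq> 0" using d(2) e by (auto simp: Zero_fract_def)
    show "Poly_Mapping.keys a \<subseteq> dual_lattice N" "Poly_Mapping.keys b \<subseteq> dual_lattice N"
      using a b by (auto simp: dual_semigroup_def)
  qed (auto simp: Modules.additive_def lookup_add pairing_add)
  then obtain p where p: "Poly_Mapping.keys p \<subseteq> ?\<Gamma>" "a = p * b" by blast
  have "x = Fract p 1"
    unfolding x p(2) Fract_1_arith(3)[symmetric] by (rule nonzero_mult_div_cancel_right[OF b0])
  then show ?thesis using p(1) by (simp add: semigroup_algebra_iff)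
qed

lemma toric_variety_normal:
  assumes "R \<in> toric_variety N \<Delta>"
  shows "integral_closure R = R"
proof -
  obtain \<sigma> where "R \<in> Spec (semigroup_algebra (dual_semigroup N \<sigma>))"
    using assms by (auto simp: toric_variety_def affine_toric_def)
  then show ?thesis
    by (rule integral_closure_Spec[OF unital_subring_semigroup_algebra[OF submonoid_dual_semigroup]])
      (use semigroup_algebra_normal in blast)
qed

lemma generization_closed_toric: "generization_closed (toric_variety N \<Delta>)"
  unfolding toric_variety_def affine_toric_def
  by (intro generization_closed_UN generization_closed_Spec unital_subring_semigroup_algebra
      submonoid_dual_semigroup)

section \<open>Cones given by generators, their faces and charts\<close>

lemma pairing_linear: "linear (pairing m)"
  by (rule linearI) (auto simp: pairing_def algebra_simps sum.distrib sum_distrib_left)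

lemma pairing_nonneg_pos: "(\<forall>u\<in>pos A. 0 \<le> pairing m u) \<longleftrightarrow> (\<forall>u\<in>A. 0 \<le> pairing m u)"
proof
  assume "\<forall>u\<in>A. 0 \<le> pairing m u"
  moreover have "convex_cone {u. 0 \<le> pairing m u}"
    unfolding convex_cone_iff
    by (auto simp: linear_0[OF pairing_linear] linear_add[OF pairing_linear] linear_cmul[OF pairing_linear])
  ultimately have "pos A \<subseteq> {u. 0 \<le> pairing m u}" unfolding pos_def by (intro hull_minimal) auto
  then show "\<forall>u\<in>pos A. 0 \<le> pairing m u" by blast
qed (auto simp: pos_def hull_inc)

lemma dual_semigroup_pos: "dual_semigroup N (pos A) = dual_semigroup N A"
  by (simp add: dual_semigroup_def pairing_nonneg_pos)

lemma pos_convex_hull: "pos (convex hull A) = pos A"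
  unfolding pos_def
proof (rule hull_unique[symmetric, THEN sym])
  show "convex hull A \<subseteq> convex_cone hull A" by (rule convex_hull_subset_convex_cone_hull)
  show "convex_cone (convex_cone hull A)" by (rule convex_cone_convex_cone_hull)
  show "convex_cone hull A \<subseteq> C" if "convex hull A \<subseteq> C" "convex_cone C" for C
    using that hull_subset[of A convex] by (intro hull_minimal) auto
qed

definition affine_chart :: "(real^'n::{finite,linorder}) set \<Rightarrow> (real^'n::{finite,linorder}) set \<Rightarrow> 'n ratfun set set"
  where "affine_chart N A = Spec (semigroup_algebra (dual_semigroup N A))"

lemma affine_toric_pos: "affine_toric N (pos A) = affine_chart N A"
  by (simp add: affine_toric_def affine_chart_def dual_semigroup_pos)

text \<open>The generators span a simplicial cone, witnessed by multiples of the dual basis in the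
  dual lattice; every subset of them then spans a face.\<close>

definition has_dual_vectors :: "(real^'n::finite) set \<Rightarrow> (real^'n) set \<Rightarrow> bool" where
  "has_dual_vectors N A \<longleftrightarrow> finite A \<and>
     (\<forall>a\<in>A. \<exists>m\<in>dual_lattice N. pairing m a > 0 \<and> (\<forall>b\<in>A - {a}. pairing m b = 0))"

lemma pairing_sum: "pairing (sum f F) u = (\<Sum>i\<in>F. pairing (f i) u)"
  by (induction F rule: infinite_finite_induct) (auto simp: pairing_add)

text \<open>The sum m of the dual vectors of A - B vanishes on B and is positive on A - B. Adding a
  multiple of m carries any exponent of B into the semigroup of A, and the character of m is a unit
  on the chart of B.\<close>

lemma affine_chart_face:
  assumes A: "has_dual_vectors N A" and B: "B \<subseteq> A"
  shows "affine_chart N B \<subseteq> affine_chart N A"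
proof
  let ?A = "semigroup_algebra (dual_semigroup N A)" and ?B = "semigroup_algebra (dual_semigroup N B)"
  note sA = unital_subring_semigroup_algebra[OF submonoid_dual_semigroup[of N A]]
  note sB = unital_subring_semigroup_algebra[OF submonoid_dual_semigroup[of N B]]
  fix S assume S: "S \<in> affine_chart N B"
  note s = SpecD[OF sB S[unfolded affine_chart_def]]
  have "\<exists>m\<in>dual_lattice N. pairing m a > 0 \<and> (\<forall>b\<in>A - {a}. pairing m b = 0)" if "a \<in> A" for a
    using A that by (auto simp: has_dual_vectors_def)
  then obtain f where f: "f a \<in> dual_lattice N" "pairing (f a) a > 0" "\<forall>b\<in>A - {a}. pairing (f a) b = 0"
    if "a \<in> A" for a by metis
  have fin: "finite A" using A by (simp add: has_dual_vectors_def)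
  define m where "m = (\<Sum>a\<in>A - B. f a)"
  have f0: "0 \<le> pairing (f a) b" if "a \<in> A" "b \<in> A" for a b
    using f[OF that(1)] that by (cases "a = b") auto
  have mL: "m \<in> dual_lattice N"
    using f by (auto simp: m_def dual_lattice_def pairing_sum intro!: Ints_sum)
  have mA: "0 \<le> pairing m a" if "a \<in> A" for a
    using f0 that by (auto simp: m_def pairing_sum intro!: sum_nonneg)
  have mB: "pairing m b = 0" if "b \<in> B" for b
    unfolding m_def pairing_sum
    by (rule sum.neutral) (use f B that in blast)
  have mpos: "0 < pairing m a" if "a \<in> A - B" for a
  proof -
    have "pairing (f a) a \<le> pairing m a"
      unfolding m_def pairing_sum
      by (rule member_le_sum) (use that f0 fin in auto)
    then show ?thesis using f(2)[of a] that by auto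
  qed
  have AB: "dual_semigroup N A \<subseteq> dual_semigroup N B" using B by (auto simp: dual_semigroup_def)
  have AS: "?A \<subseteq> S" using s(3) semigroup_algebra_mono[OF AB] by blast
  note fr = fractions_in_subset[OF sA s(2) AS]
  have "- m \<in> dual_semigroup N B"
    using mB mL pairing_diff[of 0 m] by (auto simp: dual_semigroup_def dual_lattice_def)
  then have minv: "laurent_character (- m) \<in> S" using s(3) laurent_character_in_iff by blast
  have "laurent_character w \<in> fractions_in S ?A" if w: "w \<in> dual_semigroup N B" for w
  proof -
    \<comment> \<open>The number of copies of m that makes the value at a nonnegative. As m is
      nonnegative on A, the sum k of these numbers serves all a at once.\<close>
    define c where "c a = nat \<lceil>- pairing w a / pairing m a\<rceil>" for a
    define k where "k = (\<Sum>a\<in>A - B. c a)"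
    have km: "pairing (\<Sum>i<k. m) a = k * pairing m a" for a by (simp add: pairing_sum)
    have "0 \<le> pairing (w + (\<Sum>i<k. m)) a" if "a \<in> A" for a
    proof (cases "a \<in> B")
      case True
      then show ?thesis using w mA that by (auto simp: dual_semigroup_def pairing_add km)
    next
      case False
      have "- pairing w a / pairing m a \<le> c a" unfolding c_def by linarith
      also have "real (c a) \<le> k"
        unfolding k_def of_nat_le_iff by (rule member_le_sum) (use that False fin in auto)
      finally have "- pairing w a \<le> k * pairing m a"
        using mpos[of a] that False pos_divide_le_eq by blast
      then show ?thesis by (simp add: pairing_add km)
    qed
    moreover have "w + (\<Sum>i<k. m) \<in> dual_lattice N"
      using w mL by (auto simp: dual_semigroup_def dual_lattice_def pairing_add pairing_sum)
    ultimately have "w + (\<Sum>i<k. m) \<in> dual_semigroup N A" by (simp add: dual_semigroup_def)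
    moreover have "(\<Sum>i<k. m) \<in> dual_semigroup N A"
      using mL mA by (auto simp: dual_semigroup_def dual_lattice_def pairing_sum)
    moreover have "inverse (laurent_character (\<Sum>i<k. m)) \<in> S"
    proof (induction k)
      case (Suc k)
      then show ?case
        using minv by (simp add: laurent_character_add inverse_laurent_character[of m]
            unit_mult[OF s(2)] mult.commute unital_subringD(5)[OF s(2)])
    qed (simp add: unital_subringD(1)[OF s(2)])
    ultimately have "laurent_character (w + (\<Sum>i<k. m)) / laurent_character (\<Sum>i<k. m) \<in> fractions_in S ?A"
      by (intro fractions_inI) (auto simp: laurent_character_in_iff)
    then show ?thesis by (simp add: laurent_character_add)
  qed
  then have "?B \<subseteq> fractions_in S ?A"
    using const_fun_in[of "dual_semigroup N A"] submonoid_dual_semigroup[of N A] fr(2)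
    by (intro semigroup_algebra_subset[OF fr(1)]) (auto simp: submonoid_exps_def)
  then show "S \<in> affine_chart N A"
    using Spec_transfer[OF sB S[unfolded affine_chart_def] sA AS] by (simp add: affine_chart_def)
qed

lemma toric_variety_complex:
  assumes "\<And>A. A \<in> G \<Longrightarrow> has_dual_vectors N A"
  shows "toric_variety N (fan_of (complex_of G)) = (\<Union>A\<in>G. affine_chart N A)"
proof -
  have "toric_variety N (fan_of (complex_of G)) = (\<Union>A\<in>G. \<Union>B\<in>Pow A. affine_chart N B)"
  proof (intro equalityI subsetI)
    fix S assume "S \<in> toric_variety N (fan_of (complex_of G))"
    then obtain A B where "A \<in> G" "B \<subseteq> A" "S \<in> affine_toric N (pos (convex hull B))"
      unfolding toric_variety_def fan_of_def complex_of_def by blast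
    then show "S \<in> (\<Union>A\<in>G. \<Union>B\<in>Pow A. affine_chart N B)"
      unfolding pos_convex_hull affine_toric_pos by blast
  next
    fix S assume "S \<in> (\<Union>A\<in>G. \<Union>B\<in>Pow A. affine_chart N B)"
    then obtain A B where "A \<in> G" "B \<subseteq> A" "S \<in> affine_toric N (pos (convex hull B))"
      unfolding pos_convex_hull affine_toric_pos by blast
    then show "S \<in> toric_variety N (fan_of (complex_of G))"
      unfolding toric_variety_def fan_of_def complex_of_def by blast
  qed
  also have "\<dots> = (\<Union>A\<in>G. affine_chart N A)"
  proof (rule SUP_cong[OF refl])
    fix A assume A: "A \<in> G"
    have "affine_chart N B \<subseteq> affine_chart N A" if "B \<in> Pow A" for B
      using affine_chart_face[OF assms[OF A]] that by blast
    then show "(\<Union>B\<in>Pow A. affine_chart N B) = affine_chart N A" by blast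
  qed
  finally show ?thesis .
qed

section \<open>Generic points of orbits and blow-ups of their closures\<close>

definition face_stalk :: "(real^'n::{finite,linorder}) set \<Rightarrow> (real^'n::{finite,linorder}) set \<Rightarrow> 'n ratfun set" where
  "face_stalk N T = orbit_stalk (dual_semigroup N T) (\<lambda>m. \<Sum>t\<in>T. pairing m t)"

lemma additive_pairing_sum: "Modules.additive (\<lambda>m. \<Sum>t\<in>T. pairing m t)"
  by (simp add: Modules.additive_def pairing_add sum.distrib)

lemma pairing_sum_nonneg: "m \<in> dual_semigroup N T \<Longrightarrow> 0 \<le> (\<Sum>t\<in>T. pairing m t)"
  by (auto simp: dual_semigroup_def intro: sum_nonneg)

lemma face_stalk:
  "face_stalk N T \<in> affine_chart N T" "local_subring (face_stalk N T)"
  "semigroup_algebra (dual_semigroup N T) \<subseteq> face_stalk N T"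
  "x \<in> semigroup_algebra (dual_semigroup N T) \<Longrightarrow> x \<in> max_ideal (face_stalk N T) \<longleftrightarrow>
    x \<in> semigroup_algebra {m \<in> dual_semigroup N T. 0 < (\<Sum>t\<in>T. pairing m t)}"
  unfolding face_stalk_def affine_chart_def
  using orbit_stalk[OF submonoid_dual_semigroup[of N T] additive_pairing_sum[of T] pairing_sum_nonneg]
  by simp_all

text \<open>The sum of the generators lies in the relative interior of the cone, so a nonnegative
  exponent that vanishes on it vanishes on the whole cone.\<close>

lemma pairing_nonzero_on_pos:
  assumes "finite T" "m \<in> dual_semigroup N T"
  shows "(\<exists>u\<in>pos T. pairing m u \<noteq> 0) \<longleftrightarrow> 0 < (\<Sum>t\<in>T. pairing m t)"
proof
  assume "0 < (\<Sum>t\<in>T. pairing m t)"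
  then obtain t where "t \<in> T" "pairing m t \<noteq> 0" by (metis less_irrefl sum.neutral)
  then show "\<exists>u\<in>pos T. pairing m u \<noteq> 0" by (auto simp: pos_def hull_inc)
next
  assume u: "\<exists>u\<in>pos T. pairing m u \<noteq> 0"
  show "0 < (\<Sum>t\<in>T. pairing m t)"
  proof (rule ccontr)
    assume "\<not> ?thesis"
    then have "(\<Sum>t\<in>T. pairing m t) = 0" using pairing_sum_nonneg[OF assms(2)] by simp
    then have "\<forall>t\<in>T. pairing m t = 0"
      using assms by (subst (asm) sum_nonneg_eq_0_iff) (auto simp: dual_semigroup_def)
    then have "\<forall>t\<in>T. 0 \<le> pairing m t" "\<forall>t\<in>T. 0 \<le> pairing (- m) t"
      using pairing_diff[of 0 m] by auto
    then have "\<forall>t\<in>pos T. 0 \<le> pairing m t" "\<forall>t\<in>pos T. 0 \<le> pairing (- m) t"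
      unfolding pairing_nonneg_pos by auto
    then show False using u pairing_diff[of 0 m] by force
  qed
qed

lemma orb_pos:
  assumes "finite T"
  shows "face_stalk N T \<in> orb N (pos T)" "R \<in> orb N (pos T) \<Longrightarrow> R \<subseteq> face_stalk N T"
proof -
  have orb: "R \<in> orb N (pos T) \<longleftrightarrow> R \<in> affine_chart N T \<and>
      (\<forall>m\<in>dual_semigroup N T. 0 < (\<Sum>t\<in>T. pairing m t) \<longrightarrow> laurent_character m \<in> max_ideal R)" for R
    using pairing_nonzero_on_pos[OF assms] by (auto simp: orb_def affine_toric_pos dual_semigroup_pos)
  show "face_stalk N T \<in> orb N (pos T)"
    unfolding orb by (simp add: face_stalk laurent_character_in_iff)
  show "R \<subseteq> face_stalk N T" if "R \<in> orb N (pos T)"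
    using that orbit_stalk_greatest[OF submonoid_dual_semigroup, of R N T "\<lambda>m. \<Sum>t\<in>T. pairing m t"]
    unfolding orb affine_chart_def face_stalk_def by blast
qed

lemma blowup_red_orb:
  "finite T \<Longrightarrow> blowup_red (orb N (pos T)) X = point_blowup (face_stalk N T) X"
  by (rule blowup_red_generic) (use orb_pos in blast)+

lemma openin_zariski: "openin (zariski X) {R \<in> X. x \<in> R}"
  unfolding zariski_def openin_topology_generated_by_iff by (rule generate_topology_on.Basis) blast

lemma topspace_zariski:
  assumes "\<And>R. R \<in> X \<Longrightarrow> 0 \<in> R"
  shows "topspace (zariski X) = X"
  unfolding zariski_def topology_generated_by_topspace using assms by blast

text \<open>Taking the closure keeps the generic point: if S is in the closure and x is in S, the
  open set of local rings containing x meets the orbit, so x lies in a ring contained in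
  \<open>face_stalk N T\<close>.\<close>

lemma blowup_red_orbit_closure:
  assumes T: "finite T" and \<Delta>: "pos T \<in> \<Delta>" and X: "X = toric_variety N \<Delta>"
  shows "blowup_red (orbit_closure N \<Delta> (pos T)) X = point_blowup (face_stalk N T) X"
proof (rule blowup_red_generic)
  have "0 \<in> R" if "R \<in> X" for R
    using that generization_closed_toric[of N \<Delta>] X
    by (auto simp: generization_closed_def local_subring_def unital_subringD)
  then have top: "topspace (zariski X) = X" by (rule topspace_zariski)
  have "orb N (pos T) \<subseteq> X" using \<Delta> X by (auto simp: orb_def toric_variety_def)
  then have "orb N (pos T) \<subseteq> orbit_closure N \<Delta> (pos T)"
    unfolding orbit_closure_def X[symmetric] by (intro closure_of_subset) (simp add: top)
  then show "face_stalk N T \<in> orbit_closure N \<Delta> (pos T)" using orb_pos(1)[OF T] by blast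
  fix S assume "S \<in> orbit_closure N \<Delta> (pos T)"
  then have S: "S \<in> X" "\<And>U. S \<in> U \<Longrightarrow> openin (zariski X) U \<Longrightarrow> \<exists>R. R \<in> orb N (pos T) \<and> R \<in> U"
    unfolding orbit_closure_def X[symmetric] in_closure_of top by auto
  show "S \<subseteq> face_stalk N T"
  proof
    fix x assume "x \<in> S"
    then obtain R where "R \<in> orb N (pos T)" "x \<in> R"
      using S(2)[OF _ openin_zariski, of x] S(1) by blast
    then show "x \<in> face_stalk N T" using orb_pos(2)[OF T] by blast
  qed
qed

text \<open>For T contained in A, these are the exponents of the monomial ideal of the orbit closure
  of \<open>pos T\<close> in the chart of A.\<close>

definition conormal_exps ::
  "(real^'n::{finite,linorder}) set \<Rightarrow> (real^'n::{finite,linorder}) set \<Rightarrow> (real^'n::{finite,linorder}) set \<Rightarrow> ('n \<Rightarrow>\<^sub>0 int) set" where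
  "conormal_exps N T A = {m \<in> dual_semigroup N A. 0 < (\<Sum>t\<in>T. pairing m t)}"

text \<open>The semigroup of the cone over \<open>B\<close> is that of the chart of the blow-up in which the ideal is
  generated by the character of \<open>v\<close>.\<close>

definition star_chart ::
  "(real^'n::{finite,linorder}) set \<Rightarrow> (real^'n::{finite,linorder}) set \<Rightarrow> (real^'n::{finite,linorder}) set \<Rightarrow>
    ('n \<Rightarrow>\<^sub>0 int) \<Rightarrow> (real^'n::{finite,linorder}) set \<Rightarrow> bool" where
  "star_chart N T A v B \<longleftrightarrow>
     v \<in> conormal_exps N T A \<and> dual_semigroup N A \<subseteq> dual_semigroup N B \<and>
     (\<forall>m\<in>conormal_exps N T A. m - v \<in> dual_semigroup N B) \<and>
     (\<forall>\<Lambda>. submonoid_exps \<Lambda> \<longrightarrow> dual_semigroup N A \<subseteq> \<Lambda> \<longrightarrow> (\<forall>m\<in>conormal_exps N T A. m - v \<in> \<Lambda>) \<longrightarrow>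
       dual_semigroup N B \<subseteq> \<Lambda>)"

text \<open>The second condition says that the characters \<open>v\<close> generate the ideal on every local scheme over
  the blow-up; there \<open>\<Lambda>\<close> is the set of exponents of the regular characters.\<close>

definition star_subdivision ::
  "(real^'n::{finite,linorder}) set \<Rightarrow> (real^'n::{finite,linorder}) set \<Rightarrow> (real^'n::{finite,linorder}) set \<Rightarrow>
    (('n \<Rightarrow>\<^sub>0 int) \<times> (real^'n::{finite,linorder}) set) set \<Rightarrow> bool" where
  "star_subdivision N T A P \<longleftrightarrow>
     (\<forall>(v, B)\<in>P. star_chart N T A v B) \<and>
     (\<forall>m\<in>conormal_exps N T A. \<forall>\<Lambda>. submonoid_exps \<Lambda> \<longrightarrow> dual_semigroup N A \<subseteq> \<Lambda> \<longrightarrow>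
       (\<forall>x\<in>conormal_exps N T A. x - m \<in> \<Lambda>) \<longrightarrow> (\<exists>(v, B)\<in>P. m - v \<in> \<Lambda>))"

lemma point_blowup_star_subdivision:
  assumes "T \<subseteq> A" "star_subdivision N T A P"
  shows "point_blowup (face_stalk N T) (affine_chart N A) = (\<Union>(v, B)\<in>P. affine_chart N B)"
proof -
  have chart: "star_chart N T A (fst i) (snd i)" if "i \<in> P" for i
    using assms(2) that unfolding star_subdivision_def by auto
  note c = chart[unfolded star_chart_def]
  have "point_blowup (face_stalk N T) (affine_chart N A) = (\<Union>i\<in>P. affine_chart N (snd i))"
    unfolding affine_chart_def face_stalk_def
  proof (rule point_blowup_semigroup_algebra[OF submonoid_dual_semigroup submonoid_dual_semigroup _
      additive_pairing_sum pairing_sum_nonneg conormal_exps_def])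
    show "dual_semigroup N A \<subseteq> dual_semigroup N T" using assms(1) by (auto simp: dual_semigroup_def)
    show "\<exists>i\<in>P. m - fst i \<in> \<Lambda>"
      if "m \<in> conormal_exps N T A" "submonoid_exps \<Lambda>" "dual_semigroup N A \<subseteq> \<Lambda>"
        "\<And>x. x \<in> conormal_exps N T A \<Longrightarrow> x - m \<in> \<Lambda>" for m \<Lambda>
    proof -
      have "\<exists>(v, B)\<in>P. m - v \<in> \<Lambda>"
        by (rule assms(2)[unfolded star_subdivision_def, THEN conjunct2, THEN bspec, OF that(1), THEN spec,
          THEN mp, OF that(2), THEN mp, OF that(3), THEN mp]) (intro ballI that(4))
      then show ?thesis by (auto simp: case_prod_beta)
    qed
    fix i assume i: "i \<in> P"
    show "fst i \<in> conormal_exps N T A" by (rule c[OF i, THEN conjunct1])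
    show "submonoid_exps (dual_semigroup N (snd i))" by (rule submonoid_dual_semigroup)
    show "dual_semigroup N A \<subseteq> dual_semigroup N (snd i)"
      by (rule c[OF i, THEN conjunct2, THEN conjunct1])
    show "m - fst i \<in> dual_semigroup N (snd i)" if "m \<in> conormal_exps N T A" for m
      by (rule c[OF i, THEN conjunct2, THEN conjunct2, THEN conjunct1, THEN bspec, OF that])
    show "dual_semigroup N (snd i) \<subseteq> \<Lambda>"
      if "submonoid_exps \<Lambda>" "dual_semigroup N A \<subseteq> \<Lambda>" "\<And>m. m \<in> conormal_exps N T A \<Longrightarrow> m - fst i \<in> \<Lambda>" for \<Lambda>
      by (rule c[OF i, THEN conjunct2, THEN conjunct2, THEN conjunct2, THEN spec, THEN mp, THEN mp, THEN mp])
        (use that in auto)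
  qed
  then show ?thesis by (auto simp: case_prod_beta)
qed

text \<open>The character of m is regular on the chart but has a pole at the generic point of the
  center, so the center misses the chart.\<close>

lemma point_blowup_away:
  assumes T: "finite T" and m: "m \<in> dual_semigroup N A" "t \<in> T" "pairing m t < 0"
  shows "point_blowup (face_stalk N T) (affine_chart N A) = affine_chart N A"
  unfolding affine_chart_def
proof (rule point_blowup_Spec_trivial)
  have "laurent_character m \<notin> face_stalk N T"
    unfolding face_stalk_def
  proof (rule character_notin_orbit_stalk[OF additive_pairing _ _ m(3)])
    fix k assume k: "k \<in> dual_semigroup N T"
    show "0 \<le> pairing k t" using k m(2) by (auto simp: dual_semigroup_def)
    assume "(\<Sum>t\<in>T. pairing k t) \<le> 0"
    moreover have "pairing k t \<le> (\<Sum>t\<in>T. pairing k t)"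
      by (rule member_le_sum) (use k m(2) T in \<open>auto simp: dual_semigroup_def\<close>)
    ultimately show "pairing k t = 0" using \<open>0 \<le> pairing k t\<close> by simp
  qed
  then show "\<not> semigroup_algebra (dual_semigroup N A) \<subseteq> face_stalk N T"
    using m(1) laurent_character_in_iff by blast
qed (auto simp: unital_subring_semigroup_algebra submonoid_dual_semigroup face_stalk(2))

section \<open>The semigroups of the cyclic quotient\<close>

text \<open>A nonzero slope is at least 1 in absolute value, so the value at c exceeds that at one
  end by at least 1; slope 0 leaves two equal values with positive sum.\<close>

lemma slope_interior:
  fixes a b c x y :: int
  assumes "a < c" "c < b" "0 \<le> a * x + y" "0 \<le> b * x + y" "0 < (a * x + y) + (b * x + y)"
  shows "1 \<le> c * x + y"
proof (cases "x = 0")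
  case False
  then consider "1 \<le> x" | "1 \<le> - x" by linarith
  then show ?thesis
  proof cases
    case 1
    then have "1 * 1 \<le> (c - a) * x" using assms by (intro mult_mono) auto
    then show ?thesis using assms by (simp add: algebra_simps)
  next
    case 2
    then have "1 * 1 \<le> (b - c) * (- x)" using assms by (intro mult_mono) auto
    then show ?thesis using assms by (simp add: algebra_simps)
  qed
qed (use assms in simp)

lemma slope_between:
  fixes a b c x y :: int
  assumes "a \<le> c" "c \<le> b" "0 \<le> a * x + y" "0 \<le> b * x + y"
  shows "0 \<le> c * x + y"
proof (cases "0 \<le> x")
  case True
  then have "0 \<le> (c - a) * x" using assms by simp
  then show ?thesis using assms by (simp add: algebra_simps)
next
  case False
  then have "0 \<le> (b - c) * (- x)" using assms by (intro mult_nonneg_nonneg) auto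
  then show ?thesis using assms by (simp add: algebra_simps)
qed

text \<open>Greedy choice: while the sum of g is below that of f, some g i can be raised by
  one.\<close>

lemma subsum_exists:
  fixes f :: "'i \<Rightarrow> int"
  assumes "finite S" "\<And>i. i \<in> S \<Longrightarrow> 0 \<le> f i" "int k \<le> sum f S"
  shows "\<exists>g. (\<forall>i\<in>S. 0 \<le> g i \<and> g i \<le> f i) \<and> sum g S = int k"
  using assms(3)
proof (induction k)
  case 0
  then show ?case using assms by (intro exI[of _ "\<lambda>_. 0"]) auto
next
  case (Suc k)
  then obtain g where g: "\<forall>i\<in>S. 0 \<le> g i \<and> g i \<le> f i" "sum g S = int k" by auto
  have "\<not> (\<forall>i\<in>S. f i \<le> g i)"
  proof
    assume "\<forall>i\<in>S. f i \<le> g i"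
    then have "sum f S \<le> sum g S" by (intro sum_mono) auto
    then show False using Suc.prems g by simp
  qed
  then obtain i where i: "i \<in> S" "g i < f i" by force
  have "sum (g(i := g i + 1)) S = sum g S + 1"
    using i(1) assms(1) by (simp add: sum.remove[of S i])
  then show ?case using g i by (intro exI[of _ "g(i := g i + 1)"]) auto
qed

lemma submonoid_sum:
  assumes "submonoid_exps \<Lambda>" "\<And>i. i \<in> F \<Longrightarrow> f i \<in> \<Lambda>"
  shows "sum f F \<in> \<Lambda>"
  using assms(2)
  by (induction F rule: infinite_finite_induct) (use assms(1) in \<open>auto simp: submonoid_exps_def\<close>)

lemma submonoid_add: "submonoid_exps \<Lambda> \<Longrightarrow> m \<in> \<Lambda> \<Longrightarrow> n \<in> \<Lambda> \<Longrightarrow> m + n \<in> \<Lambda>"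
  by (simp add: submonoid_exps_def)

lemma inj_unit_vec: "inj unit_vec"
  by (auto simp: inj_def unit_vec_def axis_eq_axis)

lemma pairing_unit_vec: "pairing m (unit_vec i) = of_int (Poly_Mapping.lookup m i)"
  unfolding pairing_def unit_vec_def axis_def by (simp add: if_distrib cong: if_cong)

section \<open>Coordinates on the dual lattice\<close>

locale cyclic_type =
  fixes l r :: nat and ty :: "'n::{finite,linorder} itself"
  assumes r: "r = CARD('n)" and card_ge_2: "r \<ge> 2" and l_ge: "l \<ge> r"
begin

abbreviation \<rho> :: int where "\<rho> \<equiv> int r - 1"
abbreviation L :: 'n where "L \<equiv> last_index"
abbreviation M :: "('n \<Rightarrow>\<^sub>0 int) set" where "M \<equiv> dual_lattice (N_G l)"
abbreviation D :: "(real, 'n) vec set \<Rightarrow> ('n \<Rightarrow>\<^sub>0 int) set" where "D \<equiv> dual_semigroup (N_G l)"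
abbreviation chart :: "(real, 'n) vec set \<Rightarrow> 'n ratfun set set" where "chart \<equiv> affine_chart (N_G l)"
abbreviation stalk :: "(real, 'n) vec set \<Rightarrow> 'n ratfun set" where "stalk \<equiv> face_stalk (N_G l)"
abbreviation conormal :: "(real, 'n) vec set \<Rightarrow> (real, 'n) vec set \<Rightarrow> ('n \<Rightarrow>\<^sub>0 int) set"
  where "conormal \<equiv> conormal_exps (N_G l)"
abbreviation lk :: "('n \<Rightarrow>\<^sub>0 int) \<Rightarrow> 'n \<Rightarrow> int" where "lk \<equiv> Poly_Mapping.lookup"

definition ht :: "('n \<Rightarrow>\<^sub>0 int) \<Rightarrow> int" where "ht m = (\<Sum>i\<in>-{L}. lk m i)"

text \<open>On the dual lattice, the pairing with \<open>npt l j\<close> is \<open>j * wt m + lk m L\<close>.\<close>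

definition wt :: "('n \<Rightarrow>\<^sub>0 int) \<Rightarrow> int" where "wt m = (ht m - \<rho> * lk m L) div int l"

text \<open>The element of the dual lattice supported on \<open>p\<close> and \<open>L\<close> with given \<open>wt\<close> and last coordinate.\<close>

definition pv :: "'n \<Rightarrow> int \<Rightarrow> int \<Rightarrow> ('n \<Rightarrow>\<^sub>0 int)" where
  "pv p x y = Poly_Mapping.single L y + Poly_Mapping.single p (\<rho> * y + int l * x)"

text \<open>Exponent of x_q / x_p. It pairs to 0 with every \<open>npt l j\<close>, so these
  exponents span the directions that the two-dimensional part \<open>pv\<close> does not
  see.\<close>

definition ev :: "'n \<Rightarrow> 'n \<Rightarrow> ('n \<Rightarrow>\<^sub>0 int)" where
  "ev q p = Poly_Mapping.single q 1 - Poly_Mapping.single p 1"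

text \<open>The members of \<open>\<Xi>\<close> are the complements of one index p among the
  non-last ones; recording p singles out the coordinate that is not forced to be
  nonnegative.\<close>

definition npt_simplex :: "'n \<Rightarrow> nat \<Rightarrow> nat \<Rightarrow> (real, 'n) vec set" where
  "npt_simplex p a b = {npt l a, npt l b} \<union> unit_vec ` (- {L, p})"

lemma l_pos: "0 < int l" and \<rho>_pos: "1 \<le> \<rho>" and l_gt: "\<rho> < int l"
  using card_ge_2 l_ge by auto

lemma other_index: "\<exists>p::'n. p \<noteq> L"
proof (rule ccontr)
  assume "\<not> ?thesis"
  then have "UNIV = {L}" by auto
  then have "CARD('n) = 1" by (metis card_1_singleton_iff One_nat_def)
  then show False using card_ge_2 r by simp
qed

lemma card_not_last: "card (- {L}) = nat \<rho>"
  by (simp add: card_Diff_singleton_if Compl_eq_Diff_UNIV nat_diff_distrib r)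

lemma sum_UNIV: "(\<Sum>i\<in>UNIV. f i) = f L + (\<Sum>i\<in>-{L}. f i)" for f :: "'n \<Rightarrow> 'b::ab_group_add"
  by (simp add: sum.remove[of UNIV L] Compl_eq_Diff_UNIV)

lemma sum_not_last: "p \<noteq> L \<Longrightarrow> (\<Sum>i\<in>-{L}. f i) = f p + (\<Sum>i\<in>-{L, p}. f i)"
  for f :: "'n \<Rightarrow> 'b::ab_group_add"
proof -
  assume "p \<noteq> L"
  then have "- {L} - {p} = - {L, p}" by auto
  then show ?thesis using sum.remove[of "- {L}" p f] \<open>p \<noteq> L\<close> by simp
qed

lemma pairing_npt_raw: "pairing m (npt l j) = (j * ht m + lk m L * (int l - j * \<rho>)) / real l"
proof -
  have "pairing m (npt l j) = lk m L * ((real l - real j * (real r - 1)) / real l)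
      + (\<Sum>i\<in>-{L}. lk m i * (real j / real l))"
    unfolding pairing_def npt_def sum_UNIV r
    by (intro arg_cong2[where f = "(+)"] sum.cong refl) auto
  also have "\<dots> = (j * ht m + lk m L * (int l - j * \<rho>)) / real l"
    by (simp add: ht_def sum_divide_distrib sum_distrib_left add_divide_distrib mult_ac flip: sum_distrib_right)
  finally show ?thesis .
qed

text \<open>The lattice is generated by the integral vectors and \<open>npt l 1\<close>, and the
  pairing with the latter is the integer \<open>lk m L\<close> plus the displayed quantity over
  l.\<close>

lemma M_iff: "m \<in> M \<longleftrightarrow> int l dvd ht m - \<rho> * lk m L"
proof -
  let ?g = "\<chi> i. (if i = L then real l - (real r - 1) else 1) / real l"
  have g: "?g = npt l 1" unfolding npt_def r by (simp cong: if_cong)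
  have l: "real l > 0" using l_pos by simp
  have p: "pairing m (npt l 1) = (ht m - \<rho> * lk m L) / real l + lk m L"
    unfolding pairing_npt_raw using l by (simp add: field_simps)
  have int: "pairing m z \<in> \<int>" if "\<forall>i. z $ i \<in> \<int>" for z
    using that unfolding pairing_def by (intro Ints_sum Ints_mult) auto
  have dvd: "(ht m - \<rho> * lk m L) / real l \<in> \<int> \<longleftrightarrow> int l dvd ht m - \<rho> * lk m L"
  proof
    assume "(ht m - \<rho> * lk m L) / real l \<in> \<int>"
    then obtain z where "(ht m - \<rho> * lk m L) / real l = of_int z" by (auto elim: Ints_cases)
    then have "real_of_int (ht m - \<rho> * lk m L) = of_int (int l * z)" using l by (simp add: field_simps)
    then show "int l dvd ht m - \<rho> * lk m L" unfolding of_int_eq_iff by (rule dvdI)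
  next
    assume "int l dvd ht m - \<rho> * lk m L"
    then obtain z where "ht m - \<rho> * lk m L = int l * z" by (rule dvdE)
    then show "(ht m - \<rho> * lk m L) / real l \<in> \<int>" using l by simp
  qed
  have "m \<in> M \<longleftrightarrow> pairing m (npt l 1) \<in> \<int>"
  proof
    assume "m \<in> M"
    moreover have "npt l 1 \<in> (N_G l :: (real, 'n) vec set)"
      unfolding N_G_def r[symmetric] g by (rule CollectI, rule exI[of _ 0], rule exI[of _ 1]) simp
    ultimately show "pairing m (npt l 1) \<in> \<int>" unfolding dual_lattice_def by blast
  next
    assume *: "pairing m (npt l 1) \<in> \<int>"
    show "m \<in> M"
      unfolding dual_lattice_def N_G_def r[symmetric] g
      using Ints_add[OF int Ints_mult[OF Ints_of_int *]]
      by (auto simp: linear_add[OF pairing_linear] linear_cmul[OF pairing_linear])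
  qed
  also have "\<dots> \<longleftrightarrow> (ht m - \<rho> * lk m L) / real l \<in> \<int>"
    unfolding p using Ints_add[of "(ht m - \<rho> * lk m L) / real l" "lk m L"]
      Ints_diff[of "(ht m - \<rho> * lk m L) / real l + lk m L" "lk m L"] by auto
  finally show ?thesis unfolding dvd .
qed

lemma ht_eq: "m \<in> M \<Longrightarrow> ht m = \<rho> * lk m L + int l * wt m"
  unfolding M_iff wt_def by simp

lemma M_I:
  assumes "ht m = \<rho> * lk m L + int l * x"
  shows "m \<in> M" "wt m = x"
  unfolding M_iff wt_def using assms l_pos by auto

lemma ht_add: "ht (m + n) = ht m + ht n" and ht_diff: "ht (m - n) = ht m - ht n"
  by (simp_all add: ht_def lookup_add lookup_minus sum.distrib sum_subtractf)

lemma M_add: "m \<in> M \<Longrightarrow> n \<in> M \<Longrightarrow> m + n \<in> M" "m \<in> M \<Longrightarrow> n \<in> M \<Longrightarrow> wt (m + n) = wt m + wt n"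
  and M_diff: "m \<in> M \<Longrightarrow> n \<in> M \<Longrightarrow> m - n \<in> M" "m \<in> M \<Longrightarrow> n \<in> M \<Longrightarrow> wt (m - n) = wt m - wt n"
proof -
  assume mn: "m \<in> M" "n \<in> M"
  have "ht (m + n) = \<rho> * lk (m + n) L + int l * (wt m + wt n)"
    using mn by (simp add: ht_add ht_eq lookup_add algebra_simps)
  then show "m + n \<in> M" "wt (m + n) = wt m + wt n" by (rule M_I)+
  have "ht (m - n) = \<rho> * lk (m - n) L + int l * (wt m - wt n)"
    using mn by (simp add: ht_diff ht_eq lookup_minus algebra_simps)
  then show "m - n \<in> M" "wt (m - n) = wt m - wt n" by (rule M_I)+
qed

lemma pairing_npt:
  assumes "m \<in> M"
  shows "pairing m (npt l j) = of_int (int j * wt m + lk m L)"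
proof -
  have "int j * ht m + lk m L * (int l - int j * \<rho>) = int l * (int j * wt m + lk m L)"
    unfolding ht_eq[OF assms] by (simp add: algebra_simps)
  then have "real_of_int (int j * ht m + lk m L * (int l - int j * \<rho>)) = of_int (int l * (int j * wt m + lk m L))"
    by (simp only:)
  then show ?thesis unfolding pairing_npt_raw using l_pos by (simp add: field_simps)
qed

lemma lookup_pv:
  assumes "p \<noteq> L"
  shows "lk (pv p x y) L = y" "lk (pv p x y) p = \<rho> * y + int l * x"
    "i \<noteq> L \<Longrightarrow> i \<noteq> p \<Longrightarrow> lk (pv p x y) i = 0"
  using assms by (auto simp: pv_def lookup_add lookup_single when_def)

lemma ht_pv:
  assumes "p \<noteq> L"
  shows "ht (pv p x y) = \<rho> * y + int l * x"
  unfolding ht_def sum_not_last[OF assms] using assms by (simp add: lookup_pv)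

lemma pv_M: "p \<noteq> L \<Longrightarrow> pv p x y \<in> M" "p \<noteq> L \<Longrightarrow> wt (pv p x y) = x"
  using M_I[of "pv p x y" x] by (simp_all add: ht_pv lookup_pv)

lemma lookup_ev:
  assumes "p \<noteq> L" "q \<noteq> L" "q \<noteq> p"
  shows "lk (ev q p) L = 0" "lk (ev q p) p = - 1" "lk (ev q p) q = 1"
    "i \<noteq> p \<Longrightarrow> i \<noteq> q \<Longrightarrow> lk (ev q p) i = 0"
  using assms by (auto simp: ev_def lookup_minus lookup_single when_def)

lemma ev_M:
  assumes "p \<noteq> L" "q \<noteq> L" "q \<noteq> p"
  shows "ht (ev q p) = 0" "ev q p \<in> M" "wt (ev q p) = 0"
proof -
  have "ht (ev q p) = lk (ev q p) p + (lk (ev q p) q + (\<Sum>i\<in>- {L, p} - {q}. lk (ev q p) i))"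
    unfolding ht_def sum_not_last[OF assms(1)] using assms by (subst sum.remove[of _ q]) auto
  also have "(\<Sum>i\<in>- {L, p} - {q}. lk (ev q p) i) = 0"
    by (rule sum.neutral) (use assms in \<open>auto simp: lookup_ev\<close>)
  finally show 0: "ht (ev q p) = 0" using assms by (simp add: lookup_ev)
  then show "ev q p \<in> M" "wt (ev q p) = 0"
    using M_I[of "ev q p" 0] assms by (simp_all add: lookup_ev)
qed

lemma pv_add: "pv p x y + pv p x' y' = pv p (x + x') (y + y')"
  by (rule poly_mapping_eqI) (simp add: pv_def lookup_add lookup_single when_def algebra_simps)

lemma pv_diff: "pv p x y - pv p x' y' = pv p (x - x') (y - y')"
  by (rule poly_mapping_eqI) (simp add: pv_def lookup_add lookup_minus lookup_single when_def algebra_simps)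

lemma D_iff: "m \<in> D A \<longleftrightarrow> m \<in> M \<and> (\<forall>u\<in>A. 0 \<le> pairing m u)"
  by (simp add: dual_semigroup_def)

lemma D_npt_simplex:
  "m \<in> D (npt_simplex p a b) \<longleftrightarrow> m \<in> M \<and> 0 \<le> int a * wt m + lk m L \<and> 0 \<le> int b * wt m + lk m L
    \<and> (\<forall>q. q \<noteq> L \<longrightarrow> q \<noteq> p \<longrightarrow> 0 \<le> lk m q)"
proof (cases "m \<in> M")
  case True
  then show ?thesis by (auto simp: D_iff npt_simplex_def pairing_npt pairing_unit_vec simp del: of_int_add of_int_mult)
qed (simp add: D_iff)

lemma D_base:
  "m \<in> D (base_simplex l j) \<longleftrightarrow> m \<in> M \<and> 0 \<le> int j * wt m + lk m L \<and> (\<forall>q. q \<noteq> L \<longrightarrow> 0 \<le> lk m q)"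
proof (cases "m \<in> M")
  case True
  then show ?thesis by (auto simp: D_iff base_simplex_def pairing_npt pairing_unit_vec simp del: of_int_add of_int_mult)
qed (simp add: D_iff)

lemma D_units: "m \<in> D (range unit_vec) \<longleftrightarrow> m \<in> M \<and> (\<forall>q. 0 \<le> lk m q)"
  by (auto simp: D_iff pairing_unit_vec)

lemma pv_multiple:
  assumes "submonoid_exps \<Lambda>" "pv p x y \<in> \<Lambda>" "0 \<le> k"
  shows "pv p (k * x) (k * y) \<in> \<Lambda>"
proof -
  have "pv p (int n * x) (int n * y) \<in> \<Lambda>" for n
  proof (induction n)
    case 0
    then show ?case using assms(1) by (simp add: pv_def submonoid_exps_def)
  next
    case (Suc n)
    then have "pv p x y + pv p (int n * x) (int n * y) \<in> \<Lambda>"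
      using assms by (intro submonoid_add)
    then show ?case by (simp add: pv_add algebra_simps)
  qed
  from this[of "nat k"] show ?thesis using assms(3) by simp
qed

text \<open>Peels k copies of an exponent already in \<Lambda> off the one in question. The chart
  computations below consist in choosing that exponent and k.\<close>

lemma pv_split:
  assumes "submonoid_exps \<Lambda>" "pv p x' y' \<in> \<Lambda>" "0 \<le> k" "pv p (x - k * x') (y - k * y') \<in> \<Lambda>"
  shows "pv p x y \<in> \<Lambda>"
  using submonoid_add[OF assms(1) pv_multiple[OF assms(1-3)] assms(4)] by (simp add: pv_add)

text \<open>Moving the coordinates outside L and p onto p by \<open>ev q p\<close> leaves an
  exponent of the form \<open>pv\<close>; its p-coordinate is forced by the lattice condition. This
  reduces the semigroups to two dimensions.\<close>

lemma exps_in_submonoid: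
  assumes \<Lambda>: "submonoid_exps \<Lambda>" and m: "m \<in> M" and p: "p \<noteq> L"
    and q: "\<And>q. q \<noteq> L \<Longrightarrow> q \<noteq> p \<Longrightarrow> 0 \<le> lk m q" "\<And>q. q \<noteq> L \<Longrightarrow> q \<noteq> p \<Longrightarrow> ev q p \<in> \<Lambda>"
    and pv: "pv p (wt m) (lk m L) \<in> \<Lambda>"
  shows "m \<in> \<Lambda>"
proof -
  have "m = pv p (wt m) (lk m L) + (\<Sum>q\<in>-{L, p}. \<Sum>i<nat (lk m q). ev q p)" (is "m = ?n")
  proof (rule poly_mapping_eqI)
    fix i
    have sum: "lk ?n i = lk (pv p (wt m) (lk m L)) i + (\<Sum>q\<in>-{L, p}. lk m q * lk (ev q p) i)"
      using q(1) by (simp add: lookup_add lookup_sum)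
    consider "i = L" | "i = p" | "i \<noteq> L" "i \<noteq> p" by blast
    then show "lk m i = lk ?n i"
    proof cases
      case 1
      have "(\<Sum>q\<in>-{L, p}. lk m q * lk (ev q p) i) = 0"
        by (rule sum.neutral) (use 1 p in \<open>auto simp: lookup_ev\<close>)
      then show ?thesis using sum 1 p by (simp add: lookup_pv)
    next
      case 2
      have "(\<Sum>q\<in>-{L, p}. lk m q * lk (ev q p) i) = (\<Sum>q\<in>-{L, p}. - lk m q)"
        by (rule sum.cong) (use 2 p in \<open>auto simp: lookup_ev\<close>)
      then show ?thesis
        using sum 2 p ht_eq[OF m] sum_not_last[OF p, of "lk m"] by (simp add: lookup_pv sum_negf ht_def)
    next
      case 3
      have "(\<Sum>q\<in>-{L, p}. lk m q * lk (ev q p) i) = (\<Sum>q\<in>-{L, p}. if q = i then lk m q else 0)"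
        by (rule sum.cong) (use 3 p in \<open>auto simp: lookup_ev\<close>)
      then show ?thesis using sum 3 p by (simp add: lookup_pv)
    qed
  qed
  also have "\<dots> \<in> \<Lambda>"
    by (intro submonoid_add[OF \<Lambda>] pv submonoid_sum[OF \<Lambda>] q(2)) auto
  finally show ?thesis .
qed

lemma npt_eq_iff: "npt l a = (npt l b :: (real, 'n) vec) \<longleftrightarrow> a = b"
proof
  obtain p :: 'n where p: "p \<noteq> L" using other_index by blast
  assume "npt l a = (npt l b :: (real, 'n) vec)"
  then have "npt l a $ p = (npt l b :: (real, 'n) vec) $ p" by simp
  then show "a = b" using p l_pos by (simp add: npt_def)
qed simp

section \<open>Blowing up a center spanned by two points \<open>npt l a\<close>,
  \<open>npt l b\<close>\<close>

lemma conormal_segment: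
  assumes "a \<noteq> b"
  shows "m \<in> conormal {npt l a, npt l b} (npt_simplex p a b) \<longleftrightarrow>
    m \<in> D (npt_simplex p a b) \<and> 0 < (int a * wt m + lk m L) + (int b * wt m + lk m L)"
proof (cases "m \<in> M")
  case True
  have "(\<Sum>t\<in>{npt l a, npt l b}. pairing m t) = of_int ((int a * wt m + lk m L) + (int b * wt m + lk m L))"
    using assms True by (simp add: npt_eq_iff pairing_npt)
  then show ?thesis unfolding conormal_exps_def by (simp del: of_int_add of_int_mult)
qed (simp add: conormal_exps_def D_iff)

text \<open>The three exponents take the values (0,b-a), (1,1), (b-a,0) at a and b. Each is the
  linear piece, on its subinterval, of the support function of the ideal: 0 at both ends and 1 at
  all integers strictly between, with kinks at a + 1 and b - 1.\<close>

lemma star_chart_segment: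
  assumes p: "p \<noteq> L" and ab: "a + 2 \<le> b"
    and vB: "(v, c, d) \<in> {(pv p 1 (- int a), a, a + 1), (pv p 0 1, a + 1, b - 1), (pv p (- 1) (int b), b - 1, b)}"
  shows "star_chart (N_G l) {npt l a, npt l b} (npt_simplex p a b) v (npt_simplex p c d)"
proof -
  let ?I = "conormal {npt l a, npt l b} (npt_simplex p a b)"
  have I: "m \<in> ?I \<longleftrightarrow> m \<in> D (npt_simplex p a b) \<and> 0 < (int a * wt m + lk m L) + (int b * wt m + lk m L)" for m
    using ab by (intro conormal_segment) simp
  have cd: "a \<le> c" "c \<le> d" "d \<le> b" using vB ab by auto
  have vI: "pv p 1 (- int a) \<in> ?I" "pv p 0 1 \<in> ?I" "pv p (- 1) (int b) \<in> ?I"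
    using p ab by (auto simp: I D_npt_simplex pv_M lookup_pv)
  have 1: "v \<in> ?I" using vI vB by auto
  have 2: "D (npt_simplex p a b) \<subseteq> D (npt_simplex p c d)"
    using cd slope_between[of "int a" _ "int b"] by (auto simp: D_npt_simplex)
  have v_cd: "int c * wt v + lk v L = (if c = a then 0 else 1)" "int d * wt v + lk v L = (if d = b then 0 else 1)"
    "v \<in> M" "\<And>q. q \<noteq> L \<Longrightarrow> q \<noteq> p \<Longrightarrow> lk v q = 0"
    using vB p ab by (auto simp: pv_M lookup_pv)
  have 3: "m - v \<in> D (npt_simplex p c d)" if "m \<in> ?I" for m
  proof -
    have m: "m \<in> D (npt_simplex p a b)" "0 < (int a * wt m + lk m L) + (int b * wt m + lk m L)"
      using that I by auto
    have "(if c = a then 0 else 1) \<le> int c * wt m + lk m L" "(if d = b then 0 else 1) \<le> int d * wt m + lk m L"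
      using m cd vB ab slope_interior[of "int a" "int c" "int b" "wt m" "lk m L"]
        slope_interior[of "int a" "int d" "int b" "wt m" "lk m L"] by (auto simp: D_npt_simplex)
    then show ?thesis
      using m v_cd by (simp add: D_npt_simplex M_diff lookup_minus algebra_simps)
  qed
  have 4: "m \<in> \<Lambda>"
    if \<Lambda>: "submonoid_exps \<Lambda>" "D (npt_simplex p a b) \<subseteq> \<Lambda>" "\<forall>m\<in>?I. m - v \<in> \<Lambda>" and m: "m \<in> D (npt_simplex p c d)" for \<Lambda> m
  proof (rule exps_in_submonoid[OF \<Lambda>(1) _ p])
    show "m \<in> M" and "\<And>q. q \<noteq> L \<Longrightarrow> q \<noteq> p \<Longrightarrow> 0 \<le> lk m q" using m by (auto simp: D_npt_simplex)
    show "ev q p \<in> \<Lambda>" if "q \<noteq> L" "q \<noteq> p" for q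
    proof -
      have "0 \<le> lk (ev q p) i" if "i \<noteq> p" for i
        using that p \<open>q \<noteq> L\<close> \<open>q \<noteq> p\<close> lookup_ev[of p q] by (cases "i = q") auto
      then have "ev q p \<in> D (npt_simplex p a b)" using p that by (simp add: D_npt_simplex ev_M lookup_ev)
      then show ?thesis using \<Lambda>(2) by blast
    qed
    define x y where "x = wt m" and "y = lk m L"
    have xy: "0 \<le> int c * x + y" "0 \<le> int d * x + y" using m by (auto simp: D_npt_simplex x_def y_def)
    have in_D: "pv p x y \<in> \<Lambda>" if "0 \<le> int a * x + y" "0 \<le> int b * x + y" for x y
      using \<Lambda>(2) p that by (auto simp: D_npt_simplex pv_M lookup_pv)
    have "pv p x y \<in> \<Lambda>"
      using vB
    proof (elim insertE emptyE)
      assume v: "(v, c, d) = (pv p 1 (- int a), a, a + 1)"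
      \<comment> \<open>The difference of the exponents (1,1) and (0,b-a) has value 1 at a and 0 at
        a + 1. Removing as many copies as the value at a makes that value 0 and keeps the value at a
        + 1, so the value at b becomes b - a times the latter.\<close>
      have g: "pv p (- 1) (1 + int a) \<in> \<Lambda>" using \<Lambda>(3) vI(2) v by (auto simp: pv_diff)
      have "0 \<le> (int b - int a) * ((int a + 1) * x + y)"
        using xy v ab by (intro mult_nonneg_nonneg) (auto simp: algebra_simps)
      then have c: "pv p (x - (int a * x + y) * (- 1)) (y - (int a * x + y) * (1 + int a)) \<in> \<Lambda>"
        by (intro in_D) (simp_all add: algebra_simps)
      have "0 \<le> int a * x + y" using xy v by simp
      then show ?thesis by (rule pv_split[OF \<Lambda>(1) g _ c])
    next
      assume v: "(v, c, d) = (pv p (- 1) (int b), b - 1, b)"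
      have g: "pv p 1 (1 - int b) \<in> \<Lambda>" using \<Lambda>(3) vI(2) v by (auto simp: pv_diff)
      have "0 \<le> (int b - int a) * ((int b - 1) * x + y)"
        using xy v ab by (intro mult_nonneg_nonneg) (auto simp: of_nat_diff algebra_simps)
      then have c: "pv p (x - (int b * x + y) * 1) (y - (int b * x + y) * (1 - int b)) \<in> \<Lambda>"
        by (intro in_D) (simp_all add: algebra_simps)
      have "0 \<le> int b * x + y" using xy v by simp
      then show ?thesis by (rule pv_split[OF \<Lambda>(1) g _ c])
    next
      assume v: "(v, c, d) = (pv p 0 1, a + 1, b - 1)"
      have xy': "0 \<le> (int a + 1) * x + y" "0 \<le> (int b - 1) * x + y"
        using xy v ab by (auto simp: of_nat_diff algebra_simps)
      \<comment> \<open>In the middle chart the slope is removed: for x \<ge> 0 with an exponent of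
        slope 1 vanishing at a + 1, otherwise with one of slope -1 vanishing at b - 1. A nonnegative
        constant remains.\<close>
      show ?thesis
      proof (cases "0 \<le> x")
        case True
        have g: "pv p 1 (- int a - 1) \<in> \<Lambda>" using \<Lambda>(3) vI(1) v by (auto simp: pv_diff)
        have c: "pv p (x - x * 1) (y - x * (- int a - 1)) \<in> \<Lambda>"
          using xy' by (intro in_D) (simp_all add: algebra_simps)
        show ?thesis by (rule pv_split[OF \<Lambda>(1) g True c])
      next
        case False
        have g: "pv p (- 1) (int b - 1) \<in> \<Lambda>" using \<Lambda>(3) vI(3) v by (auto simp: pv_diff)
        have c: "pv p (x - (- x) * (- 1)) (y - (- x) * (int b - 1)) \<in> \<Lambda>"
          using xy' by (intro in_D) (simp_all add: algebra_simps)
        have "0 \<le> - x" using False by simp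
        then show ?thesis by (rule pv_split[OF \<Lambda>(1) g _ c])
      qed
    qed
    then show "pv p (wt m) (lk m L) \<in> \<Lambda>" by (simp add: x_def y_def)
  qed
  show ?thesis unfolding star_chart_def using 1 2 3 4 by blast
qed

text \<open>The sign of the slope \<open>wt m\<close> decides which of the three exponents can be
  subtracted from m inside the semigroup of the chart itself; here they generate the ideal.\<close>

lemma star_subdivision_segment:
  assumes p: "p \<noteq> L" and ab: "a + 2 \<le> b"
  shows "star_subdivision (N_G l) {npt l a, npt l b} (npt_simplex p a b)
    {(pv p 1 (- int a), npt_simplex p a (a + 1)), (pv p 0 1, npt_simplex p (a + 1) (b - 1)),
     (pv p (- 1) (int b), npt_simplex p (b - 1) b)}"
  unfolding star_subdivision_def
proof (intro conjI ballI allI impI)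
  fix m \<Lambda>
  assume m: "m \<in> conormal {npt l a, npt l b} (npt_simplex p a b)" and \<Lambda>: "D (npt_simplex p a b) \<subseteq> \<Lambda>"
  then have m: "m \<in> D (npt_simplex p a b)" "0 < (int a * wt m + lk m L) + (int b * wt m + lk m L)"
    using conormal_segment[of a b m p] ab by auto
  have D: "m - pv p x y \<in> D (npt_simplex p a b)"
    if "0 \<le> int a * (wt m - x) + (lk m L - y)" "0 \<le> int b * (wt m - x) + (lk m L - y)" for x y
    using m(1) p that by (simp add: D_npt_simplex M_diff pv_M lookup_pv lookup_minus)
  consider "wt m \<ge> 1" | "wt m = 0" | "- wt m \<ge> 1" by linarith
  then have "m - pv p 1 (- int a) \<in> D (npt_simplex p a b) \<or> m - pv p 0 1 \<in> D (npt_simplex p a b)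
    \<or> m - pv p (- 1) (int b) \<in> D (npt_simplex p a b)"
  proof cases
    case 1
    then have "0 \<le> (int b - int a) * (wt m - 1)" using ab by (intro mult_nonneg_nonneg) auto
    then have "m - pv p 1 (- int a) \<in> D (npt_simplex p a b)"
      using m by (intro D) (simp_all add: D_npt_simplex algebra_simps)
    then show ?thesis by simp
  next
    case 2
    then have "m - pv p 0 1 \<in> D (npt_simplex p a b)" using m by (intro D) auto
    then show ?thesis by simp
  next
    case 3
    then have "0 \<le> (int b - int a) * (- wt m - 1)" using ab by (intro mult_nonneg_nonneg) auto
    then have "m - pv p (- 1) (int b) \<in> D (npt_simplex p a b)"
      using m by (intro D) (simp_all add: D_npt_simplex algebra_simps)
    then show ?thesis by simp
  qed
  then show "\<exists>(v, B)\<in>{(pv p 1 (- int a), npt_simplex p a (a + 1)), (pv p 0 1, npt_simplex p (a + 1) (b - 1)),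
     (pv p (- 1) (int b), npt_simplex p (b - 1) b)}. m - v \<in> \<Lambda>"
    using \<Lambda> by auto
qed (use star_chart_segment[OF p ab] in auto)


section \<open>The blow-up of the image of the origin\<close>

abbreviation units :: "(real, 'n) vec set" where "units \<equiv> range unit_vec"

lemma nonzero_lookup: "lk m i \<noteq> 0 \<Longrightarrow> m \<noteq> 0"
  by (metis lookup_zero)

lemma ht_nonneg: "(\<And>q. q \<noteq> L \<Longrightarrow> 0 \<le> lk m q) \<Longrightarrow> 0 \<le> ht m"
  unfolding ht_def by (rule sum_nonneg) auto

lemma ht_zero_iff:
  assumes "\<And>q. q \<noteq> L \<Longrightarrow> 0 \<le> lk m q"
  shows "ht m = 0 \<longleftrightarrow> (\<forall>q. q \<noteq> L \<longrightarrow> lk m q = 0)"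
  unfolding ht_def by (subst sum_nonneg_eq_0_iff) (use assms in auto)

lemma ht_single_last: "ht (Poly_Mapping.single L y) = 0"
  by (simp add: ht_def lookup_single when_def)

lemma conormal_units:
  "m \<in> conormal units units \<longleftrightarrow> m \<in> M \<and> (\<forall>q. 0 \<le> lk m q) \<and> m \<noteq> 0"
proof -
  have "(\<Sum>t\<in>units. pairing m t) = of_int (\<Sum>i\<in>UNIV. lk m i)"
    by (simp add: sum.reindex[OF inj_unit_vec] pairing_unit_vec)
  then have "0 < (\<Sum>t\<in>units. pairing m t) \<longleftrightarrow> 0 < (\<Sum>i\<in>UNIV. lk m i)"
    by (simp only: of_int_0_less_iff)
  moreover have "0 < (\<Sum>i\<in>UNIV. lk m i) \<longleftrightarrow> m \<noteq> 0" if "\<forall>q. 0 \<le> lk m q"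
  proof -
    have "(\<Sum>i\<in>UNIV. lk m i) = 0 \<longleftrightarrow> (\<forall>i. lk m i = 0)"
      using that by (simp add: sum_nonneg_eq_0_iff)
    moreover have "(\<forall>i. lk m i = 0) \<longleftrightarrow> m = 0" by (metis lookup_zero poly_mapping_eqI)
    moreover have "0 \<le> (\<Sum>i\<in>UNIV. lk m i)" using that by (simp add: sum_nonneg)
    ultimately show ?thesis by (auto simp: le_less)
  qed
  ultimately show ?thesis by (auto simp: conormal_exps_def D_units)
qed

text \<open>l times the value at \<open>npt l c\<close> is c * ht m plus (l - c * \<rho>) times the
  last coordinate, a nonnegative combination. If both weights are positive and m is nonzero, the
  value is a positive integer.\<close>

lemma unit_slope:
  assumes m: "m \<in> M" "\<forall>q. 0 \<le> lk m q" and c: "int c * \<rho> \<le> int l"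
  shows "0 \<le> int c * wt m + lk m L"
    "m \<noteq> 0 \<Longrightarrow> 1 \<le> c \<Longrightarrow> int c * \<rho> < int l \<Longrightarrow> 1 \<le> int c * wt m + lk m L"
proof -
  have eq: "int l * (int c * wt m + lk m L) = int c * ht m + (int l - int c * \<rho>) * lk m L"
    unfolding ht_eq[OF m(1)] by (simp add: algebra_simps)
  have h: "0 \<le> ht m" using m(2) by (intro ht_nonneg) auto
  have "0 \<le> int c * ht m + (int l - int c * \<rho>) * lk m L" using h m(2) c by simp
  then show "0 \<le> int c * wt m + lk m L" using eq l_pos by (metis zero_le_mult_iff not_less)
  assume *: "m \<noteq> 0" "1 \<le> c" "int c * \<rho> < int l"
  have "0 < ht m \<or> 0 < lk m L"
  proof (rule ccontr)
    assume "\<not> ?thesis"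
    then have "ht m = 0" "lk m L = 0" using h m(2) by (auto simp: le_less)
    then have "lk m q = 0" for q using ht_zero_iff[of m] m(2) by (cases "q = L") auto
    then show False using *(1) by (metis lookup_zero poly_mapping_eqI)
  qed
  then have "0 < int c * ht m + (int l - int c * \<rho>) * lk m L"
    using h m(2) * by (auto intro: add_pos_nonneg add_nonneg_pos)
  then have "0 < int c * wt m + lk m L" using eq l_pos by (metis zero_less_mult_iff not_less_iff_gr_or_eq)
  then show "1 \<le> int c * wt m + lk m L" by simp
qed

text \<open>If the p-coordinate of a \<open>pv\<close> is positive, one unit of it can be moved to q
  without leaving the ideal. The difference of the two exponents then puts \<open>ev q p\<close>
  into the semigroup of the chart.\<close>

lemma pv_ev:
  assumes "p \<noteq> L" "q \<noteq> L" "q \<noteq> p"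
  shows "pv p x y + ev q p \<in> M" "wt (pv p x y + ev q p) = x" "lk (pv p x y + ev q p) L = y"
    "ht (pv p x y + ev q p) = \<rho> * y + int l * x"
    "1 \<le> \<rho> * y + int l * x \<Longrightarrow> i \<noteq> L \<Longrightarrow> 0 \<le> lk (pv p x y + ev q p) i"
    "pv p x y + ev q p \<noteq> 0"
proof -
  show "pv p x y + ev q p \<in> M" "wt (pv p x y + ev q p) = x" "lk (pv p x y + ev q p) L = y"
    "ht (pv p x y + ev q p) = \<rho> * y + int l * x"
    using assms by (simp_all add: M_add pv_M ev_M lookup_add lookup_pv lookup_ev ht_add ht_pv)
  show "pv p x y + ev q p \<noteq> 0"
    using assms by (intro nonzero_lookup[of _ q]) (simp add: lookup_add lookup_pv lookup_ev)
  assume "1 \<le> \<rho> * y + int l * x" "i \<noteq> L"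
  then show "0 \<le> lk (pv p x y + ev q p) i"
    using assms lookup_pv[OF assms(1)] lookup_ev[OF assms]
    by (cases "i = p"; cases "i = q") (auto simp: lookup_add)
qed

lemma exps_in_submonoid':
  assumes \<Lambda>: "submonoid_exps \<Lambda>" and m: "m \<in> M" and p: "p \<noteq> L"
    and q: "\<And>q. q \<noteq> L \<Longrightarrow> q \<noteq> p \<Longrightarrow> 0 \<le> lk m q"
    and v: "1 \<le> \<rho> * y + int l * x" "\<And>q. q \<noteq> L \<Longrightarrow> q \<noteq> p \<Longrightarrow> pv p x y + ev q p - pv p x y \<in> \<Lambda>"
    and pv: "pv p (wt m) (lk m L) \<in> \<Lambda>"
  shows "m \<in> \<Lambda>"
  by (rule exps_in_submonoid[OF \<Lambda> m p q _ pv]) (use v(2) in auto)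

text \<open>The chart of the l-th power of x_p.\<close>

lemma star_chart_origin_low:
  assumes p: "p \<noteq> L"
  shows "star_chart (N_G l) units units (pv p 1 0) (npt_simplex p 0 1)"
  unfolding star_chart_def
proof (intro conjI ballI allI impI subsetI)
  have lk_pv: "lk (pv p 1 0) i = (if i = p then int l else 0)" for i
    using lookup_pv[OF p] p by (cases "i = L"; cases "i = p") auto
  then show v: "pv p 1 0 \<in> conormal units units"
    using p l_pos nonzero_lookup[of "pv p 1 0" p] by (simp add: conormal_units pv_M)
  show "m \<in> D (npt_simplex p 0 1)" if "m \<in> D units" for m
    using that unit_slope(1)[of m 1] l_gt by (auto simp: D_units D_npt_simplex)
  show "m - pv p 1 0 \<in> D (npt_simplex p 0 1)" if "m \<in> conormal units units" for m
    using that unit_slope(2)[of m 1] l_gt p lk_pv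
    by (auto simp: conormal_units D_npt_simplex M_diff pv_M lookup_minus)
  fix \<Lambda> m
  assume \<Lambda>: "submonoid_exps \<Lambda>" "D units \<subseteq> \<Lambda>" "\<forall>m\<in>conormal units units. m - pv p 1 0 \<in> \<Lambda>"
    and m: "m \<in> D (npt_simplex p 0 1)"
  show "m \<in> \<Lambda>"
  proof (rule exps_in_submonoid'[OF \<Lambda>(1) _ p, where x = 1 and y = 0])
    show "m \<in> M" "\<And>q. q \<noteq> L \<Longrightarrow> q \<noteq> p \<Longrightarrow> 0 \<le> lk m q" using m by (auto simp: D_npt_simplex)
    show 1: "1 \<le> \<rho> * 0 + int l * 1" using l_pos by simp
    show "pv p 1 0 + ev q p - pv p 1 0 \<in> \<Lambda>" if "q \<noteq> L" "q \<noteq> p" for q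
    proof -
      have "0 \<le> lk (pv p 1 0 + ev q p) i" for i using pv_ev[OF p that, where x = 1 and y = 0] 1 by (cases "i = L") auto
      then show ?thesis using \<Lambda>(3) pv_ev[OF p that, where x = 1 and y = 0] conormal_units by blast
    qed
    have x: "0 \<le> wt m + lk m L" "0 \<le> lk m L" using m by (auto simp: D_npt_simplex)
    have t: "pv p 0 1 \<in> conormal units units"
    proof -
      have "0 \<le> lk (pv p 0 1) i" for i
        using lookup_pv[OF p, where x = 0 and y = 1] \<rho>_pos by (cases "i = L"; cases "i = p") auto
      moreover have "pv p 0 1 \<noteq> 0" using p by (intro nonzero_lookup[of _ L]) (simp add: lookup_pv)
      ultimately show ?thesis using p by (auto simp: conormal_units pv_M)
    qed
    \<comment> \<open>This exponent has value 1 at \<open>npt l 0\<close> and 0 at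
      \<open>npt l 1\<close>. Removing \<open>lk m L\<close> copies leaves the power of x_p with
      slope equal to the value at \<open>npt l 1\<close>.\<close>
    have g: "pv p (- 1) 1 \<in> \<Lambda>" using \<Lambda>(3) t by (auto simp: pv_diff)
    have "0 \<le> lk (pv p (wt m + lk m L) 0) i" for i
      using lookup_pv[OF p, where x = "wt m + lk m L" and y = 0] x by (cases "i = L"; cases "i = p") auto
    then have "pv p (wt m - lk m L * (- 1)) (lk m L - lk m L * 1) \<in> \<Lambda>"
      using \<Lambda>(2) p by (auto simp: D_units pv_M)
    then show "pv p (wt m) (lk m L) \<in> \<Lambda>" by (rule pv_split[OF \<Lambda>(1) g x(2)])
  qed
qed

lemma lk_pv_nonneg:
  assumes "p \<noteq> L" "0 \<le> y" "0 \<le> \<rho> * y + int l * x"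
  shows "0 \<le> lk (pv p x y) i"
  using assms lookup_pv[OF assms(1), where x = x and y = y] by (cases "i = L"; cases "i = p") auto

lemma pv_in_units:
  "p \<noteq> L \<Longrightarrow> 0 \<le> y \<Longrightarrow> 0 \<le> \<rho> * y + int l * x \<Longrightarrow> pv p x y \<in> D units"
  by (simp add: D_units pv_M lk_pv_nonneg)

lemma pv_in_conormal_units:
  assumes "p \<noteq> L" "0 < y" "0 \<le> \<rho> * y + int l * x"
  shows "pv p x y \<in> conormal units units"
proof -
  have "pv p x y \<noteq> 0" using assms by (intro nonzero_lookup[of _ L]) (simp add: lookup_pv)
  then show ?thesis using assms by (simp add: conormal_units pv_M lk_pv_nonneg)
qed

text \<open>The chart of x_L times the \<rho>-th power of x_p. J is the last index for which
  \<open>npt l J\<close> is interior to the positive cone, that is \<open>nu\<close> or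
  \<open>nu - 1\<close>.\<close>

lemma star_chart_origin_mid:
  assumes p: "p \<noteq> L" and J: "1 \<le> J" "int J * \<rho> < int l" "int l \<le> (int J + 1) * \<rho>"
  shows "star_chart (N_G l) units units (pv p 0 1) (npt_simplex p 1 J)"
  unfolding star_chart_def
proof (intro conjI ballI allI impI subsetI)
  show t: "pv p 0 1 \<in> conormal units units"
    using p \<rho>_pos by (intro pv_in_conormal_units) auto
  show "m \<in> D (npt_simplex p 1 J)" if "m \<in> D units" for m
    using that unit_slope(1)[of m 1] unit_slope(1)[of m J] l_gt J by (auto simp: D_units D_npt_simplex)
  show "m - pv p 0 1 \<in> D (npt_simplex p 1 J)" if "m \<in> conormal units units" for m
    using that unit_slope(2)[of m 1] unit_slope(2)[of m J] l_gt p J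
    by (auto simp: conormal_units D_npt_simplex M_diff pv_M lookup_minus lookup_pv)
  fix \<Lambda> m
  assume \<Lambda>: "submonoid_exps \<Lambda>" "D units \<subseteq> \<Lambda>" "\<forall>m\<in>conormal units units. m - pv p 0 1 \<in> \<Lambda>"
    and m: "m \<in> D (npt_simplex p 1 J)"
  show "m \<in> \<Lambda>"
  proof (rule exps_in_submonoid'[OF \<Lambda>(1) _ p, where x = 0 and y = 1])
    show "m \<in> M" "\<And>q. q \<noteq> L \<Longrightarrow> q \<noteq> p \<Longrightarrow> 0 \<le> lk m q" using m by (auto simp: D_npt_simplex)
    show 1: "1 \<le> \<rho> * 1 + int l * 0" using \<rho>_pos by simp
    show "pv p 0 1 + ev q p - pv p 0 1 \<in> \<Lambda>" if "q \<noteq> L" "q \<noteq> p" for q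
    proof -
      have "0 \<le> lk (pv p 0 1 + ev q p) i" for i using pv_ev[OF p that, where x = 0 and y = 1] 1 by (cases "i = L") auto
      then show ?thesis using \<Lambda>(3) pv_ev[OF p that, where x = 0 and y = 1] conormal_units by blast
    qed
    define x y where "x = wt m" and "y = lk m L"
    have xy: "0 \<le> x + y" "0 \<le> int J * x + y" using m by (auto simp: D_npt_simplex x_def y_def)
    have "pv p x y \<in> \<Lambda>"
    proof (cases "0 \<le> x")
      case True
      have "pv p 1 0 \<in> conormal units units"
        using star_chart_origin_low[OF p] by (simp add: star_chart_def)
      then have g: "pv p 1 (- 1) \<in> \<Lambda>" using \<Lambda>(3) by (auto simp: pv_diff)
      have "pv p (x - x * 1) (y - x * (- 1)) \<in> D units"
      proof (rule pv_in_units[OF p])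
        show "0 \<le> y - x * (- 1)" using xy by simp
        then have "0 \<le> \<rho> * (y - x * (- 1))" using \<rho>_pos by (intro mult_nonneg_nonneg) auto
        then show "0 \<le> \<rho> * (y - x * (- 1)) + int l * (x - x * 1)" by simp
      qed
      from pv_split[OF \<Lambda>(1) g True subsetD[OF \<Lambda>(2) this]] show ?thesis .
    next
      case False
      then have k: "0 \<le> - x" by simp
      \<comment> \<open>Its p-coordinate \<rho> * (J + 1) - l is nonnegative by the choice of J.
        Subtracting the chart exponent gives slope -1 and value 0 at \<open>npt l J\<close>.\<close>
      have "pv p (- 1) (int J + 1) \<in> conormal units units"
        using J by (intro pv_in_conormal_units[OF p]) (auto simp: mult.commute)
      then have g: "pv p (- 1) (int J) \<in> \<Lambda>" using \<Lambda>(3) by (force simp: pv_diff)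
      have "pv p (x - (- x) * (- 1)) (y - (- x) * int J) \<in> D units"
      proof (rule pv_in_units[OF p])
        show "0 \<le> y - (- x) * int J" using xy by (simp add: algebra_simps)
        then have "0 \<le> \<rho> * (y - (- x) * int J)" using \<rho>_pos by (intro mult_nonneg_nonneg) auto
        then show "0 \<le> \<rho> * (y - (- x) * int J) + int l * (x - (- x) * (- 1))" by simp
      qed
      from pv_split[OF \<Lambda>(1) g k subsetD[OF \<Lambda>(2) this]] show ?thesis .
    qed
    then show "pv p (wt m) (lk m L) \<in> \<Lambda>" by (simp add: x_def y_def)
  qed
qed

lemma single_last_M:
  assumes "\<rho> * y + int l * x = 0"
  shows "Poly_Mapping.single L y \<in> M" "wt (Poly_Mapping.single L y) = x"
  using M_I[of "Poly_Mapping.single L y" x] assms by (auto simp: ht_single_last)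

lemma single_last_conormal:
  assumes "\<rho> * y + int l * x = 0" "0 < y"
  shows "Poly_Mapping.single L y \<in> conormal units units"
proof -
  have "Poly_Mapping.single L y \<noteq> 0" using assms(2) by (intro nonzero_lookup[of _ L]) simp
  then show ?thesis using assms by (simp add: conormal_units single_last_M lookup_single when_def)
qed

text \<open>Chart of a power of the last coordinate, normalized to have value 1 at
  \<open>npt l J\<close>. That the chart is generated is left as the hypothesis \<open>gen\<close>,
  because the cone over the base simplex is unimodular for l congruent to 1 but has index \<rho> for
  l = \<rho> * (J + 1).\<close>

lemma star_chart_origin_base:
  assumes J: "1 \<le> J" "int J * \<rho> < int l" and y: "0 < yD" "\<rho> * yD + int l * xD = 0" "int J * xD + yD = 1"
    and gen: "\<And>\<Lambda> m. submonoid_exps \<Lambda> \<Longrightarrow> D units \<subseteq> \<Lambda> \<Longrightarrow>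
      (\<And>m. m \<in> conormal units units \<Longrightarrow> m - Poly_Mapping.single L yD \<in> \<Lambda>) \<Longrightarrow>
      m \<in> D (base_simplex l J) \<Longrightarrow> m \<in> \<Lambda>"
  shows "star_chart (N_G l) units units (Poly_Mapping.single L yD) (base_simplex l J)"
  unfolding star_chart_def
proof (intro conjI ballI allI impI subsetI)
  show "Poly_Mapping.single L yD \<in> conormal units units"
    by (rule single_last_conormal[OF y(2,1)])
  show "m \<in> D (base_simplex l J)" if "m \<in> D units" for m
    using that unit_slope(1)[of m J] J by (auto simp: D_units D_base)
  show "m - Poly_Mapping.single L yD \<in> D (base_simplex l J)" if "m \<in> conormal units units" for m
    using that unit_slope(2)[of m J] J y single_last_M[OF y(2)]
    by (auto simp: conormal_units D_base M_diff lookup_minus lookup_single when_def algebra_simps)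
qed (use gen in auto)

text \<open>The cone is unimodular: the \<open>g q\<close> and the l-th power of the last coordinate
  form the basis dual to its generators. The remainder \<open>e\<close> is a nonnegative multiple of
  the latter.\<close>

lemma base_generated_one:
  assumes J: "int J * \<rho> = int l - 1"
    and \<Lambda>: "submonoid_exps \<Lambda>" "D units \<subseteq> \<Lambda>"
      "\<And>m. m \<in> conormal units units \<Longrightarrow> m - Poly_Mapping.single L (int l) \<in> \<Lambda>"
    and m: "m \<in> D (base_simplex l J)"
  shows "m \<in> \<Lambda>"
proof -
  have m': "m \<in> M" "0 \<le> int J * wt m + lk m L" "\<And>q. q \<noteq> L \<Longrightarrow> 0 \<le> lk m q" using m by (auto simp: D_base)
  define g where "g q = Poly_Mapping.single q 1 - Poly_Mapping.single L (int J)" for q :: 'n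
  define e where "e = Poly_Mapping.single L (lk m L + int J * ht m)"
  have "lk m L + int J * ht m = int l * (int J * wt m + lk m L)"
  proof -
    have "lk m L + int J * ht m = lk m L + (int J * \<rho>) * lk m L + int l * (int J * wt m)"
      unfolding ht_eq[OF m'(1)] by (simp add: algebra_simps)
    then show ?thesis unfolding J by (simp add: algebra_simps)
  qed
  moreover have "Poly_Mapping.single L (int l * (int J * wt m + lk m L)) \<in> M"
    by (rule single_last_M(1)[of _ "- \<rho> * (int J * wt m + lk m L)"]) (simp add: algebra_simps)
  ultimately have e: "e \<in> D units"
    using m'(2) by (simp add: D_units e_def lookup_single when_def)
  have gl: "g q \<in> \<Lambda>" if q: "q \<noteq> L" for q
  proof -
    let ?h = "Poly_Mapping.single q 1 + Poly_Mapping.single L (int l - int J)"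
    have ht: "ht ?h = 1" using q by (simp add: ht_add ht_single_last) (simp add: ht_def lookup_single when_def)
    have "ht ?h = \<rho> * lk ?h L + int l * (1 - \<rho>)"
      unfolding ht using q J by (simp add: lookup_add lookup_single when_def algebra_simps)
    then have "?h \<in> M" by (rule M_I)
    moreover have "int J \<le> int l"
      using J \<rho>_pos mult_left_mono[of 1 \<rho> "int J"] by simp
    moreover have "?h \<noteq> 0" using ht by (auto simp: ht_def)
    ultimately have "?h \<in> conormal units units"
      by (auto simp: conormal_units lookup_add lookup_single when_def)
    then have "?h - Poly_Mapping.single L (int l) \<in> \<Lambda>" by (rule \<Lambda>(3))
    then show ?thesis by (simp add: g_def single_diff)
  qed
  have "m = e + (\<Sum>q\<in>-{L}. \<Sum>i<nat (lk m q). g q)"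
  proof (rule poly_mapping_eqI)
    fix i
    have *: "lk (\<Sum>q\<in>-{L}. \<Sum>i<nat (lk m q). g q) i = (\<Sum>q\<in>-{L}. lk m q * lk (g q) i)"
      using m'(3) by (simp add: lookup_sum)
    show "lk m i = lk (e + (\<Sum>q\<in>-{L}. \<Sum>i<nat (lk m q). g q)) i"
    proof (cases "i = L")
      case True
      have "(\<Sum>q\<in>-{L}. lk m q * lk (g q) i) = (\<Sum>q\<in>-{L}. - int J * lk m q)"
        by (rule sum.cong) (use True in \<open>auto simp: g_def lookup_minus lookup_single when_def\<close>)
      also have "\<dots> = - int J * ht m" by (simp add: ht_def sum_distrib_left)
      finally show ?thesis unfolding lookup_add * using True by (simp add: e_def)
    next
      case False
      have "(\<Sum>q\<in>-{L}. lk m q * lk (g q) i) = (\<Sum>q\<in>-{L}. if q = i then lk m q else 0)"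
        by (rule sum.cong) (use False in \<open>auto simp: g_def lookup_minus lookup_single when_def\<close>)
      then show ?thesis unfolding lookup_add * using False by (simp add: e_def lookup_single when_def)
    qed
  qed
  also have "\<dots> \<in> \<Lambda>"
    using \<Lambda>(2) e by (intro submonoid_add[OF \<Lambda>(1)] submonoid_sum[OF \<Lambda>(1)] gl) auto
  finally show ?thesis .
qed

text \<open>An exponent \<open>m\<close> is generated by splitting off, from its first coordinates, parts of degree \<open>\<rho>\<close>.\<close>

lemma base_generated_zero:
  assumes J: "int l = \<rho> * (int J + 1)"
    and \<Lambda>: "submonoid_exps \<Lambda>" "D units \<subseteq> \<Lambda>"
      "\<And>m. m \<in> conormal units units \<Longrightarrow> m - Poly_Mapping.single L (int J + 1) \<in> \<Lambda>"
    and "m \<in> D (base_simplex l J)"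
  shows "m \<in> \<Lambda>"
  using assms(5)
proof (induction "nat (ht m)" arbitrary: m rule: less_induct)
  case less
  then have m: "m \<in> M" "0 \<le> int J * wt m + lk m L" "\<And>q. q \<noteq> L \<Longrightarrow> 0 \<le> lk m q" by (auto simp: D_base)
  have ht: "ht m = \<rho> * (lk m L + (int J + 1) * wt m)"
    unfolding ht_eq[OF m(1)] J by (simp add: algebra_simps)
  show ?case
  proof (cases "ht m = 0")
    case True
    then have 0: "lk m L + (int J + 1) * wt m = 0" using ht \<rho>_pos by simp
    then have "0 \<le> (int J + 1) * (- wt m)" using m(2) by (intro mult_nonneg_nonneg) (auto simp: algebra_simps)
    then have "0 \<le> lk m L" using 0 by simp
    moreover have "lk m q = 0" if "q \<noteq> L" for q using True ht_zero_iff[OF m(3)] that by blast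
    ultimately have "0 \<le> lk m q" for q by (cases "q = L") auto
    then show ?thesis using m(1) \<Lambda>(2) by (auto simp: D_units)
  next
    case False
    then have "0 < ht m" using ht_nonneg[OF m(3)] by simp
    then have pos: "1 \<le> lk m L + (int J + 1) * wt m"
      using ht \<rho>_pos by (metis int_one_le_iff_zero_less zero_less_mult_pos less_le_trans zero_less_one)
    then have "\<rho> * 1 \<le> ht m" unfolding ht using \<rho>_pos by (intro mult_left_mono) auto
    then have "int (nat \<rho>) \<le> (\<Sum>q\<in>-{L}. lk m q)" using \<rho>_pos by (simp add: ht_def)
    then obtain g where g: "\<forall>q\<in>-{L}. 0 \<le> g q \<and> g q \<le> lk m q" "sum g (- {L}) = int (nat \<rho>)"
      using subsum_exists[of "- {L}" "lk m" "nat \<rho>"] m(3) by auto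
    \<comment> \<open>A part of m of degree \<rho>, completed by the last coordinate -J: then
      \<open>wt h\<close> = 1 and h has value 0 at \<open>npt l J\<close>. Adding the chart exponent
      makes the last coordinate 1, so the sum lies in the ideal.\<close>
    define h where "h = Abs_poly_mapping (\<lambda>q. if q = L then - int J else g q)"
    have h: "lk h q = (if q = L then - int J else g q)" for q by (simp add: h_def)
    have ht_h: "ht h = \<rho>" using g(2) \<rho>_pos by (simp add: ht_def h)
    have "ht h = \<rho> * lk h L + int l * 1" unfolding ht_h J by (simp add: h algebra_simps)
    then have hM: "h \<in> M" "wt h = 1" by (rule M_I)+
    let ?v = "Poly_Mapping.single L (int J + 1)"
    have v: "?v \<in> M" by (rule single_last_M[of _ "- 1"]) (simp add: J)
    have lk: "lk (h + ?v) q = (if q = L then 1 else g q)" for q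
      by (simp add: lookup_add h lookup_single when_def)
    have "h + ?v \<noteq> 0" by (rule nonzero_lookup[of _ L]) (simp add: lk)
    then have "h + ?v \<in> conormal units units"
      using g(1) hM v lk by (auto simp: conormal_units M_add)
    then have h\<Lambda>: "h \<in> \<Lambda>" using \<Lambda>(3) by force
    have "nat (ht (m - h)) < nat (ht m)" using \<open>0 < ht m\<close> \<rho>_pos by (simp add: ht_diff ht_h)
    moreover have "m - h \<in> D (base_simplex l J)"
      using m hM g(1) h pos by (auto simp: D_base M_diff lookup_minus algebra_simps)
    ultimately have "m - h \<in> \<Lambda>" by (rule less.hyps)
    then have "m - h + h \<in> \<Lambda>" using h\<Lambda> by (rule submonoid_add[OF \<Lambda>(1)])
    then show ?thesis by simp
  qed
qed


text \<open>Moving one unit of a positive coordinate p of m to q stays in the ideal; where m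
  generates, the quotient x_q / x_p is therefore regular.\<close>

lemma ev_in_submonoid:
  assumes m: "m \<in> conormal units units"
    and \<Lambda>: "\<And>x. x \<in> conormal units units \<Longrightarrow> x - m \<in> \<Lambda>"
    and p: "p \<noteq> L" "0 < lk m p" and q: "q \<noteq> L" "q \<noteq> p"
  shows "ev q p \<in> \<Lambda>"
proof -
  have mD: "m \<in> M" "\<And>i. 0 \<le> lk m i" using m by (auto simp: conormal_units)
  have lk: "0 \<le> lk (m + ev q p) i" for i
    using mD(2)[of i] p lookup_ev[OF p(1) q]
    by (cases "i = L"; cases "i = p"; cases "i = q") (auto simp: lookup_add)
  moreover have "lk (m + ev q p) q \<noteq> 0" using mD(2)[of q] p q by (simp add: lookup_add lookup_ev)
  then have "m + ev q p \<noteq> 0" by (rule nonzero_lookup)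
  ultimately have "m + ev q p \<in> conormal units units"
    using mD p q by (simp add: conormal_units M_add ev_M)
  then have "m + ev q p - m \<in> \<Lambda>" by (rule \<Lambda>)
  then show ?thesis by simp
qed

lemma diff_pv_in_submonoid:
  assumes \<Lambda>: "submonoid_exps \<Lambda>" and m: "m \<in> M" "\<And>i. i \<noteq> L \<Longrightarrow> 0 \<le> lk m i" and p: "p \<noteq> L"
    and ev: "\<And>q. q \<noteq> L \<Longrightarrow> q \<noteq> p \<Longrightarrow> ev q p \<in> \<Lambda>"
    and pv: "pv p (wt m - x) (lk m L - y) \<in> \<Lambda>"
  shows "m - pv p x y \<in> \<Lambda>"
proof (rule exps_in_submonoid[OF \<Lambda> _ p _ ev])
  show "m - pv p x y \<in> M" using m p by (simp add: M_diff pv_M)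
  show "0 \<le> lk (m - pv p x y) q" if "q \<noteq> L" "q \<noteq> p" for q
    using m(2)[OF that(1)] that p by (simp add: lookup_minus lookup_pv)
  show "pv p (wt (m - pv p x y)) (lk (m - pv p x y) L) \<in> \<Lambda>"
    using pv m p by (simp add: M_diff pv_M lookup_minus lookup_pv)
qed

text \<open>\<open>yD\<close> will be the least positive invariant power of the last coordinate: l
  in the first congruence case, J + 1 in the second.\<close>

definition origin_pieces :: "nat \<Rightarrow> int \<Rightarrow> (('n \<Rightarrow>\<^sub>0 int) \<times> (real, 'n) vec set) set" where
  "origin_pieces J yD = (\<lambda>p. (pv p 1 0, npt_simplex p 0 1)) ` (- {L})
     \<union> (\<lambda>p. (pv p 0 1, npt_simplex p 1 J)) ` (- {L}) \<union> {(Poly_Mapping.single L yD, base_simplex l J)}"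

text \<open>For an m that involves some x_p: without x_L it is divided by the l-th power of x_p;
  with x_L and degree at least \<rho>, by x_L times the \<rho>-th power of x_p. Both use
  \<open>ev\<close> to concentrate m on p. What depends on the congruence case is isolated in
  \<open>gen\<close>, \<open>h1\<close> and \<open>h2\<close>.\<close>

lemma star_subdivision_origin:
  assumes J: "1 \<le> J" "int J * \<rho> < int l" "int l \<le> (int J + 1) * \<rho>"
    and y: "0 < yD" "\<rho> * yD + int l * xD = 0" "int J * xD + yD = 1"
    and gen: "\<And>\<Lambda> m. submonoid_exps \<Lambda> \<Longrightarrow> D units \<subseteq> \<Lambda> \<Longrightarrow>
      (\<And>m. m \<in> conormal units units \<Longrightarrow> m - Poly_Mapping.single L yD \<in> \<Lambda>) \<Longrightarrow>
      m \<in> D (base_simplex l J) \<Longrightarrow> m \<in> \<Lambda>"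
    and h1: "\<And>m. m \<in> M \<Longrightarrow> ht m = 0 \<Longrightarrow> 0 < lk m L \<Longrightarrow> yD \<le> lk m L"
    and h2: "\<And>m \<Lambda>. m \<in> conormal units units \<Longrightarrow> 0 < ht m \<Longrightarrow> ht m < \<rho> \<Longrightarrow> 1 \<le> lk m L \<Longrightarrow>
      submonoid_exps \<Lambda> \<Longrightarrow> D units \<subseteq> \<Lambda> \<Longrightarrow>
      (\<And>x. x \<in> conormal units units \<Longrightarrow> x - m \<in> \<Lambda>) \<Longrightarrow> m - Poly_Mapping.single L yD \<in> \<Lambda>"
  shows "star_subdivision (N_G l) units units (origin_pieces J yD)"
  unfolding star_subdivision_def
proof (intro conjI ballI allI impI)
  show "case i of (v, B) \<Rightarrow> star_chart (N_G l) units units v B" if "i \<in> origin_pieces J yD" for i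
  proof -
    have "star_chart (N_G l) units units (Poly_Mapping.single L yD) (base_simplex l J)"
      by (rule star_chart_origin_base[OF J(1,2) y]) (rule gen)
    then show ?thesis
      using that star_chart_origin_low star_chart_origin_mid[OF _ J]
      unfolding origin_pieces_def by (elim UnE imageE) simp_all
  qed
  fix m \<Lambda>
  assume m: "m \<in> conormal units units" and \<Lambda>: "submonoid_exps \<Lambda>" "D units \<subseteq> \<Lambda>"
    "\<forall>x\<in>conormal units units. x - m \<in> \<Lambda>"
  have mD: "m \<in> M" "\<And>i. 0 \<le> lk m i" "m \<noteq> 0" using m by (auto simp: conormal_units)
  have h: "0 \<le> ht m" by (rule ht_nonneg) (rule mD(2))
  show "\<exists>(v, B)\<in>origin_pieces J yD. m - v \<in> \<Lambda>"
  proof (cases "ht m = 0")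
    case True
    then have 0: "lk m q = 0" if "q \<noteq> L" for q using ht_zero_iff[of m] mD(2) that by blast
    have "lk m L \<noteq> 0"
    proof
      assume "lk m L = 0"
      then have "lk m q = 0" for q using 0 by (cases "q = L") auto
      then show False using mD(3) by (metis lookup_zero poly_mapping_eqI)
    qed
    then have "yD \<le> lk m L" using h1[OF mD(1) True] mD(2)[of L] by simp
    then have "m - Poly_Mapping.single L yD \<in> D units"
      using mD single_last_M[OF y(2)] by (auto simp: D_units M_diff lookup_minus lookup_single when_def)
    then show ?thesis using \<Lambda>(2) unfolding origin_pieces_def by blast
  next
    case False
    then obtain p where p: "p \<noteq> L" "lk m p \<noteq> 0" using ht_zero_iff[of m] mD(2) by blast
    then have p0: "0 < lk m p" using mD(2)[of p] by simp
    have ev: "ev q p \<in> \<Lambda>" if "q \<noteq> L" "q \<noteq> p" for q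
      by (rule ev_in_submonoid[OF m _ p(1) p0 that]) (use \<Lambda>(3) in blast)
    note diff = diff_pv_in_submonoid[OF \<Lambda>(1) mD(1) mD(2) p(1) ev subsetD[OF \<Lambda>(2) pv_in_units[OF p(1)]]]
    consider "lk m L = 0" | "1 \<le> lk m L" "\<rho> \<le> ht m" | "1 \<le> lk m L" "ht m < \<rho>"
      using mD(2)[of L] by linarith
    then show ?thesis
    proof cases
      case 1
      then have "ht m = int l * wt m" using ht_eq[OF mD(1)] by simp
      then have "0 < int l * wt m" using False h by linarith
      then have "0 < wt m" using l_pos by (simp add: zero_less_mult_iff)
      then have "m - pv p 1 0 \<in> \<Lambda>" using 1 l_pos by (intro diff) auto
      then show ?thesis using p unfolding origin_pieces_def by blast
    next
      case 2
      then have "m - pv p 0 1 \<in> \<Lambda>" using ht_eq[OF mD(1)] by (intro diff) (auto simp: algebra_simps)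
      then show ?thesis using p unfolding origin_pieces_def by blast
    next
      case 3
      then have "m - Poly_Mapping.single L yD \<in> \<Lambda>"
        using h False \<Lambda>(3) by (intro h2[OF m _ _ _ \<Lambda>(1,2)]) auto
      then show ?thesis unfolding origin_pieces_def by blast
    qed
  qed
qed

lemma star_subdivision_origin_one:
  assumes J: "1 \<le> J" "int J * \<rho> = int l - 1"
  shows "star_subdivision (N_G l) units units (origin_pieces J (int l))"
proof (rule star_subdivision_origin[OF J(1), where xD = "- \<rho>"])
  show "int J * \<rho> < int l" "int l \<le> (int J + 1) * \<rho>" using J \<rho>_pos by (simp_all add: distrib_right)
  show "0 < int l" by (rule l_pos)
  show "\<rho> * int l + int l * - \<rho> = 0" by (simp add: algebra_simps)
  show "int J * - \<rho> + int l = 1" unfolding mult_minus_right J(2) by simp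
  show "m \<in> \<Lambda>" if "submonoid_exps \<Lambda>" "D units \<subseteq> \<Lambda>"
    "\<And>m. m \<in> conormal units units \<Longrightarrow> m - Poly_Mapping.single L (int l) \<in> \<Lambda>"
    "m \<in> D (base_simplex l J)" for \<Lambda> m
    using base_generated_one[OF J(2) that] .
  have pairing: "lk m L + int J * ht m = int l * (int J * wt m + lk m L)" if "m \<in> M" for m
  proof -
    have "lk m L + int J * ht m = lk m L + (int J * \<rho>) * lk m L + int l * (int J * wt m)"
      unfolding ht_eq[OF that] by (simp add: algebra_simps)
    then show ?thesis unfolding J by (simp add: algebra_simps)
  qed
  show "int l \<le> lk m L" if "m \<in> M" "ht m = 0" "0 < lk m L" for m
  proof -
    have "lk m L = int l * (int J * wt m + lk m L)" using pairing[OF that(1)] that(2) by simp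
    then show ?thesis using that(3) by (metis dvd_triv_left zdvd_imp_le)
  qed
  fix m \<Lambda>
  assume m: "m \<in> conormal units units" and h: "0 < ht m" "ht m < \<rho>" "1 \<le> lk m L"
    and \<Lambda>: "submonoid_exps \<Lambda>" "D units \<subseteq> \<Lambda>" "\<And>x. x \<in> conormal units units \<Longrightarrow> x - m \<in> \<Lambda>"
  have mD: "m \<in> M" "\<And>i. 0 \<le> lk m i" "m \<noteq> 0" using m by (auto simp: conormal_units)
  obtain p where p: "p \<noteq> L" "lk m p \<noteq> 0" using h(1) ht_zero_iff[of m] mD(2) by fastforce
  then have p0: "0 < lk m p" using mD(2)[of p] by simp
  have ev: "ev q p \<in> \<Lambda>" if "q \<noteq> L" "q \<noteq> p" for q
    by (rule ev_in_submonoid[OF m \<Lambda>(3) p(1) p0 that])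
  have slope: "1 \<le> int J * wt m + lk m L"
    using unit_slope(2)[of m J] mD J by auto
  have l_le: "int l \<le> lk m L + int J * ht m"
    unfolding pairing[OF mD(1)] using slope l_pos mult_left_mono[of 1 "int J * wt m + lk m L" "int l"] by simp
  \<comment> \<open>A degree below \<rho> forces a large last coordinate. So m stays in the ideal
    when x_L^J is traded for one x_p, and since m generates, the exponent of x_p / x_L^J lies in
    \<Lambda>.\<close>
  have "int J * ht m \<le> int J * (\<rho> - 1)" using h by (intro mult_left_mono) auto
  then have yJ: "int J \<le> lk m L" using l_le J by (simp add: algebra_simps)
  have lk: "0 \<le> lk (m + pv p 1 (- int J)) i" for i
    using mD(2)[of i] yJ J lookup_pv[OF p(1), where x = 1 and y = "- int J"]
    by (cases "i = L"; cases "i = p") (auto simp: lookup_add algebra_simps)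
  moreover have "lk (m + pv p 1 (- int J)) p \<noteq> 0"
    using p0 J p by (simp add: lookup_add lookup_pv algebra_simps)
  then have "m + pv p 1 (- int J) \<noteq> 0" by (rule nonzero_lookup)
  ultimately have "m + pv p 1 (- int J) \<in> conormal units units"
    using mD p by (simp add: conormal_units M_add pv_M)
  then have "m + pv p 1 (- int J) - m \<in> \<Lambda>" by (rule \<Lambda>(3))
  then have g: "pv p 1 (- int J) \<in> \<Lambda>" by simp
  have k: "0 \<le> ht m" using h by simp
  \<comment> \<open>Trading all \<open>ht m\<close> units on p in this way leaves a pure power of
    x_L, nonnegative by \<open>l_le\<close> even after removal of x_L^l.\<close>
  have "pv p (wt m - (- \<rho>) - ht m * 1) (lk m L - int l - ht m * (- int J)) \<in> D units"
  proof (rule pv_in_units[OF p(1)])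
    show "0 \<le> lk m L - int l - ht m * (- int J)" using l_le by (simp add: mult.commute)
    have "\<rho> * (lk m L - int l - ht m * (- int J)) + int l * (wt m - (- \<rho>) - ht m * 1)
        = \<rho> * lk m L + int l * wt m + (int J * \<rho>) * ht m - int l * ht m" by (simp add: algebra_simps)
    also have "\<dots> = 0" unfolding J ht_eq[OF mD(1), symmetric] by (simp add: algebra_simps)
    finally show "0 \<le> \<rho> * (lk m L - int l - ht m * (- int J)) + int l * (wt m - (- \<rho>) - ht m * 1)" by simp
  qed
  from pv_split[OF \<Lambda>(1) g k subsetD[OF \<Lambda>(2) this]]
  have "m - pv p (- \<rho>) (int l) \<in> \<Lambda>"
    by (intro diff_pv_in_submonoid[OF \<Lambda>(1) mD(1) mD(2) p(1) ev])
  moreover have "pv p (- \<rho>) (int l) = Poly_Mapping.single L (int l)" by (simp add: pv_def algebra_simps)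
  ultimately show "m - Poly_Mapping.single L (int l) \<in> \<Lambda>" by simp
qed

text \<open>All degrees of lattice exponents are multiples of \<rho> here, so the remaining case 0 <
  ht m < \<rho> is void.\<close>

lemma star_subdivision_origin_zero:
  assumes J: "1 \<le> J" "int l = \<rho> * (int J + 1)"
  shows "star_subdivision (N_G l) units units (origin_pieces J (int J + 1))"
proof (rule star_subdivision_origin[OF J(1), where xD = "- 1"])
  show "int J * \<rho> < int l" "int l \<le> (int J + 1) * \<rho>" using J \<rho>_pos by (simp_all add: algebra_simps)
  show "0 < int J + 1" by simp
  show "\<rho> * (int J + 1) + int l * - 1 = 0" "int J * - 1 + (int J + 1) = 1" using J by simp_all
  show "m \<in> \<Lambda>" if "submonoid_exps \<Lambda>" "D units \<subseteq> \<Lambda>"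
    "\<And>m. m \<in> conormal units units \<Longrightarrow> m - Poly_Mapping.single L (int J + 1) \<in> \<Lambda>"
    "m \<in> D (base_simplex l J)" for \<Lambda> m
    using base_generated_zero[OF J(2) that] .
  have ht: "ht m = \<rho> * (lk m L + (int J + 1) * wt m)" if "m \<in> M" for m
    unfolding ht_eq[OF that] J by (simp add: algebra_simps)
  show "int J + 1 \<le> lk m L" if "m \<in> M" "ht m = 0" "0 < lk m L" for m
  proof -
    have "lk m L = (int J + 1) * (- wt m)" using ht[OF that(1)] that(2) \<rho>_pos by simp
    then show ?thesis using that(3) by (metis dvd_triv_left zdvd_imp_le)
  qed
  fix m \<Lambda>
  assume m: "m \<in> conormal units units" and h: "0 < ht m" "ht m < \<rho>"
  have "m \<in> M" using m by (simp add: conormal_units)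
  then have "\<rho> dvd ht m" using ht by simp
  then show "m - Poly_Mapping.single L (int J + 1) \<in> \<Lambda>" using h zdvd_imp_le by fastforce
qed

section \<open>The last center when l is congruent to 0\<close>

abbreviation base_units :: "(real, 'n) vec set" where "base_units \<equiv> unit_vec ` (- {L})"

lemma conormal_base:
  "m \<in> conormal base_units (base_simplex l J) \<longleftrightarrow> m \<in> D (base_simplex l J) \<and> 0 < ht m"
proof -
  have "(\<Sum>t\<in>base_units. pairing m t) = of_int (ht m)"
    by (simp add: sum.reindex[OF inj_on_subset[OF inj_unit_vec]] pairing_unit_vec ht_def)
  then show ?thesis by (simp add: conormal_exps_def)
qed

text \<open>The degree of an exponent is \<rho> times its value at \<open>npt l (J + 1)\<close>, so
  the transversal singularity is of type 1/\<rho>(1,...,1) and has one new ray. The exponent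
  \<open>pv p 1 (- int J)\<close> restricts to the \<rho>-th power of x_p and vanishes at
  \<open>npt l J\<close>.\<close>

lemma star_subdivision_base:
  assumes J: "int l = \<rho> * (int J + 1)"
  shows "star_subdivision (N_G l) base_units (base_simplex l J)
    ((\<lambda>p. (pv p 1 (- int J), npt_simplex p J (J + 1))) ` (- {L}))"
proof -
  let ?I = "conormal base_units (base_simplex l J)"
  have I: "m \<in> ?I \<longleftrightarrow> m \<in> D (base_simplex l J) \<and> 0 < ht m" for m by (rule conormal_base)
  have ht: "ht m = \<rho> * ((int J + 1) * wt m + lk m L)" if "m \<in> M" for m
    unfolding ht_eq[OF that] J by (simp add: algebra_simps)
  have slope: "0 < (int J + 1) * wt m + lk m L \<longleftrightarrow> 0 < ht m" "0 \<le> (int J + 1) * wt m + lk m L \<longleftrightarrow> 0 \<le> ht m"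
    if "m \<in> M" for m
    unfolding ht[OF that] using \<rho>_pos by (auto simp: zero_less_mult_iff zero_le_mult_iff)
  have coord: "\<rho> * (- int J) + int l * 1 = \<rho>" unfolding J by (simp add: algebra_simps)
  have pv_D: "pv p x y \<in> D (base_simplex l J)"
    if "p \<noteq> L" "0 \<le> int J * x + y" "0 \<le> (int J + 1) * x + y" for p x y
  proof -
    have "0 \<le> \<rho> * ((int J + 1) * x + y)" using that \<rho>_pos by (intro mult_nonneg_nonneg) auto
    then have "0 \<le> lk (pv p x y) p" using that(1) by (simp add: lookup_pv J algebra_simps)
    then have "0 \<le> lk (pv p x y) q" if "q \<noteq> L" for q
      using that \<open>p \<noteq> L\<close> by (cases "q = p") (auto simp: lookup_pv)
    then show ?thesis using that by (simp add: D_base pv_M lookup_pv)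
  qed
  have chart: "star_chart (N_G l) base_units (base_simplex l J) (pv p 1 (- int J)) (npt_simplex p J (J + 1))"
    if p: "p \<noteq> L" for p
    unfolding star_chart_def
  proof (intro conjI ballI allI impI subsetI)
    show "pv p 1 (- int J) \<in> ?I"
      unfolding I using p coord \<rho>_pos by (auto simp: ht_pv intro!: pv_D)
    show "m \<in> D (npt_simplex p J (J + 1))" if "m \<in> D (base_simplex l J)" for m
      using that slope(2)[of m] ht_nonneg[of m] by (auto simp: D_base D_npt_simplex algebra_simps)
    show "m - pv p 1 (- int J) \<in> D (npt_simplex p J (J + 1))" if "m \<in> ?I" for m
      using that slope(1)[of m] p
      by (auto simp: I D_base D_npt_simplex M_diff pv_M lookup_minus lookup_pv algebra_simps)
    fix \<Lambda> m
    assume \<Lambda>: "submonoid_exps \<Lambda>" "D (base_simplex l J) \<subseteq> \<Lambda>" "\<forall>m\<in>?I. m - pv p 1 (- int J) \<in> \<Lambda>"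
      and m: "m \<in> D (npt_simplex p J (J + 1))"
    show "m \<in> \<Lambda>"
    proof (rule exps_in_submonoid'[OF \<Lambda>(1) _ p, where x = 1 and y = "- int J"])
      show "m \<in> M" "\<And>q. q \<noteq> L \<Longrightarrow> q \<noteq> p \<Longrightarrow> 0 \<le> lk m q" using m by (auto simp: D_npt_simplex)
      show 1: "1 \<le> \<rho> * (- int J) + int l * 1" unfolding coord by (rule \<rho>_pos)
      show "pv p 1 (- int J) + ev q p - pv p 1 (- int J) \<in> \<Lambda>" if "q \<noteq> L" "q \<noteq> p" for q
      proof -
        note e = pv_ev[OF p that, where x = 1 and y = "- int J"]
        have "pv p 1 (- int J) + ev q p \<in> ?I"
          unfolding I D_base using e(1,2,3) e(5)[OF 1] e(4) coord \<rho>_pos by simp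
        then show ?thesis using \<Lambda>(3) by blast
      qed
      show "pv p (wt m) (lk m L) \<in> \<Lambda>"
        using m p by (intro subsetD[OF \<Lambda>(2)] pv_D) (auto simp: D_npt_simplex algebra_simps)
    qed
  qed
  show ?thesis
    unfolding star_subdivision_def
  proof (intro conjI ballI allI impI)
    show "case i of (v, B) \<Rightarrow> star_chart (N_G l) base_units (base_simplex l J) v B"
      if "i \<in> (\<lambda>p. (pv p 1 (- int J), npt_simplex p J (J + 1))) ` (- {L})" for i
      using that chart by auto
    fix m \<Lambda>
    assume m: "m \<in> ?I" and \<Lambda>: "submonoid_exps \<Lambda>" "D (base_simplex l J) \<subseteq> \<Lambda>" "\<forall>x\<in>?I. x - m \<in> \<Lambda>"
    have mD: "m \<in> M" "0 \<le> int J * wt m + lk m L" "\<And>q. q \<noteq> L \<Longrightarrow> 0 \<le> lk m q" "0 < ht m"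
      using m by (auto simp: I D_base)
    obtain p where p: "p \<noteq> L" "lk m p \<noteq> 0" using mD(4) ht_zero_iff[OF mD(3)] by fastforce
    then have p0: "0 < lk m p" using mD(3)[of p] by simp
    have ev: "ev q p \<in> \<Lambda>" if "q \<noteq> L" "q \<noteq> p" for q
    proof -
      have "0 \<le> lk (m + ev q p) i" if "i \<noteq> L" for i
        using mD(3)[OF that] p0 lookup_ev[OF p(1) \<open>q \<noteq> L\<close> \<open>q \<noteq> p\<close>]
        by (cases "i = p"; cases "i = q") (auto simp: lookup_add)
      then have "m + ev q p \<in> ?I"
        using mD that p by (simp add: I D_base M_add ev_M ht_add lookup_add lookup_ev)
      then have "m + ev q p - m \<in> \<Lambda>" using \<Lambda>(3) by blast
      then show ?thesis by simp
    qed
    have "m - pv p 1 (- int J) \<in> \<Lambda>"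
      using mD(2) slope(1)[OF mD(1)] mD(4)
      by (intro diff_pv_in_submonoid[OF \<Lambda>(1) mD(1,3) p(1) ev] subsetD[OF \<Lambda>(2)] pv_D p(1))
        (auto simp: algebra_simps)
    then show "\<exists>(v, B)\<in>(\<lambda>p. (pv p 1 (- int J), npt_simplex p J (J + 1))) ` (- {L}). m - v \<in> \<Lambda>"
      using p(1) by auto
  qed
qed

section \<open>Simplicial cones, and charts that miss a center\<close>

lemma finite_npt_simplex: "finite (npt_simplex p a b)"
  by (simp add: npt_simplex_def)

lemma pairing_pv_npt:
  "p \<noteq> L \<Longrightarrow> pairing (pv p x y) (npt l j) = of_int (int j * x + y)"
  by (simp add: pairing_npt pv_M lookup_pv)

lemma has_dual_vectors_npt_simplex:
  assumes p: "p \<noteq> L" and ab: "a \<le> b"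
  shows "has_dual_vectors (N_G l) (npt_simplex p a b)"
  unfolding has_dual_vectors_def
proof (intro conjI ballI finite_npt_simplex)
  have zero: "pairing (pv p x y) (unit_vec q) = 0" if "q \<noteq> L" "q \<noteq> p" for q x y
    using p that by (simp add: pairing_unit_vec lookup_pv)
  fix u assume "u \<in> npt_simplex p a b"
  \<comment> \<open>Equality of a and b must be allowed: the middle simplices of the final stage can
    degenerate.\<close>
  then consider "u = npt l a" "a = b" | "u = npt l a" "a < b" | "u = npt l b" "a < b"
    | q where "q \<noteq> L" "q \<noteq> p" "u = unit_vec q"
    using ab unfolding npt_simplex_def by fastforce
  then show "\<exists>m\<in>M. 0 < pairing m u \<and> (\<forall>b\<in>npt_simplex p a b - {u}. pairing m b = 0)"
  proof cases
    case 1
    then show ?thesis using p zero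
      by (intro bexI[of _ "pv p 0 1"]) (auto simp: npt_simplex_def pairing_pv_npt pv_M)
  next
    case 2
    then show ?thesis using p zero
      by (intro bexI[of _ "pv p (- 1) (int b)"]) (auto simp: npt_simplex_def pairing_pv_npt pv_M)
  next
    case 3
    then show ?thesis using p zero
      by (intro bexI[of _ "pv p 1 (- int a)"]) (auto simp: npt_simplex_def pairing_pv_npt pv_M)
  next
    case 4
    show ?thesis
    proof (intro bexI[of _ "ev q p"] conjI ballI)
      show "0 < pairing (ev q p) u" using 4 p by (simp add: pairing_unit_vec lookup_ev)
      show "ev q p \<in> M" using 4 p by (simp add: ev_M)
      fix w assume w: "w \<in> npt_simplex p a b - {u}"
      then consider j where "w = npt l j" | x where "w = unit_vec x" "x \<noteq> p" "x \<noteq> q"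
        using 4(3) unfolding npt_simplex_def by blast
      then show "pairing (ev q p) w = 0"
        using 4 p by cases (simp_all add: pairing_npt ev_M pairing_unit_vec lookup_ev)
    qed
  qed
qed

lemma has_dual_vectors_base:
  assumes "int J * \<rho> < int l"
  shows "has_dual_vectors (N_G l) (base_simplex l J :: (real, 'n) vec set)"
  unfolding has_dual_vectors_def
proof (intro conjI ballI)
  show "finite (base_simplex l J)" by (simp add: base_simplex_def)
  fix u :: "(real, 'n) vec" assume "u \<in> base_simplex l J"
  then consider "u = npt l J" | q where "q \<noteq> L" "u = unit_vec q" unfolding base_simplex_def by blast
  then show "\<exists>m\<in>M. 0 < pairing m u \<and> (\<forall>b\<in>base_simplex l J - {u}. pairing m b = 0)"
  proof cases
    case 1
    have "Poly_Mapping.single L (int l) \<in> M" "wt (Poly_Mapping.single L (int l)) = - \<rho>"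
      by (rule single_last_M[of _ "- \<rho>"], simp add: algebra_simps)+
    moreover from this have "0 < int J * wt (Poly_Mapping.single L (int l)) + lk (Poly_Mapping.single L (int l)) L"
      using assms by (simp add: right_diff_distrib)
    ultimately show ?thesis using 1
      by (intro bexI[of _ "Poly_Mapping.single L (int l)"])
        (auto simp: base_simplex_def pairing_npt pairing_unit_vec lookup_single when_def
          simp del: of_int_add of_int_mult split: if_splits)
  next
    case 2
    show ?thesis
    proof (intro bexI[of _ "pv q 1 (- int J)"] conjI ballI)
      have "0 < lk (pv q 1 (- int J)) q" using 2 assms by (simp add: lookup_pv mult.commute)
      then show "0 < pairing (pv q 1 (- int J)) u" using 2 by (simp add: pairing_unit_vec)
      show "pv q 1 (- int J) \<in> M" using 2 by (simp add: pv_M)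
      fix w :: "(real, 'n) vec" assume "w \<in> base_simplex l J - {u}"
      then consider "w = npt l J" | x where "w = unit_vec x" "x \<noteq> L" "x \<noteq> q"
        using 2(2) unfolding base_simplex_def by blast
      then show "pairing (pv q 1 (- int J)) w = 0"
        using 2 by cases (simp_all add: pairing_pv_npt pairing_unit_vec lookup_pv)
    qed
  qed
qed

lemma has_dual_vectors_units: "has_dual_vectors (N_G l) units"
  unfolding has_dual_vectors_def
proof (intro conjI ballI)
  fix u assume "u \<in> units"
  then obtain q where u: "u = unit_vec q" by blast
  show "\<exists>m\<in>M. 0 < pairing m u \<and> (\<forall>b\<in>units - {u}. pairing m b = 0)"
  proof (cases "q = L")
    case True
    have "Poly_Mapping.single L (int l) \<in> M" by (rule single_last_M[of _ "- \<rho>"]) (simp add: algebra_simps)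
    then show ?thesis using True u l_pos
      by (intro bexI[of _ "Poly_Mapping.single L (int l)"]) (auto simp: pairing_unit_vec lookup_single when_def split: if_splits)
  next
    case False
    have "lk (pv q 1 0) i = (if i = q then int l else 0)" for i
      using lookup_pv[OF False, where x = 1 and y = 0] False by (cases "i = L"; cases "i = q") auto
    then show ?thesis using False u l_pos
      by (intro bexI[of _ "pv q 1 0"]) (auto simp: pairing_unit_vec pv_M split: if_splits)
  qed
qed simp

text \<open>The exponents with values b - j or j - a at \<open>npt l j\<close> are nonnegative on
  the simplex and negative beyond its end.\<close>

lemma npt_simplex_away:
  assumes p: "p \<noteq> L" and ab: "a \<le> b" "b \<le> i \<or> i' \<le> a" and i: "i < i'"
  shows "\<exists>m\<in>D (npt_simplex p a b). \<exists>t\<in>{npt l i, npt l i'}. pairing m t < 0"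
  using ab(2)
proof
  assume "b \<le> i"
  have "pv p (- 1) (int b) \<in> D (npt_simplex p a b)" using p ab by (simp add: D_npt_simplex pv_M lookup_pv)
  moreover have "pairing (pv p (- 1) (int b)) (npt l i') < 0" using p i \<open>b \<le> i\<close> by (simp add: pairing_pv_npt)
  ultimately show ?thesis by blast
next
  assume "i' \<le> a"
  have "pv p 1 (- int a) \<in> D (npt_simplex p a b)" using p ab by (simp add: D_npt_simplex pv_M lookup_pv)
  moreover have "pairing (pv p 1 (- int a)) (npt l i) < 0" using p i \<open>i' \<le> a\<close> by (simp add: pairing_pv_npt)
  ultimately show ?thesis by blast
qed

lemma base_away:
  assumes J: "int J * \<rho> < int l" and i: "i < J"
  shows "\<exists>m\<in>D (base_simplex l J). \<exists>t\<in>{npt l i, npt l i'}. pairing m t < 0"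
proof -
  obtain p :: 'n where p: "p \<noteq> L" using other_index by blast
  have "0 \<le> lk (pv p 1 (- int J)) q" if "q \<noteq> L" for q
    using that p J by (cases "q = p") (auto simp: lookup_pv mult.commute)
  then have "pv p 1 (- int J) \<in> D (base_simplex l J)" using p by (simp add: D_base pv_M lookup_pv)
  moreover have "pairing (pv p 1 (- int J)) (npt l i) < 0" using p i by (simp add: pairing_pv_npt)
  ultimately show ?thesis by blast
qed

text \<open>The exponent with values b - j has negative p-coordinate b * \<rho> - l, and
  \<open>unit_vec p\<close> is a vertex of the center but not of the simplex.\<close>

lemma npt_simplex_away_base_units:
  assumes p: "p \<noteq> L" and ab: "a \<le> b" "int b * \<rho> < int l"
  shows "\<exists>m\<in>D (npt_simplex p a b). \<exists>t\<in>base_units. pairing m t < 0"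
proof -
  have "pv p (- 1) (int b) \<in> D (npt_simplex p a b)" using p ab by (simp add: D_npt_simplex pv_M lookup_pv)
  moreover have "lk (pv p (- 1) (int b)) p < 0" using p ab by (simp add: lookup_pv mult.commute)
  then have "pairing (pv p (- 1) (int b)) (unit_vec p) < 0" by (simp only: pairing_unit_vec of_int_less_0_iff)
  ultimately show ?thesis using p by blast
qed

end

section \<open>The sequence of triangulations\<close>

lemma convex_cone_pos: "convex_cone (pos A)"
  by (simp add: pos_def convex_cone_convex_cone_hull)

lemma pos_inc: "A \<subseteq> pos A"
  by (simp add: pos_def hull_subset)

lemma pos_sum:
  assumes "\<And>i. i \<in> F \<Longrightarrow> f i \<in> pos A"
  shows "sum f F \<in> pos A"
  using assms
  by (induction F rule: infinite_finite_induct)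
    (auto intro: convex_cone_contains_0 convex_cone_add convex_cone_pos)

lemma pos_face_mem_fan:
  assumes "B \<subseteq> A" "A \<in> G"
  shows "pos B \<in> fan_of (complex_of G)"
proof -
  have "convex hull B \<in> complex_of G" using assms by (auto simp: complex_of_def)
  then show ?thesis unfolding fan_of_def by (metis imageI pos_convex_hull)
qed

lemma toric_compatible_complex:
  assumes "\<And>A. A \<in> G \<Longrightarrow> \<exists>\<sigma>\<in>\<Delta>. A \<subseteq> \<sigma> \<and> convex_cone \<sigma>"
  shows "toric_compatible (fan_of (complex_of G)) \<Delta>"
  unfolding toric_compatible_def
proof
  fix \<tau> assume "\<tau> \<in> fan_of (complex_of G)"
  then obtain A B where AB: "A \<in> G" "B \<subseteq> A" "\<tau> = pos B"
    unfolding fan_of_def complex_of_def using pos_convex_hull by blast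
  obtain \<sigma> where \<sigma>: "\<sigma> \<in> \<Delta>" "A \<subseteq> \<sigma>" "convex_cone \<sigma>" using assms[OF AB(1)] by blast
  have "pos B \<subseteq> \<sigma>" unfolding pos_def by (rule hull_minimal) (use AB \<sigma> in auto)
  then show "\<exists>\<sigma>\<in>\<Delta>. \<tau> \<subseteq> \<sigma>" using \<sigma>(1) AB(3) by blast
qed

lemma complex_of_absorb:
  assumes "\<And>A. A \<in> H \<Longrightarrow> \<exists>B\<in>G. A \<subseteq> B"
  shows "complex_of (G \<union> H) = complex_of G"
  unfolding complex_of_def using assms by blast

context cyclic_type
begin

section \<open>The recursively defined triangulations in closed form\<close>

lemma Xi_eq: "\<Xi> = (\<lambda>p. - {L, p}) ` (- {L})"
proof (intro equalityI subsetI)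
  fix \<xi> :: "'n set" assume "\<xi> \<in> \<Xi>"
  then have \<xi>: "\<xi> \<subseteq> - {L}" "card \<xi> = r - 2" by (auto simp: \<Xi>_def r)
  have "card (- {L} - \<xi>) = card (- {L}) - card \<xi>" using \<xi>(1) by (intro card_Diff_subset) auto
  also have "\<dots> = 1" using card_ge_2 \<xi>(2) unfolding card_not_last by simp
  finally obtain p where "- {L} - \<xi> = {p}" by (rule card_1_singletonE)
  then have "p \<in> - {L}" "\<xi> = - {L, p}" using \<xi>(1) by auto
  then show "\<xi> \<in> (\<lambda>p. - {L, p}) ` (- {L})" by blast
next
  fix \<xi> :: "'n set" assume "\<xi> \<in> (\<lambda>p. - {L, p}) ` (- {L})"
  then obtain p where p: "p \<noteq> L" "\<xi> = - {L} - {p}" by auto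
  then have "card \<xi> = card (- {L}) - 1" by (simp add: card_Diff_singleton_if)
  also have "\<dots> = CARD('n) - 2" unfolding card_not_last r[symmetric] using card_ge_2 by simp
  finally show "\<xi> \<in> \<Xi>" using p(2) by (auto simp: \<Xi>_def)
qed

lemma simplices_eq: "simplices l a b = (\<lambda>p. npt_simplex p a b) ` (- {L})"
  unfolding simplices_def Xi_eq npt_simplex_def by blast

lemma npt_neq_unit_vec:
  assumes "p \<noteq> L" "q \<noteq> L" "q \<noteq> p"
  shows "npt l j \<noteq> (unit_vec q :: (real, 'n) vec)"
proof
  assume "npt l j = (unit_vec q :: (real, 'n) vec)"
  then have "npt l j $ p = (unit_vec q :: (real, 'n) vec) $ p"
    "npt l j $ q = (unit_vec q :: (real, 'n) vec) $ q" by simp_all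
  then show False using assms l_pos by (auto simp: npt_def unit_vec_def axis_def)
qed

text \<open>The bound matters for r = 2, where \<open>npt l l\<close> is the first basis
  vector.\<close>

lemma npt_neq_unit_vec':
  assumes "q \<noteq> L" "j < l"
  shows "npt l j \<noteq> (unit_vec q :: (real, 'n) vec)"
proof
  assume "npt l j = (unit_vec q :: (real, 'n) vec)"
  then have "npt l j $ q = (unit_vec q :: (real, 'n) vec) $ q" by simp
  then show False using assms by (auto simp: npt_def unit_vec_def axis_def)
qed

lemma npt_mem_npt_simplex: "p \<noteq> L \<Longrightarrow> npt l j \<in> npt_simplex p a b \<longleftrightarrow> j = a \<or> j = b"
  using npt_neq_unit_vec[of p] by (fastforce simp: npt_simplex_def npt_eq_iff)

text \<open>The recursion removes simplices by set difference; disjointness guarantees that no other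
  generating simplex disappears.\<close>

lemma simplices_disjoint:
  assumes "{a, b} \<noteq> {c, d}"
  shows "simplices l a b \<inter> (simplices l c d :: (real, 'n) vec set set) = {}"
proof (rule ccontr)
  assume "\<not> ?thesis"
  then obtain p q :: 'n where pq: "p \<noteq> L" "q \<noteq> L" "npt_simplex p a b = npt_simplex q c d"
    unfolding simplices_eq by auto
  then have "j = a \<or> j = b \<longleftrightarrow> j = c \<or> j = d" for j
    using npt_mem_npt_simplex[of p j a b] npt_mem_npt_simplex[of q j c d] by simp
  then show False using assms by blast
qed

lemma base_notin_simplices:
  assumes "a < l" "b < l"
  shows "base_simplex l J \<notin> (simplices l a b :: (real, 'n) vec set set)"
proof
  assume "base_simplex l J \<in> (simplices l a b :: (real, 'n) vec set set)"
  then obtain p :: 'n where p: "p \<noteq> L" "base_simplex l J = npt_simplex p a b" unfolding simplices_eq by blast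
  have "unit_vec p \<in> base_simplex l J" using p(1) by (simp add: base_simplex_def)
  then have "unit_vec p \<in> npt_simplex p a b" using p(2) by simp
  then obtain q where "q \<noteq> p" "unit_vec p = (unit_vec q :: (real, 'n) vec)"
    using npt_neq_unit_vec'[OF p(1) assms(1)] npt_neq_unit_vec'[OF p(1) assms(2)]
    unfolding npt_simplex_def by auto
  then show False using inj_unit_vec by (auto dest: injD)
qed

text \<open>Unit intervals are finished up to k + 1 and from J - k on; one interval from k + 1 to J
  - k remains. For J = 2 * k + 1 it is a point, for J = 2 * k + 2 a unit interval.\<close>

definition inner_stage :: "nat \<Rightarrow> nat \<Rightarrow> (real, 'n) vec set set" where
  "inner_stage J k = (\<Union>j\<in>{1..k + 1} \<union> {J - k + 1..J}. simplices l (j - 1) j) \<union> simplices l (k + 1) (J - k)"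

text \<open>With \<open>J = \<nu>\<close> respectively \<open>J = \<nu> - 1\<close>, this is the triangulation with index \<open>k + 1\<close>.\<close>

definition stage :: "nat \<Rightarrow> nat \<Rightarrow> (real, 'n) vec set set" where
  "stage J k = inner_stage J k \<union> {base_simplex l J}"

lemma inner_stageE:
  assumes "A \<in> inner_stage J k" "2 * k + 1 \<le> J"
  obtains p a b where "p \<noteq> L" "A = npt_simplex p a b" "a \<le> b" "b \<le> J"
proof -
  consider j where "j \<in> {1..k + 1} \<union> {J - k + 1..J}" "A \<in> simplices l (j - 1) j"
    | "A \<in> simplices l (k + 1) (J - k)"
    using assms(1) unfolding inner_stage_def by blast
  then have "\<exists>a b. a \<le> b \<and> b \<le> J \<and> A \<in> simplices l a b"
  proof cases
    case (1 j)
    then show ?thesis using assms(2) by (intro exI[of _ "j - 1"] exI[of _ j]) auto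
  next
    case 2
    then show ?thesis using assms(2) by (intro exI[of _ "k + 1"] exI[of _ "J - k"]) auto
  qed
  then show ?thesis using that unfolding simplices_eq by blast
qed

lemma J_less: "int J * \<rho> < int l \<Longrightarrow> J < l"
  using \<rho>_pos mult_left_mono[of 1 \<rho> "int J"] by simp

lemma base_notin_inner_stage:
  assumes "2 * k + 1 \<le> J" "J < l"
  shows "base_simplex l J \<notin> inner_stage J k"
proof
  assume "base_simplex l J \<in> inner_stage J k"
  then obtain p a b where "p \<noteq> L" "base_simplex l J = npt_simplex p a b" "a \<le> b" "b \<le> J"
    using assms(1) by (rule inner_stageE)
  then show False using base_notin_simplices[of a b J] assms(2) unfolding simplices_eq by auto
qed

lemma stage_Suc:
  assumes J: "J < l" and k: "2 * k + 3 \<le> J"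
  shows "stage J (Suc k) = (stage J k - simplices l (k + 1) (J - k))
    \<union> simplices l (k + 1) (k + 2) \<union> simplices l (k + 2) (J - k - 1) \<union> simplices l (J - k - 1) (J - k)"
proof -
  let ?S = "simplices l (k + 1) (J - k) :: (real, 'n) vec set set"
  let ?O = "\<Union>j\<in>{1..k + 1} \<union> {J - k + 1..J}. simplices l (j - 1) j :: (real, 'n) vec set set"
  have "?O \<inter> ?S = {}"
  proof -
    have "simplices l (j - 1) j \<inter> ?S = {}" if "j \<in> {1..k + 1} \<union> {J - k + 1..J}" for j
      by (rule simplices_disjoint) (use that k in \<open>auto simp: doubleton_eq_iff\<close>)
    then show ?thesis by blast
  qed
  moreover have "base_simplex l J \<notin> ?S" using J k by (intro base_notin_simplices) auto
  ultimately have 1: "stage J k - ?S = ?O \<union> {base_simplex l J}"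
    unfolding stage_def inner_stage_def by blast
  have idx: "{1..Suc k + 1} \<union> {J - Suc k + 1..J} = ({1..k + 1} \<union> {J - k + 1..J}) \<union> {k + 2, J - k}"
    using k by auto
  have "inner_stage J (Suc k) = ?O \<union> simplices l (k + 1) (k + 2) \<union> simplices l (J - k - 1) (J - k)
      \<union> simplices l (k + 2) (J - k - 1)"
    unfolding inner_stage_def idx by (simp add: Un_ac)
  then show ?thesis unfolding stage_def 1[unfolded stage_def] by blast
qed

lemma gens_eq_stage:
  assumes J: "int J * \<rho> < int l" and k: "2 * k + 1 \<le> J"
  shows "J = nu l CARD('n) \<Longrightarrow> (gens_one l k :: (real, 'n) vec set set) = stage J k"
    and "J + 1 = nu l CARD('n) \<Longrightarrow> (gens_zero l k :: (real, 'n) vec set set) = stage J k"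
proof -
  note Jl = J_less[OF J]
  have 0: "stage J 0 = simplices l 0 1 \<union> simplices l 1 J \<union> {base_simplex l J}"
    by (simp add: stage_def inner_stage_def)
  show "(gens_one l k :: (real, 'n) vec set set) = stage J k" if "J = nu l CARD('n)"
    using k
  proof (induction k)
    case 0
    then show ?case using \<open>stage J 0 = _\<close> that by (simp add: Let_def)
  next
    case (Suc k)
    have e: "J - Suc k + 1 = J - k" "J - Suc k = J - k - 1" using Suc.prems by auto
    have "(gens_one l (Suc k) :: (real, 'n) vec set set) = (gens_one l k - simplices l (Suc k) (J - Suc k + 1)) \<union> simplices l (Suc k) (Suc k + 1)
       \<union> simplices l (Suc k + 1) (J - Suc k) \<union> simplices l (J - Suc k) (J - Suc k + 1)"
      by (simp add: Let_def that)
    also have "\<dots> = stage J (Suc k)"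
      using Suc stage_Suc[OF Jl, of k] unfolding e(1) unfolding e(2) by simp
    finally show ?case .
  qed
  show "(gens_zero l k :: (real, 'n) vec set set) = stage J k" if "J + 1 = nu l CARD('n)"
    using k
  proof (induction k)
    case 0
    then show ?case using \<open>stage J 0 = _\<close> by (simp add: Let_def flip: that)
  next
    case (Suc k)
    have e: "J + 1 - Suc k = J - k" by simp
    have "(gens_zero l (Suc k) :: (real, 'n) vec set set) = (gens_zero l k - simplices l (Suc k) (J + 1 - Suc k)) \<union> simplices l (Suc k) (Suc k + 1)
       \<union> simplices l (Suc k + 1) (J + 1 - Suc k - 1) \<union> simplices l (J + 1 - Suc k - 1) (J + 1 - Suc k)"
      unfolding that by (simp add: Let_def)
    also have "\<dots> = stage J (Suc k)"
      using Suc stage_Suc[OF Jl, of k] unfolding e by simp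
    finally show ?case .
  qed
qed

text \<open>At the end the remaining interval is a unit interval or, for odd J, a point. In the
  latter case its simplices are faces of neighbouring ones, so only the complexes agree, not the
  generating sets.\<close>

lemma complex_of_inner_stage:
  assumes "2 * k + 1 \<le> J" "J \<le> 2 * k + 2"
  shows "complex_of (inner_stage J k \<union> E) = complex_of ((\<Union>j\<in>{1..J}. simplices l (j - 1) j) \<union> E)"
proof -
  let ?G = "(\<Union>j\<in>{1..J}. simplices l (j - 1) j) \<union> E"
  consider "J = 2 * k + 2" | "J = 2 * k + 1" using assms by linarith
  then show ?thesis
  proof cases
    case 1
    then have J: "J - k = k + 2" "{1..J} = ({1..k + 1} \<union> {J - k + 1..J}) \<union> {k + 2}" by auto
    have "inner_stage J k \<union> E = ?G" unfolding inner_stage_def J(2) J(1) by (simp add: Un_ac)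
    then show ?thesis by simp
  next
    case 2
    then have J: "J - k = k + 1" "{1..J} = {1..k + 1} \<union> {J - k + 1..J}" by auto
    have "inner_stage J k \<union> E = ?G \<union> simplices l (k + 1) (k + 1)"
      unfolding inner_stage_def J(2) J(1) by (simp add: Un_ac)
    moreover have "complex_of (?G \<union> simplices l (k + 1) (k + 1)) = complex_of ?G"
    proof (rule complex_of_absorb)
      fix A :: "(real, 'n) vec set" assume "A \<in> simplices l (k + 1) (k + 1)"
      then obtain p where p: "p \<noteq> L" "A = npt_simplex p (k + 1) (k + 1)" unfolding simplices_eq by blast
      then have "A \<subseteq> npt_simplex p k (k + 1)" by (auto simp: npt_simplex_def)
      moreover have "npt_simplex p k (k + 1) \<in> simplices l (k + 1 - 1) (k + 1)"
        using p(1) by (auto simp: simplices_eq)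
      moreover have "k + 1 \<in> {1..J}" using assms by auto
      ultimately show "\<exists>B\<in>?G. A \<subseteq> B" by blast
    qed
    ultimately show ?thesis by simp
  qed
qed

section \<open>Blow-ups of the stages\<close>

definition charts :: "(real, 'n) vec set set \<Rightarrow> 'n ratfun set set" where
  "charts G = (\<Union>A\<in>G. chart A)"

lemma charts_Un: "charts (G \<union> H) = charts G \<union> charts H"
  by (auto simp: charts_def)

lemma point_blowup_charts: "point_blowup T (charts G) = (\<Union>A\<in>G. point_blowup T (chart A))"
  unfolding charts_def by (rule point_blowup_UN)

lemma has_dual_vectors_simplices:
  "(A :: (real, 'n) vec set) \<in> simplices l a b \<Longrightarrow> a \<le> b \<Longrightarrow> has_dual_vectors (N_G l) A"
  using has_dual_vectors_npt_simplex unfolding simplices_eq by blast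

lemma has_dual_vectors_inner_stage:
  assumes "2 * k + 1 \<le> J" "A \<in> inner_stage J k"
  shows "has_dual_vectors (N_G l) A"
  using assms(2,1) by (rule inner_stageE) (simp add: has_dual_vectors_npt_simplex)

lemma has_dual_vectors_stage:
  assumes "int J * \<rho> < int l" "2 * k + 1 \<le> J" "A \<in> stage J k"
  shows "has_dual_vectors (N_G l) A"
  using assms(3) has_dual_vectors_inner_stage[OF assms(2)] has_dual_vectors_base[OF assms(1)]
  unfolding stage_def by blast

lemma point_blowup_Un: "point_blowup T (X \<union> Y) = point_blowup T X \<union> point_blowup T Y"
  by (simp add: point_blowup_def)

lemma blowup_origin:
  assumes "1 \<le> J" "star_subdivision (N_G l) units units (origin_pieces J yD)"
  shows "point_blowup (stalk units) (chart units) = charts (stage J 0)"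
proof -
  have "point_blowup (stalk units) (chart units)
      = (\<Union>(v, B)\<in>origin_pieces J yD. chart B)"
    by (rule point_blowup_star_subdivision[OF subset_refl assms(2)])
  also have "\<dots> = charts (stage J 0)"
    unfolding origin_pieces_def charts_def stage_def inner_stage_def simplices_eq by simp
  finally show ?thesis .
qed

text \<open>Only the simplices over the remaining interval contain both vertices of the center; each
  other chart carries a character showing that the center misses it.\<close>

lemma blowup_stage:
  assumes J: "int J * \<rho> < int l" and k: "2 * k + 3 \<le> J"
  shows "point_blowup (stalk {npt l (k + 1), npt l (J - k)}) (charts (stage J k)) = charts (stage J (Suc k))"
proof -
  let ?T = "{npt l (k + 1), npt l (J - k)} :: (real, 'n) vec set"
  let ?S = "simplices l (k + 1) (J - k) :: (real, 'n) vec set set"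
  note Jl = J_less[OF J]
  have st: "stage J k = (stage J k - ?S) \<union> ?S" unfolding stage_def inner_stage_def by blast
  have away: "\<exists>m\<in>D A. \<exists>t\<in>?T. pairing m t < 0" if A: "A \<in> stage J k - ?S" for A
  proof -
    consider "A = base_simplex l J" | j where "j \<in> {1..k + 1} \<union> {J - k + 1..J}" "A \<in> simplices l (j - 1) j"
      using A unfolding stage_def inner_stage_def by blast
    then show ?thesis
    proof cases
      case 1
      then show ?thesis using base_away[OF J, of "k + 1" "J - k"] k by simp
    next
      case 2
      then obtain p where p: "p \<noteq> L" "A = npt_simplex p (j - 1) j" unfolding simplices_eq by blast
      show ?thesis unfolding p(2) by (rule npt_simplex_away[OF p(1)]) (use 2(1) k in auto)
    qed
  qed
  have "point_blowup (stalk ?T) (chart A) = chart A"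
    if "A \<in> stage J k - ?S" for A
    using away[OF that] point_blowup_away[of ?T] by (metis finite.emptyI finite.insertI)
  then have 1: "point_blowup (stalk ?T) (charts (stage J k - ?S)) = charts (stage J k - ?S)"
    unfolding point_blowup_charts by (simp add: charts_def)
  have "point_blowup (stalk ?T) (chart (npt_simplex p (k + 1) (J - k)))
      = chart (npt_simplex p (k + 1) (k + 2)) \<union> chart (npt_simplex p (k + 2) (J - k - 1))
        \<union> chart (npt_simplex p (J - k - 1) (J - k))" if p: "p \<noteq> L" for p
  proof -
    have "?T \<subseteq> npt_simplex p (k + 1) (J - k)" by (auto simp: npt_simplex_def)
    moreover have "k + 1 + 2 \<le> J - k" using k by simp
    ultimately show ?thesis
      using point_blowup_star_subdivision[OF _ star_subdivision_segment[OF p]] by (simp add: Un_assoc)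
  qed
  note piece = this
  have "point_blowup (stalk ?T) (charts ?S) = (\<Union>p\<in>-{L}.
      point_blowup (stalk ?T) (chart (npt_simplex p (k + 1) (J - k))))"
    unfolding point_blowup_charts simplices_eq by blast
  also have "\<dots> = (\<Union>p\<in>-{L}. chart (npt_simplex p (k + 1) (k + 2))
      \<union> chart (npt_simplex p (k + 2) (J - k - 1)) \<union> chart (npt_simplex p (J - k - 1) (J - k)))"
    by (rule SUP_cong[OF refl]) (rule piece, blast)
  also have "\<dots> = charts (simplices l (k + 1) (k + 2) \<union> simplices l (k + 2) (J - k - 1) \<union> simplices l (J - k - 1) (J - k))"
    unfolding charts_def simplices_eq by blast
  finally have 2: "point_blowup (stalk ?T) (charts ?S)
      = charts (simplices l (k + 1) (k + 2) \<union> simplices l (k + 2) (J - k - 1) \<union> simplices l (J - k - 1) (J - k))" .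
  have "point_blowup (stalk ?T) (charts (stage J k))
      = point_blowup (stalk ?T) (charts (stage J k - ?S)) \<union> point_blowup (stalk ?T) (charts ?S)"
    by (subst st) (simp only: point_blowup_charts UN_Un)
  then show ?thesis unfolding 1 2 stage_Suc[OF Jl k] by (simp only: charts_Un Un_assoc)
qed

lemma blowup_base:
  assumes l: "int l = \<rho> * (int J + 1)" and k: "2 * k + 1 \<le> J"
  shows "point_blowup (stalk base_units) (charts (stage J k))
    = charts ((stage J k - {base_simplex l J}) \<union> simplices l J (J + 1))"
proof -
  have J: "int J * \<rho> < int l" using l \<rho>_pos by (simp add: algebra_simps)
  have bound: "int b * \<rho> < int l" if "b \<le> J" for b
  proof -
    have "int b * \<rho> \<le> int J * \<rho>" using that \<rho>_pos by (intro mult_right_mono) auto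
    then show ?thesis using J by simp
  qed
  have st: "stage J k - {base_simplex l J} = inner_stage J k"
    using base_notin_inner_stage[OF k J_less[OF J]] by (auto simp: stage_def)
  have "point_blowup (stalk base_units) (chart A) = chart A"
    if A: "A \<in> inner_stage J k" for A
  proof -
    obtain p a b where p: "p \<noteq> L" "A = npt_simplex p a b" "a \<le> b" "b \<le> J"
      using A k by (rule inner_stageE)
    obtain m t where "m \<in> D A" "t \<in> base_units" "pairing m t < 0"
      using npt_simplex_away_base_units[OF p(1,3) bound[OF p(4)]] p(2) by blast
    then show ?thesis by (intro point_blowup_away[of base_units]) auto
  qed
  then have 1: "point_blowup (stalk base_units) (charts (inner_stage J k)) = charts (inner_stage J k)"
    unfolding point_blowup_charts by (simp add: charts_def)
  have "base_units \<subseteq> base_simplex l J" by (auto simp: base_simplex_def)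
  then have "point_blowup (stalk base_units) (chart (base_simplex l J))
      = charts (simplices l J (J + 1))"
    using point_blowup_star_subdivision[OF _ star_subdivision_base[OF l]]
    by (simp add: charts_def simplices_eq)
  then show ?thesis
    unfolding st using 1 by (simp add: stage_def charts_def point_blowup_Un Un_commute)
qed


section \<open>Refinement of the fans\<close>

abbreviation X :: "nat \<Rightarrow> 'n ratfun set set" where "X \<equiv> X_seq l"
abbreviation fan :: "nat \<Rightarrow> (real, 'n) vec set set" where "fan \<equiv> fan_seq l"
abbreviation full :: "(real, 'n) vec set set" where "full \<equiv> full_triangulation l"
abbreviation faces :: "(real, 'n) vec set set" where "faces \<equiv> \<Delta>_G"

lemma npt_between:
  assumes "a \<le> c" "c \<le> b"
  shows "npt l c \<in> pos (npt_simplex p a b)"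
proof (cases "a = b")
  case True
  then show ?thesis using assms pos_inc[of "npt_simplex p a b"] by (auto simp: npt_simplex_def)
next
  case False
  then have ab: "0 < real b - real a" using assms by simp
  define t where "t = (real c - real a) / (real b - real a)"
  define s where "s = 1 - t"
  have "t * (real b - real a) = real c - real a" using ab by (simp add: t_def)
  then have st: "s + t = 1" "s * real a + t * real b = real c" by (simp_all add: s_def algebra_simps)
  have "0 \<le> t" "t \<le> 1" using ab assms by (simp_all add: t_def)
  then have st': "0 \<le> s" "0 \<le> t" by (simp_all add: s_def)
  have "npt l c = s *\<^sub>R npt l a + t *\<^sub>R (npt l b :: (real, 'n) vec)"
  proof (rule vec_eq_iff[THEN iffD2, rule_format])
    fix i :: 'n
    have "s * (real l - real a * (real r - 1)) + t * (real l - real b * (real r - 1))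
        = (s + t) * real l - (s * real a + t * real b) * (real r - 1)" by (simp only: algebra_simps)
    then have "s * (real l - real a * (real r - 1)) + t * (real l - real b * (real r - 1))
        = real l - real c * (real r - 1)" unfolding st by simp
    then show "npt l c $ i = (s *\<^sub>R npt l a + t *\<^sub>R (npt l b :: (real, 'n) vec)) $ i"
      using st(2) by (cases "i = L") (simp_all add: npt_def r[symmetric] flip: add_divide_distrib)
  qed
  moreover have "npt l a \<in> pos (npt_simplex p a b)" "npt l b \<in> pos (npt_simplex p a b)"
    using pos_inc[of "npt_simplex p a b"] by (auto simp: npt_simplex_def)
  ultimately show ?thesis
    using st' by (auto intro!: convex_cone_add convex_cone_scaleR convex_cone_pos)
qed

lemma npt_simplex_between:
  assumes "a \<le> c" "c \<le> d" "d \<le> b"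
  shows "npt_simplex p c d \<subseteq> pos (npt_simplex p a b)"
proof -
  have "unit_vec ` (- {L, p}) \<subseteq> pos (npt_simplex p a b)"
    using pos_inc[of "npt_simplex p a b"] by (auto simp: npt_simplex_def)
  moreover have "npt l c \<in> pos (npt_simplex p a b)" "npt l d \<in> pos (npt_simplex p a b)"
    using assms by (auto intro: npt_between)
  ultimately show ?thesis by (auto simp: npt_simplex_def[of p c d])
qed

lemma vec_in_pos:
  assumes "\<And>i. 0 \<le> u $ i" "\<And>i. u $ i \<noteq> 0 \<Longrightarrow> unit_vec i \<in> pos A"
  shows "(u :: (real, 'n) vec) \<in> pos A"
proof -
  have "u = (\<Sum>i\<in>UNIV. u $ i *\<^sub>R unit_vec i)"
    by (rule vec_eq_iff[THEN iffD2, rule_format])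
      (simp add: unit_vec_def axis_def if_distrib cong: if_cong)
  also have "\<dots> \<in> pos A"
  proof (rule pos_sum)
    fix i
    show "u $ i *\<^sub>R unit_vec i \<in> pos A"
      using convex_cone_scaleR[OF convex_cone_pos assms(1,2)] convex_cone_contains_0[OF convex_cone_pos]
      by (cases "u $ i = 0") simp_all
  qed
  finally show ?thesis .
qed

lemma npt_nonneg:
  assumes "int j * \<rho> \<le> int l"
  shows "0 \<le> (npt l j :: (real, 'n) vec) $ i"
proof -
  have "real_of_int (int j * \<rho>) \<le> real_of_int (int l)" using assms by (simp only: of_int_le_iff)
  then show ?thesis by (simp add: npt_def r[symmetric])
qed

lemma stage_in_units:
  assumes "int J * \<rho> < int l" "A \<in> stage J 0" "1 \<le> J"
  shows "A \<subseteq> pos units"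
proof -
  have u: "unit_vec i \<in> pos units" for i :: 'n using pos_inc[of units] by auto
  have n: "npt l j \<in> pos units" if "j \<le> J" for j
  proof (rule vec_in_pos)
    have "int j * \<rho> \<le> int J * \<rho>" using that \<rho>_pos by (intro mult_right_mono) auto
    then show "0 \<le> (npt l j :: (real, 'n) vec) $ i" for i using assms(1) by (intro npt_nonneg) simp
  qed (rule u)
  consider "A = base_simplex l J" | "A \<in> inner_stage J 0" using assms(2) by (auto simp: stage_def)
  then show ?thesis
  proof cases
    case 1
    then show ?thesis using u n by (auto simp: base_simplex_def)
  next
    case 2
    then obtain p a b where "A = npt_simplex p a b" "a \<le> b" "b \<le> J"
      using assms(3) by (auto elim!: inner_stageE)
    then show ?thesis using u n by (auto simp: npt_simplex_def)
  qed
qed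

text \<open>The last coordinate of \<open>npt l (J + 1)\<close> is zero, so this point lies in the
  cone over the other basis vectors.\<close>

lemma base_cover:
  assumes "int l = \<rho> * (int J + 1)"
  shows "npt_simplex p J (J + 1) \<subseteq> pos (base_simplex l J)"
proof -
  have u: "unit_vec i \<in> pos (base_simplex l J)" if "i \<noteq> L" for i :: 'n
    using pos_inc[of "base_simplex l J :: (real, 'n) vec set"] that by (auto simp: base_simplex_def)
  have "npt l J \<in> pos (base_simplex l J :: (real, 'n) vec set)"
    using pos_inc[of "base_simplex l J :: (real, 'n) vec set"] by (auto simp: base_simplex_def)
  moreover have "npt l (J + 1) \<in> pos (base_simplex l J :: (real, 'n) vec set)"
  proof (rule vec_in_pos)
    show "0 \<le> (npt l (J + 1) :: (real, 'n) vec) $ i" for i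
      using assms by (intro npt_nonneg) (simp add: algebra_simps)
    have "real_of_int (int l) = real_of_int (\<rho> * (int J + 1))" using assms by (simp only:)
    then have "(npt l (J + 1) :: (real, 'n) vec) $ L = 0"
      by (simp add: npt_def r[symmetric] mult.commute)
    then show "unit_vec i \<in> pos (base_simplex l J)" if "(npt l (J + 1) :: (real, 'n) vec) $ i \<noteq> 0" for i
      using that by (intro u) auto
  qed
  ultimately show ?thesis using u by (auto simp: npt_simplex_def)
qed

lemma stage_cover:
  assumes J: "J < l" "2 * k + 3 \<le> J" and A: "A \<in> stage J (Suc k)"
  shows "\<exists>B\<in>stage J k. A \<subseteq> pos B"
proof (cases "A \<in> stage J k")
  case True
  then show ?thesis using pos_inc by blast
next
  case False
  then have "A \<in> simplices l (k + 1) (k + 2) \<union> simplices l (k + 2) (J - k - 1) \<union> simplices l (J - k - 1) (J - k)"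
    using A unfolding stage_Suc[OF J] by blast
  then have "\<exists>c d. A \<in> simplices l c d \<and> k + 1 \<le> c \<and> c \<le> d \<and> d \<le> J - k"
  proof (elim UnE)
    assume "A \<in> simplices l (k + 1) (k + 2)"
    then show ?thesis using J(2) by (intro exI[of _ "k + 1"] exI[of _ "k + 2"]) auto
  next
    assume "A \<in> simplices l (k + 2) (J - k - 1)"
    then show ?thesis using J(2) by (intro exI[of _ "k + 2"] exI[of _ "J - k - 1"]) auto
  next
    assume "A \<in> simplices l (J - k - 1) (J - k)"
    then show ?thesis using J(2) by (intro exI[of _ "J - k - 1"] exI[of _ "J - k"]) auto
  qed
  then obtain p c d where p: "p \<noteq> L" "A = npt_simplex p c d" and cd: "k + 1 \<le> c" "c \<le> d" "d \<le> J - k"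
    unfolding simplices_eq by blast
  have "npt_simplex p (k + 1) (J - k) \<in> stage J k"
    using p(1) by (auto simp: stage_def inner_stage_def simplices_eq)
  then show ?thesis using npt_simplex_between[OF cd, of p] p(2) by blast
qed

section \<open>The two congruence cases and the sequence of varieties\<close>

definition gens_seq :: "nat \<Rightarrow> (real, 'n) vec set set" where
  "gens_seq i = (if case_one l r then stage (nu l r) (i - 1)
     else if i < kappa l r then stage (nu l r - 1) (i - 1)
     else (stage (nu l r - 1) (kappa l r - 2) - {base_simplex l (nu l r - 1)}) \<union> simplices l (nu l r - 1) (nu l r))"

lemma case_one_arith:
  assumes "case_one l r"
  shows "int (nu l r) * \<rho> = int l - 1" "int (nu l r) * \<rho> < int l" "1 \<le> nu l r"
    "kappa l r = (nu l r + 1) div 2"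
proof -
  have "(r - 1) dvd (l - 1)"
    using assms l_ge card_ge_2 mod_eq_dvd_iff_nat[of 1 l "r - 1"] unfolding case_one_def cong_def by simp
  then have e: "nu l r * (r - 1) = l - 1" using assms by (simp add: nu_def)
  then have "int (nu l r * (r - 1)) = int (l - 1)" by simp
  then show 1: "int (nu l r) * \<rho> = int l - 1" using card_ge_2 l_ge by (simp add: of_nat_diff)
  then show "int (nu l r) * \<rho> < int l" by simp
  show "1 \<le> nu l r" using e l_ge card_ge_2 by (cases "nu l r") auto
  show "kappa l r = (nu l r + 1) div 2" using assms by (simp add: kappa_def nu_def)
qed

lemma case_zero_arith:
  assumes "\<not> case_one l r" "l mod (r - 1) \<in> {0, 1}"
  shows "int l = \<rho> * (int (nu l r - 1) + 1)" "int (nu l r - 1) * \<rho> < int l" "2 \<le> nu l r"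
    "kappa l r = nu l r div 2 + 1"
proof -
  \<comment> \<open>For r = 2 every l satisfies \<open>case_one\<close>, so the second case has r
    \<ge> 3 and its residue is really 0.\<close>
  have r3: "2 \<le> r - 1"
  proof (rule ccontr)
    assume "\<not> ?thesis"
    then have "r - 1 = 1" using card_ge_2 by simp
    then show False using assms(1) by (simp add: case_one_def cong_def)
  qed
  then have "l mod (r - 1) \<noteq> 1" using assms(1) by (simp add: case_one_def cong_def)
  then have e: "nu l r * (r - 1) = l" using assms by (auto simp: nu_def)
  show nu2: "2 \<le> nu l r"
  proof (rule ccontr)
    assume "\<not> ?thesis"
    then consider "nu l r = 0" | "nu l r = 1" by linarith
    then show False using e l_ge card_ge_2 by cases auto
  qed
  have "int l = int (nu l r * (r - 1))" using e by simp
  then show 1: "int l = \<rho> * (int (nu l r - 1) + 1)" using nu2 card_ge_2 by (simp add: of_nat_diff)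
  then show "int (nu l r - 1) * \<rho> < int l" using \<rho>_pos by (simp add: algebra_simps)
  show "kappa l r = nu l r div 2 + 1" using assms(1) by (simp add: kappa_def nu_def)
qed

context
  assumes l_mod: "l mod (r - 1) \<in> {0, 1}"
begin

lemma triangulation_seq_eq:
  assumes "1 \<le> i" "i \<le> kappa l r"
  shows "triangulation_seq l i = complex_of (gens_seq i)"
proof (cases "case_one l r")
  case True
  note a = case_one_arith[OF True]
  have "2 * (i - 1) + 1 \<le> nu l r" using assms a(4) by auto
  then have "gens_one l (i - 1) = stage (nu l r) (i - 1)"
    by (rule gens_eq_stage(1)[OF a(2)]) (simp only: r)
  then show ?thesis using True by (simp only: triangulation_seq_def gens_seq_def Let_def r[symmetric] if_True)
next
  case False
  note a = case_zero_arith[OF False l_mod]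
  have nu: "nu l r - 1 + 1 = nu l CARD('n)" using a(3) by (simp add: r)
  show ?thesis
  proof (cases "i < kappa l r")
    case True
    then have "2 * (i - 1) + 1 \<le> nu l r - 1" using assms a(3,4) by auto
    then have "gens_zero l (i - 1) = stage (nu l r - 1) (i - 1)"
      by (rule gens_eq_stage(2)[OF a(2) _ nu])
    then show ?thesis using True False
      by (simp only: triangulation_seq_def gens_seq_def Let_def r[symmetric] if_True if_False)
  next
    case i: False
    have "2 * (kappa l r - 2) + 1 \<le> nu l r - 1" using a(3,4) by auto
    then have "gens_zero l (kappa l r - 2) = stage (nu l r - 1) (kappa l r - 2)"
      by (rule gens_eq_stage(2)[OF a(2) _ nu])
    then show ?thesis using i False
      by (simp only: triangulation_seq_def gens_seq_def Let_def r[symmetric] if_False)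
  qed
qed

text \<open>\<open>kappa\<close> is chosen so that 2 * k + 1 \<le> J \<le> 2 * k + 2 for the last
  segment stage: k = \<open>kappa\<close> - 1 and J = \<open>nu\<close> in the first case, k =
  \<open>kappa\<close> - 2 and J = \<open>nu\<close> - 1 in the second, which reserves one step for
  the base simplex.\<close>

lemma triangulation_seq_kappa: "triangulation_seq l (kappa l r) = full"
proof (cases "case_one l r")
  case True
  note a = case_one_arith[OF True]
  have "triangulation_seq l (kappa l r) = complex_of (gens_seq (kappa l r))"
    using a by (intro triangulation_seq_eq) auto
  also have "\<dots> = complex_of (inner_stage (nu l r) (kappa l r - 1) \<union> {base_simplex l (nu l r)})"
    using True by (simp add: gens_seq_def stage_def)
  also have "\<dots> = complex_of ((\<Union>j\<in>{1..nu l r}. simplices l (j - 1) j) \<union> {base_simplex l (nu l r)})"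
    by (rule complex_of_inner_stage) (use a(3,4) in auto)
  finally show ?thesis using True by (simp add: full_triangulation_def Let_def r[symmetric])
next
  case False
  note a = case_zero_arith[OF False l_mod]
  define J where "J = nu l r - 1"
  have J: "nu l r = J + 1" using a(3) by (simp add: J_def)
  have k: "2 * (kappa l r - 2) + 1 \<le> J" "J \<le> 2 * (kappa l r - 2) + 2" using a(3,4) J by auto
  have "triangulation_seq l (kappa l r) = complex_of (gens_seq (kappa l r))"
    using a by (intro triangulation_seq_eq) auto
  also have "gens_seq (kappa l r) = inner_stage J (kappa l r - 2) \<union> simplices l J (J + 1)"
    using False base_notin_inner_stage[OF k(1) J_less[OF a(2), folded J_def]]
    by (simp add: gens_seq_def stage_def J)
  also have "complex_of \<dots> = complex_of ((\<Union>j\<in>{1..J}. simplices l (j - 1) j) \<union> simplices l J (J + 1))"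
    by (rule complex_of_inner_stage[OF k])
  also have "(\<Union>j\<in>{1..J}. simplices l (j - 1) j) \<union> simplices l J (J + 1)
      = (\<Union>j\<in>{1..J + 1}. simplices l (j - 1) j :: (real, 'n) vec set set)"
    by (simp add: atLeastAtMostSuc_conv Un_commute)
  finally show ?thesis using False by (simp add: full_triangulation_def Let_def r[symmetric] J)
qed

lemma fan_seq_eq:
  assumes "1 \<le> i" "i \<le> kappa l r"
  shows "fan i = fan_of (complex_of (gens_seq i))"
  using assms triangulation_seq_eq[OF assms] triangulation_seq_kappa
  by (auto simp: fan_seq_def r[symmetric])

lemma has_dual_vectors_gens_seq:
  assumes "1 \<le> i" "i \<le> kappa l r" "A \<in> gens_seq i"
  shows "has_dual_vectors (N_G l) A"
proof (cases "case_one l r")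
  case True
  note a = case_one_arith[OF True]
  show ?thesis
    using assms True a(4) by (intro has_dual_vectors_stage[OF a(2), of "i - 1"]) (auto simp: gens_seq_def)
next
  case False
  note a = case_zero_arith[OF False l_mod]
  show ?thesis
  proof (cases "i < kappa l r")
    case True
    then have "2 * (i - 1) + 1 \<le> nu l r - 1" using assms a(3,4) by auto
    moreover have "A \<in> stage (nu l r - 1) (i - 1)" using assms(3) True False by (simp only: gens_seq_def if_True if_False)
    ultimately show ?thesis by (rule has_dual_vectors_stage[OF a(2)])
  next
    case i: False
    then have "A \<in> stage (nu l r - 1) (kappa l r - 2) \<or> A \<in> simplices l (nu l r - 1) (nu l r)"
      using assms(3) False by (simp only: gens_seq_def if_False) blast
    moreover have "2 * (kappa l r - 2) + 1 \<le> nu l r - 1" using a(3,4) by auto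
    ultimately show ?thesis
      using has_dual_vectors_stage[OF a(2)] has_dual_vectors_simplices[of A "nu l r - 1" "nu l r"] by auto
  qed
qed

lemma X_seq_eq:
  assumes "1 \<le> i" "i \<le> kappa l r"
  shows "X i = charts (gens_seq i)"
  unfolding X_seq_def fan_seq_eq[OF assms] charts_def
  using has_dual_vectors_gens_seq[OF assms] by (rule toric_variety_complex)

lemma toric_variety_Delta: "toric_variety (N_G l) faces = chart units"
proof -
  have "toric_variety (N_G l) faces = (\<Union>B\<in>Pow units. chart B)"
    unfolding toric_variety_def \<Delta>_G_def affine_toric_pos[symmetric] by blast
  also have "\<dots> = chart units"
    using affine_chart_face[OF has_dual_vectors_units] by blast
  finally show ?thesis .
qed

lemma X_seq_0: "X 0 = chart units"
  by (simp add: X_seq_def fan_seq_def toric_variety_Delta)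

lemma blowup_red_center:
  assumes "1 \<le> i" "i \<le> kappa l r" "finite T" "A \<in> gens_seq i" "T \<subseteq> A"
    and "center l i = orbit_closure (N_G l) (fan i) (pos T)"
  shows "blowup_red (center l i) (X i) = point_blowup (stalk T) (X i)"
  unfolding assms(6)
  by (rule blowup_red_orbit_closure[OF assms(3)])
    (simp_all add: X_seq_def fan_seq_eq[OF assms(1,2)] pos_face_mem_fan[OF assms(5,4)])

text \<open>The existential T hides the shape of the center: separatedness and the morphisms only
  need that each step blows up the closure of a point.\<close>

lemma blowup_step:
  assumes i: "i < kappa l r"
  shows "\<exists>T. blowup_red (center l i) (X i) = point_blowup (stalk T) (X i)
    \<and> point_blowup (stalk T) (X i) = X (i + 1)"
proof (cases "i = 0")
  case True
  have "center l 0 = orb (N_G l) (pos units)" by (simp add: center_def \<sigma>0_def Let_def)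
  then have "blowup_red (center l 0) (X 0) = point_blowup (stalk units) (X 0)"
    by (simp add: blowup_red_orb)
  moreover have "point_blowup (stalk units) (X 0) = X 1"
  proof (cases "case_one l r")
    case c: True
    note a = case_one_arith[OF c]
    have "gens_seq 1 = stage (nu l r) 0" using c by (simp add: gens_seq_def)
    then show ?thesis
      using blowup_origin[OF a(3) star_subdivision_origin_one[OF a(3,1)]] X_seq_eq[of 1] i True
      by (simp add: X_seq_0)
  next
    case c: False
    note a = case_zero_arith[OF c l_mod]
    have J: "1 \<le> nu l r - 1" using a(3) by simp
    have "gens_seq 1 = stage (nu l r - 1) 0" using c a(3,4) by (simp add: gens_seq_def)
    then show ?thesis
      using blowup_origin[OF J star_subdivision_origin_zero[OF J a(1)]] X_seq_eq[of 1] i True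
      by (simp add: X_seq_0)
  qed
  ultimately show ?thesis using True by auto
next
  case i0: False
  define k where "k = i - 1"
  have ik: "i = k + 1" using i0 by (simp add: k_def)
  \<comment> \<open>Common to both congruence cases, with J = \<open>nu\<close> or J =
    \<open>nu - 1\<close>; the center is spanned by the ends of the remaining interval.\<close>
  have segment: "\<exists>T. blowup_red (center l i) (X i) = point_blowup (stalk T) (X i)
    \<and> point_blowup (stalk T) (X i) = X (i + 1)"
    if J: "int J * \<rho> < int l" "2 * k + 3 \<le> J" and g: "gens_seq i = stage J k" "gens_seq (i + 1) = stage J (Suc k)"
      and c: "center l i = orbit_closure (N_G l) (fan i)
        (pos ({npt l (k + 1), npt l (J - k)} :: (real, 'n) vec set))" for J
  proof -
    obtain p :: 'n where p: "p \<noteq> L" using other_index by blast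
    have "blowup_red (center l i) (X i)
        = point_blowup (stalk {npt l (k + 1), npt l (J - k)}) (X i)"
    proof (rule blowup_red_center[OF _ _ _ _ _ c])
      show "npt_simplex p (k + 1) (J - k) \<in> gens_seq i"
        using p by (auto simp: g stage_def inner_stage_def simplices_eq)
    qed (use i ik in \<open>auto simp: npt_simplex_def\<close>)
    moreover have "point_blowup (stalk {npt l (k + 1), npt l (J - k)}) (X i) = X (i + 1)"
      using blowup_stage[OF J] X_seq_eq[of i] X_seq_eq[of "i + 1"] i ik g by simp
    ultimately show ?thesis by blast
  qed
  show ?thesis
  proof (cases "case_one l r")
    case c: True
    note a = case_one_arith[OF c]
    have "nu l r - i + 1 = nu l r - k" using i a(4) ik by auto
    then show ?thesis
      using c i a(4) ik by (intro segment[OF a(2)]) (auto simp: gens_seq_def center_def Let_def r[symmetric])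
  next
    case c: False
    note a = case_zero_arith[OF c l_mod]
    show ?thesis
    proof (cases "i < kappa l r - 1")
      case True
      have "nu l r - i = nu l r - 1 - k" using ik by simp
      then show ?thesis
        using c True a(3,4) ik by (intro segment[OF a(2)]) (auto simp: gens_seq_def center_def Let_def r[symmetric])
    next
      case False
      then have k: "i = kappa l r - 1" "k = kappa l r - 2" using i ik by auto
      have center: "center l i = orbit_closure (N_G l) (fan i) (pos base_units)"
        using c False i0 by (simp add: center_def Let_def r[symmetric])
      have g: "gens_seq i = stage (nu l r - 1) k" using c i ik by (simp add: gens_seq_def)
      have g': "gens_seq (i + 1) = (stage (nu l r - 1) k - {base_simplex l (nu l r - 1)})
          \<union> simplices l (nu l r - 1) (nu l r - 1 + 1)"
        using c k i a(3) by (simp add: gens_seq_def)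
      have k2: "2 * k + 1 \<le> nu l r - 1" using k a(3,4) by auto
      have "blowup_red (center l i) (X i) = point_blowup (stalk base_units) (X i)"
      proof (rule blowup_red_center[OF _ _ _ _ _ center])
        show "base_simplex l (nu l r - 1) \<in> gens_seq i" by (simp add: g stage_def)
      qed (use i ik in \<open>auto simp: base_simplex_def\<close>)
      moreover have "point_blowup (stalk base_units) (X i) = X (i + 1)"
        using blowup_base[OF a(1) k2] X_seq_eq[of i] X_seq_eq[of "i + 1"] i ik g g' by simp
      ultimately show ?thesis by blast
    qed
  qed
qed

lemma toric_compatible_step:
  assumes i: "i < kappa l r"
  shows "toric_compatible (fan (i + 1)) (fan i)"
proof (cases "i = 0")
  case True
  have "\<exists>J. gens_seq 1 = stage J 0 \<and> int J * \<rho> < int l \<and> 1 \<le> J"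
  proof (cases "case_one l r")
    case True
    then show ?thesis using case_one_arith[OF True] by (auto simp: gens_seq_def)
  next
    case False
    have "gens_seq 1 = stage (nu l r - 1) 0" "1 \<le> nu l r - 1"
      using False case_zero_arith[OF False l_mod] by (auto simp: gens_seq_def)
    then show ?thesis using case_zero_arith[OF False l_mod] by blast
  qed
  then have "A \<subseteq> pos units" if "A \<in> gens_seq 1" for A using stage_in_units that by auto
  moreover have "pos units \<in> fan 0" by (auto simp: fan_seq_def \<Delta>_G_def)
  ultimately have "toric_compatible (fan_of (complex_of (gens_seq 1))) (fan 0)"
    by (intro toric_compatible_complex) (use convex_cone_pos in blast)
  then show ?thesis using True i fan_seq_eq[of 1] by simp
next
  case i0: False
  define k where "k = i - 1"
  have ik: "i = k + 1" using i0 by (simp add: k_def)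
  have "\<exists>B\<in>gens_seq i. A \<subseteq> pos B" if A: "A \<in> gens_seq (i + 1)" for A
  proof (cases "case_one l r")
    case c: True
    note a = case_one_arith[OF c]
    show ?thesis
      using stage_cover[OF J_less[OF a(2)], of k A] c A ik i a(4) by (simp add: gens_seq_def)
  next
    case c: False
    note a = case_zero_arith[OF c l_mod]
    show ?thesis
    proof (cases "i + 1 < kappa l r")
      case True
      then show ?thesis
        using stage_cover[OF J_less[OF a(2)], of k A] c A ik a(3,4) by (simp add: gens_seq_def)
    next
      case False
      then have k: "k = kappa l r - 2" using i ik by auto
      have g: "gens_seq i = stage (nu l r - 1) k" using c i ik by (simp add: gens_seq_def)
      have "A \<in> stage (nu l r - 1) k \<or> A \<in> simplices l (nu l r - 1) (nu l r - 1 + 1)"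
        using A c False k a(3) by (auto simp: gens_seq_def)
      then show ?thesis
      proof
        assume "A \<in> stage (nu l r - 1) k"
        then show ?thesis using pos_inc g by blast
      next
        assume "A \<in> simplices l (nu l r - 1) (nu l r - 1 + 1)"
        then have "A \<subseteq> pos (base_simplex l (nu l r - 1))"
          unfolding simplices_eq using base_cover[OF a(1)] by blast
        then show ?thesis unfolding g by (auto simp: stage_def)
      qed
    qed
  qed
  moreover have "pos B \<in> fan_of (complex_of (gens_seq i))" if "B \<in> gens_seq i" for B
    using that by (intro pos_face_mem_fan) auto
  ultimately have "toric_compatible (fan_of (complex_of (gens_seq (i + 1)))) (fan_of (complex_of (gens_seq i)))"
    by (intro toric_compatible_complex) (use convex_cone_pos in blast)
  then show ?thesis using i ik fan_seq_eq[of i] fan_seq_eq[of "i + 1"] by simp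
qed

lemma generization_closed_X_seq: "generization_closed (X i)"
  unfolding X_seq_def by (rule generization_closed_toric)

text \<open>Separatedness is inherited along the blow-ups from the affine variety
  \<open>X 0\<close>, which replaces a proof that the cones of each fan meet in common
  faces.\<close>

lemma separated_X_seq: "i \<le> kappa l r \<Longrightarrow> separated (X i)"
proof (induction i)
  case 0
  show ?case
    unfolding X_seq_0 affine_chart_def
    by (rule separated_Spec[OF unital_subring_semigroup_algebra[OF submonoid_dual_semigroup]])
next
  case (Suc i)
  then obtain T where T: "point_blowup (stalk T) (X i) = X (i + 1)"
    using blowup_step[of i] by auto
  have "separated (point_blowup (stalk T) (X i))"
    using Suc by (intro separated_point_blowup[OF generization_closed_X_seq _ face_stalk(2)]) auto
  then show ?case using T by simp
qed

lemma birational_morphism_X_seq: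
  assumes "i < kappa l r"
  shows "birational_morphism (X (i + 1)) (X i)"
proof -
  obtain T where T: "point_blowup (stalk T) (X i) = X (i + 1)"
    using blowup_step[OF assms] by auto
  have "birational_morphism (point_blowup (stalk T) (X i)) (X i)"
    using assms by (intro birational_morphism_point_blowup[OF generization_closed_X_seq separated_X_seq face_stalk(2)]) simp
  then show ?thesis using T by simp
qed

text \<open>The reduced blow-up is already the toric variety of the next fan, whose local rings are
  integrally closed; normalization changes nothing.\<close>

lemma X_seq_blowup:
  assumes "i < kappa l r"
  shows "X (i + 1) = normalization (blowup_red (center l i) (X i))"
proof -
  have "blowup_red (center l i) (X i) = X (i + 1)"
    using blowup_step[OF assms] by metis
  moreover have "normalization (X (i + 1)) = X (i + 1)"
    by (rule normalization_normal[OF generization_closed_X_seq]) (rule toric_variety_normal, simp add: X_seq_def)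
  ultimately show ?thesis by simp
qed

lemma X_seq_kappa: "X (kappa l r) = toric_variety (N_G l) (fan_of full)"
proof -
  have "kappa l r \<noteq> 0"
    using case_one_arith(3,4) case_zero_arith(4)[OF _ l_mod] by (cases "case_one l r") auto
  then show ?thesis by (simp add: X_seq_def fan_seq_def r[symmetric])
qed

text \<open>The composite sends S to a member of \<open>X 0\<close> dominated by S, and
  separatedness of \<open>X 0\<close> leaves only one such member.\<close>

lemma birational_map_composite:
  assumes "S \<in> toric_variety (N_G l) (fan_of full)"
  shows "\<exists>!R. R \<in> toric_variety (N_G l) faces \<and> dominates S R"
    "birational_map (toric_variety (N_G l) faces) S
      = foldr (\<circ>) (map (\<lambda>i. birational_map (X (i - 1))) [1..<kappa l r + 1]) id S"
proof -
  let ?F = "foldr (\<circ>) (map (\<lambda>i. birational_map (X (i - 1))) [1..<kappa l r + 1]) id S"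
  have X0: "X 0 = toric_variety (N_G l) faces"
    by (simp add: X_seq_def fan_seq_def)
  have sep: "separated (toric_variety (N_G l) faces)"
    using separated_X_seq[of 0] X0 by simp
  have F: "?F \<in> X 0 \<and> dominates S ?F"
  proof (rule birational_chain)
    show "birational_morphism (X (Suc i)) (X i)" if "i < kappa l r" for i
      using birational_morphism_X_seq[OF that] by simp
    show "separated (X i)" if "i < kappa l r" for i
      using separated_X_seq that by simp
    show "S \<in> X (kappa l r)" using assms X_seq_kappa by simp
  qed
  then show "\<exists>!R. R \<in> toric_variety (N_G l) faces \<and> dominates S R"
    using sep unfolding X0 separated_def by (intro ex1I[of _ ?F]) blast+
  show "birational_map (toric_variety (N_G l) faces) S = ?F"
    using F unfolding X0 by (intro birational_map_eq[OF sep]) blast+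
qed

end

end

theorem proposition9p2:
  fixes l :: nat
  assumes "CARD('n::{finite,linorder}) \<ge> 2"
    and "l \<ge> CARD('n)"
    and "l mod (CARD('n) - 1) \<in> {0, 1}"
  shows
    "triangulation_seq l (kappa l CARD('n)) = (full_triangulation l :: (real^'n::{finite,linorder}) set set)
     \<and> (\<forall>i < kappa l CARD('n).
          toric_compatible (fan_seq l (i + 1)) (fan_seq l i :: (real^'n::{finite,linorder}) set set)
          \<and> birational_morphism (X_seq l (i + 1)) (X_seq l i :: 'n ratfun set set))
     \<and> birational_morphism
          (toric_variety (N_G l) (fan_of (full_triangulation l)))
          (toric_variety (N_G l) \<Delta>_G :: 'n ratfun set set)
     \<and> (\<forall>S \<in> toric_variety (N_G l) (fan_of (full_triangulation l)) :: 'n ratfun set set.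
          birational_map (toric_variety (N_G l) \<Delta>_G) S
            = foldr (\<circ>) (map (\<lambda>i. birational_map (X_seq l (i - 1))) [1..<kappa l CARD('n) + 1]) id S)
     \<and> (\<forall>i < kappa l CARD('n).
          (X_seq l (i + 1) :: 'n ratfun set set)
            = normalization (blowup_red (center l i) (X_seq l i)))"
proof -
  interpret cyclic_type l "CARD('n)" "TYPE('n)" by standard (use assms in auto)
  show ?thesis
  proof (intro conjI allI impI ballI)
    show "triangulation_seq l (kappa l CARD('n)) = (full_triangulation l :: (real^'n::{finite,linorder}) set set)"
      by (rule triangulation_seq_kappa[OF assms(3)])
    show "birational_morphism
          (toric_variety (N_G l) (fan_of (full_triangulation l)))
          (toric_variety (N_G l) \<Delta>_G :: 'n ratfun set set)"
      unfolding birational_morphism_def using birational_map_composite(1)[OF assms(3)] by blast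
    fix i assume i: "i < kappa l CARD('n)"
    show "toric_compatible (fan_seq l (i + 1)) (fan_seq l i :: (real^'n::{finite,linorder}) set set)"
      by (rule toric_compatible_step[OF assms(3) i])
    show "birational_morphism (X_seq l (i + 1)) (X_seq l i :: 'n ratfun set set)"
      by (rule birational_morphism_X_seq[OF assms(3) i])
    show "(X_seq l (i + 1) :: 'n ratfun set set) = normalization (blowup_red (center l i) (X_seq l i))"
      by (rule X_seq_blowup[OF assms(3) i])
  next
    fix S :: "'n ratfun set" assume "S \<in> toric_variety (N_G l) (fan_of (full_triangulation l))"
    then show "birational_map (toric_variety (N_G l) \<Delta>_G) S
        = foldr (\<circ>) (map (\<lambda>i. birational_map (X_seq l (i - 1))) [1..<kappa l CARD('n) + 1]) id S"
      by (rule birational_map_composite(2)[OF assms(3)])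
  qed
qed

end
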